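(* Under the standing setting, let $\varrho$ be an intrinsic pseudo metric on $\mathcal V$ such that the weighted degree $\mathrm{Deg}$ is bounded on every distance ball $B_r(v)=\{u\in\mathcal V:\varrho(u,v)\le r\}$, $v\in\mathcal V$, $r\ge0$. Then the Kirchhoff Laplacian $\mathbf H_0$ is self-adjoint.
   Context: Standing setting: $\mathcal G_d=(\mathcal V,\mathcal E)$ is a graph with finite or countably infinite vertex and edge sets, connected, with no loops or multiple edges, locally finite ($1\le\deg(v)=\#\mathcal E_v<\infty$, $\mathcal E_v$ the edges incident to $v$); $u\sim v$ means $u,v$ are joined by an edge $e_{u,v}$. Each edge has length $|e|\in(0,\infty)$, $\sup_e|e|<\infty$, and is identified with $(0,|e|)$. $\mathbf H_0$ is the closure in $L^2(\mathcal G)=\bigoplus_eL^2(e)$ of $-d^2/dx^2$ (edgewise on $W^{2,2}(e)$) restricted to functions vanishing on all but finitely many edges and satisfying at every vertex $v$: $f_e(v)$ independent of $e\in\mathcal E_v$ and $\sum_{e\in\mathcal E_v}f_e'(v)=0$ ($f_e'(v)$ the derivative at $v$ in the direction into $e$). Weights: $m(v)=\sum_{e\in\mathcal E_v}|e|$, $b(u,v)=|e_{u,v}|^{-1}$ if $u\sim v$, $0$ otherwise; weighted degree $\mathrm{Deg}(v)=\frac1{m(v)}\sum_ub(u,v)$. A pseudo metric is a symmetric $\varrho:\mathcal V\times\mathcal V\to[0,\infty)$ with $\varrho(v,v)=0$ satisfying the triangle inequality; it is intrinsic if $\sum_{u}b(u,v)\varrho(u,v)^2\le m(v)$ for all $v\in\mathcal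 V$. *)

theory Defs
  imports "HOL-Analysis.Analysis"
begin

text \<open>Metric graph: vertex set V, edge set E of oriented pairs (u,v); the edge (u,v)
  is identified with the interval (0, len (u,v)), u sitting at 0 and v at len (u,v).
  Functions on the metric graph are maps f :: edge => real => complex (only the values
  on (0, len e) for e in E matter).\<close>

type_synonym 'v edge = "'v \<times> 'v"
type_synonym 'v gfun = "'v edge \<Rightarrow> real \<Rightarrow> complex"

definition adjacent :: "'v edge set \<Rightarrow> 'v \<Rightarrow> 'v \<Rightarrow> bool" where
  "adjacent E u v \<longleftrightarrow> (u, v) \<in> E \<or> (v, u) \<in> E"

definition incident_edges :: "'v edge set \<Rightarrow> 'v \<Rightarrow> 'v edge set" where
  "incident_edges E v = {e \<in> E. fst e = v \<or> snd e = v}"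

definition neighbours :: "'v edge set \<Rightarrow> 'v \<Rightarrow> 'v set" where
  "neighbours E v = {u. adjacent E u v}"

text \<open>Standing setting.\<close>
definition metric_graph :: "'v set \<Rightarrow> 'v edge set \<Rightarrow> ('v edge \<Rightarrow> real) \<Rightarrow> bool" where
  "metric_graph V E len \<longleftrightarrow>
     countable V \<and> E \<subseteq> V \<times> V \<and>
     (\<forall>(u, v) \<in> E. u \<noteq> v \<and> (v, u) \<notin> E) \<and>
     (\<forall>u \<in> V. \<forall>v \<in> V. (u, v) \<in> {(x, y). adjacent E x y}\<^sup>*) \<and>
     (\<forall>v \<in> V. finite (incident_edges E v) \<and> card (incident_edges E v) \<ge> 1) \<and>
     (\<forall>e \<in> E. len e > 0) \<and> (\<exists>C. \<forall>e \<in> E. len e \<le> C)"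

text \<open>Edge length of the edge joining u and v (whatever its orientation).\<close>
definition elen :: "'v edge set \<Rightarrow> ('v edge \<Rightarrow> real) \<Rightarrow> 'v \<Rightarrow> 'v \<Rightarrow> real" where
  "elen E len u v = (if (u, v) \<in> E then len (u, v) else len (v, u))"

definition vm :: "'v edge set \<Rightarrow> ('v edge \<Rightarrow> real) \<Rightarrow> 'v \<Rightarrow> real" where
  "vm E len v = (\<Sum>e \<in> incident_edges E v. len e)"

definition wb :: "'v edge set \<Rightarrow> ('v edge \<Rightarrow> real) \<Rightarrow> 'v \<Rightarrow> 'v \<Rightarrow> real" where
  "wb E len u v = (if adjacent E u v then 1 / elen E len u v else 0)"

definition wDeg :: "'v edge set \<Rightarrow> ('v edge \<Rightarrow> real) \<Rightarrow> 'v \<Rightarrow> real" where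
  "wDeg E len v = (1 / vm E len v) * (\<Sum>u \<in> neighbours E v. wb E len u v)"

definition pseudo_metric :: "'v set \<Rightarrow> ('v \<Rightarrow> 'v \<Rightarrow> real) \<Rightarrow> bool" where
  "pseudo_metric V \<rho> \<longleftrightarrow>
     (\<forall>u \<in> V. \<forall>v \<in> V. \<rho> u v \<ge> 0 \<and> \<rho> u v = \<rho> v u) \<and> (\<forall>v \<in> V. \<rho> v v = 0) \<and>
     (\<forall>u \<in> V. \<forall>v \<in> V. \<forall>w \<in> V. \<rho> u w \<le> \<rho> u v + \<rho> v w)"

definition intrinsic :: "'v set \<Rightarrow> 'v edge set \<Rightarrow> ('v edge \<Rightarrow> real) \<Rightarrow> ('v \<Rightarrow> 'v \<Rightarrow> real) \<Rightarrow> bool" where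
  "intrinsic V E len \<rho> \<longleftrightarrow>
     pseudo_metric V \<rho> \<and>
     (\<forall>v \<in> V. (\<Sum>u \<in> neighbours E v. wb E len u v * (\<rho> u v)\<^sup>2) \<le> vm E len v)"

definition dball :: "'v set \<Rightarrow> ('v \<Rightarrow> 'v \<Rightarrow> real) \<Rightarrow> real \<Rightarrow> 'v \<Rightarrow> 'v set" where
  "dball V \<rho> r v = {u \<in> V. \<rho> u v \<le> r}"

text \<open>The Hilbert space L^2(G) = direct sum of L^2(e) (functions up to a.e. equality).\<close>
definition edge_int :: "('v edge \<Rightarrow> real) \<Rightarrow> 'v edge \<Rightarrow> (real \<Rightarrow> 'b::{banach,second_countable_topology}) \<Rightarrow> 'b" where
  "edge_int len e \<phi> = (LINT x:{0<..<len e}|lborel. \<phi> x)"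

definition L2G :: "'v edge set \<Rightarrow> ('v edge \<Rightarrow> real) \<Rightarrow> 'v gfun \<Rightarrow> bool" where
  "L2G E len f \<longleftrightarrow>
     (\<forall>e \<in> E. set_borel_measurable lborel {0<..<len e} (f e) \<and>
              set_integrable lborel {0<..<len e} (\<lambda>x. (cmod (f e x))\<^sup>2)) \<and>
     (\<lambda>e. edge_int len e (\<lambda>x. (cmod (f e x))\<^sup>2)) summable_on E"

definition L2inner :: "'v edge set \<Rightarrow> ('v edge \<Rightarrow> real) \<Rightarrow> 'v gfun \<Rightarrow> 'v gfun \<Rightarrow> complex" where
  "L2inner E len f g = (\<Sum>\<^sub>\<infinity>e \<in> E. edge_int len e (\<lambda>x. f e x * cnj (g e x)))"

definition L2norm :: "'v edge set \<Rightarrow> ('v edge \<Rightarrow> real) \<Rightarrow> 'v gfun \<Rightarrow> real" where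
  "L2norm E len f = sqrt (\<Sum>\<^sub>\<infinity>e \<in> E. edge_int len e (\<lambda>x. (cmod (f e x))\<^sup>2))"

definition L2dist :: "'v edge set \<Rightarrow> ('v edge \<Rightarrow> real) \<Rightarrow> 'v gfun \<Rightarrow> 'v gfun \<Rightarrow> real" where
  "L2dist E len f g = L2norm E len (\<lambda>e x. f e x - g e x)"

text \<open>Linear operators in L^2(G) are handled through their graphs (sets of pairs (f, T f)).\<close>
definition graph_closure :: "'v edge set \<Rightarrow> ('v edge \<Rightarrow> real) \<Rightarrow> ('v gfun \<times> 'v gfun) set \<Rightarrow> ('v gfun \<times> 'v gfun) set" where
  "graph_closure E len R = {(f, g). L2G E len f \<and> L2G E len g \<and>
     (\<exists>F G. (\<forall>n. (F n, G n) \<in> R) \<and>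
        (\<lambda>n. L2dist E len (F n) f) \<longlonglongrightarrow> 0 \<and> (\<lambda>n. L2dist E len (G n) g) \<longlonglongrightarrow> 0)}"

definition graph_adjoint :: "'v edge set \<Rightarrow> ('v edge \<Rightarrow> real) \<Rightarrow> ('v gfun \<times> 'v gfun) set \<Rightarrow> ('v gfun \<times> 'v gfun) set" where
  "graph_adjoint E len R = {(h, k). L2G E len h \<and> L2G E len k \<and>
     (\<forall>(f, g) \<in> R. L2inner E len g h = L2inner E len f k)}"

definition densely_defined :: "'v edge set \<Rightarrow> ('v edge \<Rightarrow> real) \<Rightarrow> ('v gfun \<times> 'v gfun) set \<Rightarrow> bool" where
  "densely_defined E len R \<longleftrightarrow>
     (\<forall>f. L2G E len f \<longrightarrow> (\<forall>\<epsilon>>0. \<exists>(u, w) \<in> R. L2dist E len u f < \<epsilon>))"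

text \<open>Self-adjoint: densely defined and equal to its adjoint (as graphs).\<close>
definition self_adjoint_op :: "'v edge set \<Rightarrow> ('v edge \<Rightarrow> real) \<Rightarrow> ('v gfun \<times> 'v gfun) set \<Rightarrow> bool" where
  "self_adjoint_op E len R \<longleftrightarrow> densely_defined E len R \<and> graph_adjoint E len R = R"

text \<open>W^{2,2}(0,l): phi x = a + b x + int_0^x int_0^t g, with g in L^2(0,l); then
  phi'(0) = b, phi'(l) = b + int_0^l g, phi'' = g a.e.\<close>
definition sq_int :: "real \<Rightarrow> (real \<Rightarrow> complex) \<Rightarrow> bool" where
  "sq_int l g \<longleftrightarrow> set_borel_measurable lborel {0<..<l} g \<and>
                   set_integrable lborel {0<..<l} (\<lambda>x. (cmod (g x))\<^sup>2)"

text \<open>Pre-minimal Kirchhoff Laplacian: pairs (f, -f'') with f_e in W^{2,2}(e),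
  f vanishing on all but finitely many edges, continuity and Kirchhoff conditions at every
  vertex.  Value of f_e at the vertex v: f e 0 if v is the initial vertex of e, f e (len e)
  otherwise; derivative at v in the direction into e: b e resp. -(b e + int_0^l g e).\<close>
definition kirchhoff_core :: "'v set \<Rightarrow> 'v edge set \<Rightarrow> ('v edge \<Rightarrow> real) \<Rightarrow> ('v gfun \<times> 'v gfun) set" where
  "kirchhoff_core V E len = {(f, h). \<exists>(a :: 'v edge \<Rightarrow> complex) (b :: 'v edge \<Rightarrow> complex) (g :: 'v gfun).
     finite {e \<in> E. \<exists>x \<in> {0..len e}. f e x \<noteq> 0} \<and>
     (\<forall>e \<in> E. sq_int (len e) (g e) \<and>
        (\<forall>x \<in> {0..len e}. f e x = a e + b e * of_real x +
             (LINT t:{0..x}|lborel. (LINT s:{0..t}|lborel. g e s))) \<and>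
        (\<forall>x \<in> {0<..<len e}. h e x = - g e x)) \<and>
     (\<forall>v \<in> V. \<forall>e \<in> incident_edges E v. \<forall>e' \<in> incident_edges E v.
        (if fst e = v then f e 0 else f e (len e)) = (if fst e' = v then f e' 0 else f e' (len e'))) \<and>
     (\<forall>v \<in> V. (\<Sum>e \<in> incident_edges E v.
        (if fst e = v then b e else - (b e + (LINT s:{0..len e}|lborel. g e s)))) = 0)}"

text \<open>H_0 = closure of the pre-minimal operator.\<close>
definition H0 :: "'v set \<Rightarrow> 'v edge set \<Rightarrow> ('v edge \<Rightarrow> real) \<Rightarrow> ('v gfun \<times> 'v gfun) set" where
  "H0 V E len = graph_closure E len (kirchhoff_core V E len)"

end

theory Submission
  imports Defs
begin

text \<open>The core operator is symmetric and nonnegative, so it is essentially self-adjoint once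
  \<open>1 - d\<^sup>2/dx\<^sup>2\<close> maps the core onto a dense subspace. An element \<open>z\<close> of the orthogonal complement of that
  range solves \<open>z'' = z\<close> on every edge together with the Kirchhoff conditions; its vertex values
  satisfy a discrete equation with edge weights at most \<open>1/|e|\<close> and a potential that is bounded
  below by a multiple of \<open>m\<close>. Testing this equation with cutoffs built from the intrinsic metric, as
  in the proof of Gaffney's theorem, bounds \<open>m(v)|z(v)|\<^sup>2\<close> by \<open>O(1/R\<^sup>2)\<close>, hence \<open>z = 0\<close>. Distance balls may be
  infinite: boundedness of \<open>Deg\<close> on them makes the sums over the support of a cutoff converge, which
  allows its truncation to finite vertex sets.\<close>

section \<open>Square-integrable functions over a measure\<close>

text \<open>Nonnegativity is what makes a single real spectral point enough: on the core
  \<open>norm f \<le> norm (f + h)\<close>, so the two deficiency spaces at plus and minus i are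
  replaced by the solutions of \<open>z'' = z\<close>, which are explicit hyperbolic functions. On
  an edge of length \<open>l\<close>, the derivatives at the ends expressed through the end values
  give the weight \<open>1 / sinh l\<close> and the potential \<open>tanh (l/2)\<close>. Bounded
  edge lengths yield \<open>tanh (l/2) \<ge> c * l\<close> with one \<open>c\<close> for all edges,
  and a trace inequality that turns square integrability of \<open>z\<close> into summability of
  \<open>m(v) |z(v)|^2\<close>. Both match the normalisation of an intrinsic metric, whose energy at
  a vertex is at most \<open>m(v)\<close>. The obstacle is that truncating a cutoff to a finite set
  creates jumps across edges that the metric does not control. The truncation is placed so that
  these jumps occur only where the mass of \<open>z\<close> is at most \<open>\<epsilon>\<close>;
  they are then paid for by the bound on \<open>Deg\<close>. Since that bound depends on the radius
  \<open>R\<close>, \<open>\<epsilon>\<close> has to tend to 0 before \<open>R\<close> tends to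
  infinity.\<close>

definition L2_on :: "'a measure \<Rightarrow> ('a \<Rightarrow> complex) \<Rightarrow> bool" where
  "L2_on M f \<longleftrightarrow> f \<in> borel_measurable M \<and> integrable M (\<lambda>x. (cmod (f x))\<^sup>2)"

definition l2_prod :: "'a measure \<Rightarrow> ('a \<Rightarrow> complex) \<Rightarrow> ('a \<Rightarrow> complex) \<Rightarrow> complex" where
  "l2_prod M f g = (LINT x|M. f x * cnj (g x))"

definition l2_sq :: "'a measure \<Rightarrow> ('a \<Rightarrow> complex) \<Rightarrow> real" where
  "l2_sq M f = (LINT x|M. (cmod (f x))\<^sup>2)"

lemma cmod_add_sq_le: "(cmod (a + b))\<^sup>2 \<le> 2 * (cmod a)\<^sup>2 + 2 * (cmod b)\<^sup>2"
proof -
  have "(cmod (a + b))\<^sup>2 \<le> (cmod a + cmod b)\<^sup>2"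
    by (intro power_mono norm_triangle_ineq) auto
  also have "\<dots> \<le> 2 * (cmod a)\<^sup>2 + 2 * (cmod b)\<^sup>2"
    using zero_le_power2[of "cmod a - cmod b"] by (simp add: power2_eq_square algebra_simps)
  finally show ?thesis .
qed

lemma borel_measurable_cnj [measurable (raw)]:
  "f \<in> borel_measurable M \<Longrightarrow> (\<lambda>x. cnj (f x)) \<in> borel_measurable M"
  by (rule borel_measurable_continuous_on[where f = cnj]) (intro continuous_intros)

lemma L2_on_add: assumes "L2_on M f" "L2_on M g" shows "L2_on M (\<lambda>x. f x + g x)"
proof -
  have [measurable]: "f \<in> borel_measurable M" "g \<in> borel_measurable M"
    using assms by (auto simp: L2_on_def)
  have "integrable M (\<lambda>x. 2 * (cmod (f x))\<^sup>2 + 2 * (cmod (g x))\<^sup>2)"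
    using assms by (auto simp: L2_on_def)
  then have "integrable M (\<lambda>x. (cmod (f x + g x))\<^sup>2)"
    by (rule Bochner_Integration.integrable_bound)
       (auto intro!: AE_I2 order_trans[OF cmod_add_sq_le])
  then show ?thesis by (simp add: L2_on_def)
qed

lemma L2_on_cmult: "L2_on M f \<Longrightarrow> L2_on M (\<lambda>x. c * f x)"
  by (auto simp: L2_on_def norm_mult power_mult_distrib)

lemma L2_on_diff: "L2_on M f \<Longrightarrow> L2_on M g \<Longrightarrow> L2_on M (\<lambda>x. f x - g x)"
  using L2_on_add[of M f "\<lambda>x. (-1) * g x"] L2_on_cmult[of M g "-1"] by simp

lemma integrable_mult_cnj: assumes "L2_on M f" "L2_on M g" shows "integrable M (\<lambda>x. f x * cnj (g x))"
proof -
  have [measurable]: "f \<in> borel_measurable M" "g \<in> borel_measurable M"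
    using assms by (auto simp: L2_on_def)
  have "integrable M (\<lambda>x. (cmod (f x))\<^sup>2 + (cmod (g x))\<^sup>2)"
    using assms by (auto simp: L2_on_def)
  moreover have "cmod (a * cnj b) \<le> (cmod a)\<^sup>2 + (cmod b)\<^sup>2" for a b
  proof -
    have "0 \<le> (cmod a - cmod b)\<^sup>2 + (cmod a)\<^sup>2 + (cmod b)\<^sup>2" by simp
    then show ?thesis by (simp add: norm_mult power2_eq_square algebra_simps)
  qed
  ultimately show ?thesis
    by (elim Bochner_Integration.integrable_bound) (auto intro!: AE_I2)
qed

lemma l2_sq_nonneg [simp]: "0 \<le> l2_sq M f"
  by (simp add: l2_sq_def)

lemma l2_prod_self: "l2_prod M f f = of_real (l2_sq M f)"
proof -
  have "l2_prod M f f = (LINT x|M. complex_of_real ((cmod (f x))\<^sup>2))"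
    unfolding l2_prod_def by (simp only: complex_norm_square)
  then show ?thesis by (simp only: l2_sq_def integral_complex_of_real)
qed

lemma l2_prod_cnj: "l2_prod M g f = cnj (l2_prod M f g)"
  unfolding l2_prod_def Bochner_Integration.integral_cnj[symmetric] by (simp add: mult.commute)

lemma l2_prod_add_left: "L2_on M f \<Longrightarrow> L2_on M g \<Longrightarrow> L2_on M h \<Longrightarrow> l2_prod M (\<lambda>x. f x + g x) h = l2_prod M f h + l2_prod M g h"
  by (simp add: l2_prod_def distrib_right integrable_mult_cnj)

lemma l2_prod_diff_left: "L2_on M f \<Longrightarrow> L2_on M g \<Longrightarrow> L2_on M h \<Longrightarrow> l2_prod M (\<lambda>x. f x - g x) h = l2_prod M f h - l2_prod M g h"
  by (simp add: l2_prod_def left_diff_distrib integrable_mult_cnj)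

lemma l2_prod_cmult_left: "l2_prod M (\<lambda>x. c * f x) h = c * l2_prod M f h"
  by (simp add: l2_prod_def mult.assoc)

lemma l2_prod_add_right: "L2_on M f \<Longrightarrow> L2_on M g \<Longrightarrow> L2_on M h \<Longrightarrow> l2_prod M h (\<lambda>x. f x + g x) = l2_prod M h f + l2_prod M h g"
  by (simp add: l2_prod_def distrib_left integrable_mult_cnj)

lemma l2_prod_diff_right: "L2_on M f \<Longrightarrow> L2_on M g \<Longrightarrow> L2_on M h \<Longrightarrow> l2_prod M h (\<lambda>x. f x - g x) = l2_prod M h f - l2_prod M h g"
  by (simp add: l2_prod_def right_diff_distrib integrable_mult_cnj)

lemma l2_prod_cmult_right: "l2_prod M h (\<lambda>x. c * f x) = cnj c * l2_prod M h f"
  by (simp add: l2_prod_def mult.left_commute)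

lemma l2_sq_add:
  assumes "L2_on M f" "L2_on M g"
  shows "l2_sq M (\<lambda>x. f x + g x) = l2_sq M f + l2_sq M g + 2 * Re (l2_prod M f g)"
proof -
  have "l2_prod M (\<lambda>x. f x + g x) (\<lambda>x. f x + g x) = l2_prod M f f + l2_prod M g f + (l2_prod M f g + l2_prod M g g)"
    using assms by (simp add: l2_prod_add_left l2_prod_add_right L2_on_add)
  moreover have "Re (l2_prod M g f) = Re (l2_prod M f g)"
    by (subst l2_prod_cnj) simp
  ultimately have "Re (l2_prod M (\<lambda>x. f x + g x) (\<lambda>x. f x + g x)) = Re (l2_prod M f f) + Re (l2_prod M g g) + 2 * Re (l2_prod M f g)"
    by simp
  then show ?thesis unfolding l2_prod_self by simp
qed

lemma l2_sq_cmult: "l2_sq M (\<lambda>x. c * f x) = (cmod c)\<^sup>2 * l2_sq M f"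
  by (simp add: l2_sq_def norm_mult power_mult_distrib)

lemma l2_sq_diff:
  assumes "L2_on M f" "L2_on M g"
  shows "l2_sq M (\<lambda>x. f x - g x) = l2_sq M f + l2_sq M g - 2 * Re (l2_prod M f g)"
proof -
  have "l2_prod M (\<lambda>x. f x - g x) (\<lambda>x. f x - g x) = l2_prod M f f - l2_prod M g f - (l2_prod M f g - l2_prod M g g)"
    using assms by (simp add: l2_prod_diff_left l2_prod_diff_right L2_on_diff)
  moreover have "Re (l2_prod M g f) = Re (l2_prod M f g)"
    by (subst l2_prod_cnj) simp
  ultimately have "Re (l2_prod M (\<lambda>x. f x - g x) (\<lambda>x. f x - g x)) = Re (l2_prod M f f) + Re (l2_prod M g g) - 2 * Re (l2_prod M f g)"
    by simp
  then show ?thesis unfolding l2_prod_self by simp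
qed

lemma l2_sq_diff_commute: "l2_sq M (\<lambda>x. f x - g x) = l2_sq M (\<lambda>x. g x - f x)"
  by (simp add: l2_sq_def norm_minus_commute)

lemma l2_sq_parallelogram:
  assumes "L2_on M f" "L2_on M g"
  shows "l2_sq M (\<lambda>x. f x + g x) + l2_sq M (\<lambda>x. f x - g x) = 2 * l2_sq M f + 2 * l2_sq M g"
  using l2_sq_add[OF assms] l2_sq_diff[OF assms] by simp

lemma l2_sq_add_le:
  assumes "L2_on M f" "L2_on M g"
  shows "l2_sq M (\<lambda>x. f x + g x) \<le> 2 * l2_sq M f + 2 * l2_sq M g"
  using l2_sq_parallelogram[OF assms] l2_sq_nonneg[of M "\<lambda>x. f x - g x"] by linarith

text \<open>Near-minimality gives near-orthogonality: substituting
  \<open>c = t * l2_prod M f g\<close> makes the hypothesis a quadratic inequality in the real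
  number \<open>t\<close>. With \<open>d = l2_sq M f\<close> the hypothesis is void and the bound is
  Cauchy-Schwarz; with \<open>d\<close> the excess of a minimizing sequence it makes the limiting
  residual orthogonal to the subspace.\<close>

lemma l2_prod_bound_of_l2_sq_bound:
  assumes f: "L2_on M f" and g: "L2_on M g" and d: "d \<ge> 0"
    and b: "\<And>c. l2_sq M f - d \<le> l2_sq M (\<lambda>x. f x - c * g x)"
  shows "(cmod (l2_prod M f g))\<^sup>2 \<le> d * l2_sq M g"
proof -
  let ?I = "l2_prod M f g"
  have *: "2 * t * (cmod ?I)\<^sup>2 \<le> d + t\<^sup>2 * (cmod ?I)\<^sup>2 * l2_sq M g" for t :: real
  proof -
    have "l2_sq M (\<lambda>x. f x - (of_real t * ?I) * g x)
        = l2_sq M f + l2_sq M (\<lambda>x. (of_real t * ?I) * g x) - 2 * Re (l2_prod M f (\<lambda>x. (of_real t * ?I) * g x))"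
      by (rule l2_sq_diff[OF f L2_on_cmult[OF g]])
    also have "l2_prod M f (\<lambda>x. (of_real t * ?I) * g x) = of_real (t * (cmod ?I)\<^sup>2)"
      unfolding l2_prod_cmult_right using complex_norm_square[of ?I] by (simp add: mult.commute mult.left_commute)
    finally show ?thesis
      using b[of "of_real t * ?I"] by (simp add: l2_sq_cmult norm_mult power_mult_distrib)
  qed
  show ?thesis
  proof (cases "l2_sq M g = 0")
    \<comment> \<open>For \<open>g\<close> of norm zero the quadratic term disappears, and the large
      value \<open>(d + 1) / |I|^2\<close> of \<open>t\<close> contradicts the bound; in the other
      case \<open>t = 1 / l2_sq M g\<close> is the optimal choice.\<close>
    case True
    have "(cmod ?I)\<^sup>2 \<le> 0"
    proof (rule ccontr)
      assume n: "\<not> ?thesis"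
      then have "(cmod ?I)\<^sup>2 > 0" by simp
      then have "2 * ((d + 1) / (cmod ?I)\<^sup>2) * (cmod ?I)\<^sup>2 = 2 * (d + 1)" by simp
      with *[of "(d + 1) / (cmod ?I)\<^sup>2"] True d show False by simp
    qed
    then show ?thesis using True by simp
  next
    case False
    then have p: "l2_sq M g > 0" using l2_sq_nonneg[of M g] by linarith
    have "2 * (cmod ?I)\<^sup>2 / l2_sq M g \<le> d + (cmod ?I)\<^sup>2 / l2_sq M g"
      using *[of "1 / l2_sq M g"] p by (simp add: power2_eq_square field_simps)
    then show ?thesis using p by (simp add: field_simps)
  qed
qed

lemma l2_prod_Cauchy_Schwarz:
  assumes f: "L2_on M f" and g: "L2_on M g"
  shows "(cmod (l2_prod M f g))\<^sup>2 \<le> l2_sq M f * l2_sq M g"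
  using l2_prod_bound_of_l2_sq_bound[OF f g l2_sq_nonneg[of M f]] by simp

lemma l2_prod_tendsto_left:
  assumes "\<And>n. L2_on M (f n)" "L2_on M f'" "L2_on M g" "(\<lambda>n. l2_sq M (\<lambda>x. f n x - f' x)) \<longlonglongrightarrow> 0"
  shows "(\<lambda>n. l2_prod M (f n) g) \<longlonglongrightarrow> l2_prod M f' g"
proof -
  have "(\<lambda>n. sqrt (l2_sq M (\<lambda>x. f n x - f' x) * l2_sq M g)) \<longlonglongrightarrow> sqrt (0 * l2_sq M g)"
    by (intro tendsto_intros assms)
  then have l: "(\<lambda>n. sqrt (l2_sq M (\<lambda>x. f n x - f' x) * l2_sq M g)) \<longlonglongrightarrow> 0" by simp
  have "norm (l2_prod M (f n) g - l2_prod M f' g) \<le> sqrt (l2_sq M (\<lambda>x. f n x - f' x) * l2_sq M g)" for n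
    using l2_prod_Cauchy_Schwarz[OF L2_on_diff[OF assms(1)[of n] assms(2)] assms(3)]
    by (simp add: l2_prod_diff_left assms real_le_rsqrt)
  then have "(\<lambda>n. l2_prod M (f n) g - l2_prod M f' g) \<longlonglongrightarrow> 0"
    by (intro Lim_null_comparison[OF _ l]) auto
  then show ?thesis by (simp add: LIM_zero_iff)
qed

section \<open>Completeness and orthogonal projection\<close>

lemma summable_diff_imp_convergent:
  fixes f :: "nat \<Rightarrow> 'a::banach"
  assumes "summable (\<lambda>n. norm (f (Suc n) - f n))"
  shows "convergent f"
proof -
  have "summable (\<lambda>n. f (Suc n) - f n)"
    using assms by (rule summable_norm_cancel)
  then have "convergent (\<lambda>n. \<Sum>i<n. f (Suc i) - f i)"
    by (simp add: summable_iff_convergent)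
  then have "convergent (\<lambda>n. f n - f 0)"
    by (simp add: sum_lessThan_telescope)
  then show ?thesis
    using convergent_add[OF _ convergent_const[of "f 0"]] by fastforce
qed

text \<open>The geometric rate makes \<open>\<Sum>k. 4 ^ k * \<bar>f (k+1) - f k\<bar>\<^sup>2\<close> integrable, hence the
  sequence converges almost everywhere; Fatou's lemma upgrades this to convergence in \<open>L\<^sup>2\<close>.\<close>

lemma L2_on_complete:
  assumes f: "\<And>n. L2_on M (f n)"
    and b: "\<And>n m. n \<le> m \<Longrightarrow> l2_sq M (\<lambda>x. f m x - f n x) \<le> (1/8)^n"
  shows "\<exists>g. L2_on M g \<and> (\<lambda>n. l2_sq M (\<lambda>x. f n x - g x)) \<longlonglongrightarrow> 0"
proof -
  have [measurable]: "f n \<in> borel_measurable M" for n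
    using f by (simp add: L2_on_def)
  have nn: "(\<integral>\<^sup>+x. ennreal ((cmod (f m x - f n x))\<^sup>2) \<partial>M) = ennreal (l2_sq M (\<lambda>x. f m x - f n x))" for m n
    unfolding l2_sq_def using L2_on_diff[OF f f, of m n]
    by (intro nn_integral_eq_integral) (auto simp: L2_on_def)
  \<comment> \<open>The weight \<open>4^k\<close> is the square of \<open>2^k\<close>, so mere
    boundedness of \<open>d k x\<close> in \<open>k\<close> makes the increments of \<open>f\<close>
    decay like \<open>2^-k\<close>; the rate \<open>1/8\<close> of the hypothesis leaves
    \<open>(1/2)^k\<close> for the integrals.\<close>
  define d where "d k x = 4^k * (cmod (f (Suc k) x - f k x))\<^sup>2" for k x
  have [measurable]: "d k \<in> borel_measurable M" for k unfolding d_def by simp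
  have d0: "d k x \<ge> 0" for k x by (simp add: d_def)
  have "(\<integral>\<^sup>+x. (\<Sum>k. ennreal (d k x)) \<partial>M) = (\<Sum>k. \<integral>\<^sup>+x. ennreal (d k x) \<partial>M)"
    by (rule nn_integral_suminf) simp
  also have "\<dots> \<le> (\<Sum>k. ennreal ((1/2)^k))"
  proof (intro suminf_le summableI)
    fix k
    have "(\<integral>\<^sup>+x. ennreal (d k x) \<partial>M) = ennreal (4^k) * (\<integral>\<^sup>+x. ennreal ((cmod (f (Suc k) x - f k x))\<^sup>2) \<partial>M)"
      unfolding d_def by (subst nn_integral_cmult[symmetric]) (auto simp: ennreal_mult)
    also have "\<dots> = ennreal (4^k * l2_sq M (\<lambda>x. f (Suc k) x - f k x))"
      unfolding nn by (simp add: ennreal_mult)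
    also have "\<dots> \<le> ennreal (4^k * (1/8)^k)"
      by (intro ennreal_leI mult_left_mono b) auto
    also have "4^k * (1/8::real)^k = (1/2)^k"
      by (simp flip: power_mult_distrib)
    finally show "(\<integral>\<^sup>+x. ennreal (d k x) \<partial>M) \<le> ennreal ((1/2)^k)" .
  qed
  also have "\<dots> = ennreal (\<Sum>k. (1/2)^k)"
    by (intro suminf_ennreal2 summable_geometric) auto
  also have "\<dots> < \<infinity>" by simp
  finally have "(\<integral>\<^sup>+x. (\<Sum>k. ennreal (d k x)) \<partial>M) \<noteq> \<infinity>" by simp
  then have "AE x in M. (\<Sum>k. ennreal (d k x)) \<noteq> \<infinity>"
    by (intro nn_integral_PInf_AE) auto
  then have conv: "AE x in M. convergent (\<lambda>n. f n x)"
  proof eventually_elim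
    case (elim x)
    then have "summable (\<lambda>k. d k x)"
      using d0 by (intro summable_suminf_not_top) auto
    then have "Bseq (\<lambda>k. d k x)"
      by (intro convergent_imp_Bseq) (auto dest: summable_LIMSEQ_zero simp: convergent_def)
    then obtain B where B: "B > 0" "\<And>k. \<bar>d k x\<bar> \<le> B"
      unfolding Bseq_def by auto
    have le: "cmod (f (Suc k) x - f k x) \<le> sqrt B * (1/2)^k" for k
    proof -
      have "(2^k * cmod (f (Suc k) x - f k x))\<^sup>2 = d k x"
      proof -
        have "(4::real)^k = (2^k)\<^sup>2" by (simp add: power2_eq_square flip: power_mult_distrib)
        then show ?thesis by (simp add: d_def power_mult_distrib)
      qed
      also have "\<dots> \<le> B" using B(2)[of k] by simp
      finally have "2^k * cmod (f (Suc k) x - f k x) \<le> sqrt B"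
        by (rule real_le_rsqrt)
      then show ?thesis by (simp add: field_simps)
    qed
    have "summable (\<lambda>k. norm (f (Suc k) x - f k x))"
      by (rule summable_comparison_test'[where g = "\<lambda>k. sqrt B * (1/2)^k" and N = 0])
         (use le in \<open>auto intro!: summable_mult summable_geometric\<close>)
    then show ?case by (rule summable_diff_imp_convergent)
  qed
  define g where "g x = lim (\<lambda>n. f n x)" for x
  have [measurable]: "g \<in> borel_measurable M" unfolding g_def by simp
  have nb: "(\<integral>\<^sup>+x. ennreal ((cmod (f n x - g x))\<^sup>2) \<partial>M) \<le> ennreal ((1/8)^n)" for n
  proof -
    have "(\<integral>\<^sup>+x. ennreal ((cmod (f n x - g x))\<^sup>2) \<partial>M)
        = (\<integral>\<^sup>+x. liminf (\<lambda>m. ennreal ((cmod (f m x - f n x))\<^sup>2)) \<partial>M)"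
    proof (rule nn_integral_cong_AE, use conv in eventually_elim)
      case (elim x)
      then have "(\<lambda>m. f m x) \<longlonglongrightarrow> g x" by (simp add: g_def convergent_LIMSEQ_iff)
      then have "(\<lambda>m. ennreal ((cmod (f m x - f n x))\<^sup>2)) \<longlonglongrightarrow> ennreal ((cmod (g x - f n x))\<^sup>2)"
        by (intro tendsto_intros)
      then have "liminf (\<lambda>m. ennreal ((cmod (f m x - f n x))\<^sup>2)) = ennreal ((cmod (g x - f n x))\<^sup>2)"
        by (intro lim_imp_Liminf) auto
      then show ?case by (simp add: norm_minus_commute)
    qed
    also have "\<dots> \<le> liminf (\<lambda>m. \<integral>\<^sup>+x. ennreal ((cmod (f m x - f n x))\<^sup>2) \<partial>M)"
      by (rule nn_integral_liminf) simp
    also have "\<dots> \<le> liminf (\<lambda>m. ennreal ((1/8)^n))"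
      unfolding nn
      by (intro Liminf_mono eventually_sequentiallyI[of n] ennreal_leI b)
    finally show ?thesis by (simp add: Liminf_const)
  qed
  have sd: "L2_on M (\<lambda>x. f n x - g x)" for n
    unfolding L2_on_def
    by (auto intro!: integrableI_bounded le_less_trans[OF nb[of n]])
  have "L2_on M g"
    using L2_on_diff[OF f[of 0] sd[of 0]] by simp
  moreover have "l2_sq M (\<lambda>x. f n x - g x) \<le> (1/8)^n" for n
  proof -
    have "ennreal (l2_sq M (\<lambda>x. f n x - g x)) \<le> ennreal ((1/8)^n)"
      using nb[of n] sd[of n] unfolding l2_sq_def
      by (subst nn_integral_eq_integral[symmetric]) (auto simp: L2_on_def)
    then show ?thesis by simp
  qed
  then have "(\<lambda>n. l2_sq M (\<lambda>x. f n x - g x)) \<longlonglongrightarrow> 0"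
    by (intro Lim_null_comparison[OF _ LIMSEQ_power_zero[of "1/8::real"]]) auto
  ultimately show ?thesis by blast
qed

text \<open>The residuals of a minimizing sequence converge to some \<open>z\<close> orthogonal to
  \<open>S\<close>; once \<open>w\<close> is orthogonal to \<open>z\<close> as well, all residuals
  are, and so is their limit \<open>z\<close> itself, hence \<open>z\<close> has norm zero. The
  hypothesis asks for \<open>l2_prod M w z = 0\<close> and not for \<open>z = 0\<close> because the
  lemma is applied in \<open>edgeM E\<close>, where a function living outside the edge intervals is
  orthogonal to all flattened functions without vanishing.\<close>

lemma subspace_dense_if_orthogonal_trivial:
  assumes S: "\<And>s. s \<in> S \<Longrightarrow> L2_on M s"
    and comb: "\<And>s t c. s \<in> S \<Longrightarrow> t \<in> S \<Longrightarrow> (\<lambda>x. s x + c * t x) \<in> S"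
    and ne: "S \<noteq> {}"
    and w: "L2_on M w"
    and orth: "\<And>z. L2_on M z \<Longrightarrow> (\<And>s. s \<in> S \<Longrightarrow> l2_prod M s z = 0) \<Longrightarrow> l2_prod M w z = 0"
    and e: "\<epsilon> > 0"
  shows "\<exists>s\<in>S. l2_sq M (\<lambda>x. s x - w x) < \<epsilon>"
proof -
  define D where "D = Inf ((\<lambda>s. l2_sq M (\<lambda>x. w x - s x)) ` S)"
  have bdd: "bdd_below ((\<lambda>s. l2_sq M (\<lambda>x. w x - s x)) ` S)"
    by (auto intro!: bdd_belowI2[of _ 0])
  have D: "D \<le> l2_sq M (\<lambda>x. w x - s x)" if "s \<in> S" for s
    unfolding D_def using that by (intro cINF_lower bdd)
  \<comment> \<open>By the parallelogram law the excess \<open>(1/8)^n / 4\<close> gives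
    \<open>(1/8)^n\<close> for the squared distance of two residuals, the rate required by
    \<open>L2_on_complete\<close>.\<close>
  have "\<exists>s\<in>S. l2_sq M (\<lambda>x. w x - s x) < D + (1/8)^n / 4" for n
    unfolding D_def
    using cInf_lessD[of "(\<lambda>s. l2_sq M (\<lambda>x. w x - s x)) ` S" "D + (1/8)^n / 4"] ne
    by (auto simp: D_def)
  then obtain s where s: "\<And>n. s n \<in> S" and sn: "\<And>n. l2_sq M (\<lambda>x. w x - s n x) < D + (1/8)^n / 4"
    by metis
  have ss: "L2_on M (s n)" for n using S s by blast
  define r where "r n = (\<lambda>x. w x - s n x)" for n
  have rs: "L2_on M (r n)" for n unfolding r_def by (intro L2_on_diff w ss)
  have cauchy: "l2_sq M (\<lambda>x. r m x - r n x) \<le> (1/8)^n" if "n \<le> m" for n m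
  proof -
    \<comment> \<open>The sum is twice the residual of the midpoint of \<open>s n\<close> and
      \<open>s m\<close>, and that residual costs at least \<open>D\<close>. The midpoint is built
      from two combinations of the form \<open>s + c * t\<close>, so that \<open>comb\<close> alone
      places it in \<open>S\<close>.\<close>
    have "(\<lambda>x. r m x + r n x) = (\<lambda>x. 2 * (w x - (s n x + (1/2) * (s m x + (-1) * s n x))))"
      unfolding r_def by (intro ext) (simp add: algebra_simps)
    then have "l2_sq M (\<lambda>x. r m x + r n x) = 4 * l2_sq M (\<lambda>x. w x - (s n x + (1/2) * (s m x + (-1) * s n x)))"
      using l2_sq_cmult[of M 2 "\<lambda>x. w x - (s n x + (1/2) * (s m x + (-1) * s n x))"] by simp
    moreover have "D \<le> l2_sq M (\<lambda>x. w x - (s n x + (1/2) * (s m x + (-1) * s n x)))"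
      by (intro D comb s)
    moreover have "(1/8::real)^m \<le> (1/8)^n"
      using that by (intro power_decreasing) auto
    ultimately show ?thesis
      using l2_sq_parallelogram[OF rs[of m] rs[of n]] sn[of m, folded r_def] sn[of n, folded r_def]
      by linarith
  qed
  obtain z where z: "L2_on M z" and lim: "(\<lambda>n. l2_sq M (\<lambda>x. r n x - z x)) \<longlonglongrightarrow> 0"
    using L2_on_complete[OF rs cauchy] by blast
  have ipS: "l2_prod M t z = 0" if t: "t \<in> S" for t
  proof -
    have le: "(cmod (l2_prod M (r n) t))\<^sup>2 \<le> (1/8)^n * l2_sq M t" for n
    proof (rule l2_prod_bound_of_l2_sq_bound[OF rs S[OF t]])
      fix c
      have eq: "(\<lambda>x. r n x - c * t x) = (\<lambda>x. w x - (s n x + c * t x))"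
        unfolding r_def by (intro ext) simp
      have "(0::real) < (1/8)^n" by simp
      then show "l2_sq M (r n) - (1/8)^n \<le> l2_sq M (\<lambda>x. r n x - c * t x)"
        unfolding eq using D[OF comb[OF s t, of n c]] sn[of n, folded r_def] by linarith
    qed simp
    have l: "(\<lambda>n. (1/8)^n * l2_sq M t) \<longlonglongrightarrow> 0"
      by (rule tendsto_mult_left_zero[OF LIMSEQ_power_zero]) simp
    have "\<forall>n. norm ((cmod (l2_prod M (r n) t))\<^sup>2) \<le> (1/8)^n * l2_sq M t"
      using le by (metis norm_power real_norm_def abs_norm_cancel)
    then have l0: "(\<lambda>n. (cmod (l2_prod M (r n) t))\<^sup>2) \<longlonglongrightarrow> 0"
      by (rule Lim_null_comparison[OF always_eventually l])
    have "(\<lambda>n. (cmod (l2_prod M (r n) t))\<^sup>2) \<longlonglongrightarrow> (cmod (l2_prod M z t))\<^sup>2"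
      by (intro tendsto_power tendsto_norm l2_prod_tendsto_left rs z S[OF t] lim)
    from LIMSEQ_unique[OF this l0] have "(cmod (l2_prod M z t))\<^sup>2 = 0" .
    then show ?thesis by (subst l2_prod_cnj) simp
  qed
  have "l2_prod M w z = 0" by (rule orth[OF z ipS])
  then have "l2_prod M (r n) z = 0" for n
    unfolding r_def by (simp add: l2_prod_diff_left w ss z ipS s)
  then have "(\<lambda>n. l2_prod M (r n) z) \<longlonglongrightarrow> 0" by simp
  from LIMSEQ_unique[OF this l2_prod_tendsto_left[OF rs z z lim]]
  have "l2_prod M z z = 0" by simp
  then have nz: "l2_sq M z = 0" by (simp add: l2_prod_self)
  have "l2_sq M (r n) \<le> 2 * l2_sq M (\<lambda>x. r n x - z x)" for n
    using l2_sq_add_le[OF L2_on_diff[OF rs z] z, of n] nz by simp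
  then have "\<forall>n. norm (l2_sq M (r n)) \<le> 2 * l2_sq M (\<lambda>x. r n x - z x)" by simp
  then have "(\<lambda>n. l2_sq M (r n)) \<longlonglongrightarrow> 0"
    by (rule Lim_null_comparison[OF always_eventually tendsto_mult_right_zero[OF lim]])
  then have "\<forall>\<^sub>F n in sequentially. l2_sq M (r n) < \<epsilon>"
    using e by (rule order_tendstoD)
  then obtain n where "l2_sq M (r n) < \<epsilon>"
    unfolding eventually_sequentially by blast
  then have "l2_sq M (\<lambda>x. s n x - w x) < \<epsilon>"
    unfolding r_def by (subst l2_sq_diff_commute)
  with s show ?thesis by blast
qed

section \<open>The space of the metric graph as one \<open>L\<^sup>2\<close> space\<close>

text \<open>Extending functions on the edges by zero to \<open>E \<times> \<real>\<close> turns \<open>L\<^sup>2(G)\<close> into a subspace of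
  \<open>L\<^sup>2\<close> of a product measure.\<close>

definition edgeM :: "'v edge set \<Rightarrow> ('v edge \<times> real) measure" where
  "edgeM E = count_space E \<Otimes>\<^sub>M lborel"

definition flat :: "('v edge \<Rightarrow> real) \<Rightarrow> 'v gfun \<Rightarrow> 'v edge \<times> real \<Rightarrow> complex" where
  "flat len f = (\<lambda>(e, x). indicator {0<..<len e} x *\<^sub>R f e x)"

lemma pair_sigma_finite_edgeM: "countable E \<Longrightarrow> pair_sigma_finite (count_space E) (lborel :: real measure)"
  by (intro pair_sigma_finite.intro sigma_finite_measure_count_space_countable sigma_finite_lborel)

text \<open>Fubini for \<open>count_space E\<close>, which is sigma-finite because \<open>E\<close>
  is countable; the integral over the counting measure is the unconditional sum that occurs in
  \<open>L2inner\<close> and \<open>L2norm\<close>.\<close>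

lemma integral_edgeM:
  fixes F :: "'v edge \<times> real \<Rightarrow> 'b::{banach, second_countable_topology}"
  assumes E: "countable E" and F: "integrable (edgeM E) F"
  shows "(LINT p|edgeM E. F p) = (\<Sum>\<^sub>\<infinity>e\<in>E. LINT x|lborel. F (e, x))"
    and "e \<in> E \<Longrightarrow> integrable lborel (\<lambda>x. F (e, x))"
    and "(\<lambda>e. norm (LINT x|lborel. F (e, x))) summable_on E"
proof -
  interpret pair_sigma_finite "count_space E" "lborel :: real measure"
    by (rule pair_sigma_finite_edgeM[OF E])
  have F': "integrable (count_space E \<Otimes>\<^sub>M lborel) F" using F by (simp add: edgeM_def)
  have s: "Infinite_Set_Sum.abs_summable_on (\<lambda>e. LINT x|lborel. F (e, x)) E"
    using integrable_fst'[OF F'] by (simp add: abs_summable_on_def)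
  show "(LINT p|edgeM E. F p) = (\<Sum>\<^sub>\<infinity>e\<in>E. LINT x|lborel. F (e, x))"
    using integral_fst'[OF F'] infsetsum_infsum[OF s] by (simp add: edgeM_def infsetsum_def)
  show "e \<in> E \<Longrightarrow> integrable lborel (\<lambda>x. F (e, x))"
    using AE_integrable_fst'[OF F'] by (simp add: AE_count_space)
  show "(\<lambda>e. norm (LINT x|lborel. F (e, x))) summable_on E"
    by (rule abs_summable_equivalent[THEN iffD2, OF s])
qed

lemma cmod_flat_sq:
  "(cmod (flat len f (e, x)))\<^sup>2 = indicator {0<..<len e} x *\<^sub>R (cmod (f e x))\<^sup>2"
  by (auto simp: flat_def indicator_def)

lemma edge_int_norm_sq: "edge_int len e (\<lambda>x. (cmod (f e x))\<^sup>2) = (LINT x|lborel. (cmod (flat len f (e, x)))\<^sup>2)"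
  by (simp add: edge_int_def set_lebesgue_integral_def cmod_flat_sq)

lemma edge_int_mult_cnj: "edge_int len e (\<lambda>x. f e x * cnj (g e x)) = (LINT x|lborel. flat len f (e, x) * cnj (flat len g (e, x)))"
  unfolding edge_int_def set_lebesgue_integral_def flat_def
  by (intro Bochner_Integration.integral_cong) (auto simp: indicator_def)

lemma L2G_iff_L2_on:
  assumes E: "countable E"
  shows "L2G E len f \<longleftrightarrow> L2_on (edgeM E) (flat len f)"
proof
  interpret pair_sigma_finite "count_space E" "lborel :: real measure"
    by (rule pair_sigma_finite_edgeM[OF E])
  assume L: "L2G E len f"
  have [measurable]: "flat len f \<in> borel_measurable (count_space E \<Otimes>\<^sub>M lborel)"
  proof (rule measurable_pair_measure_countable1[OF E])
    fix e assume "e \<in> E"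
    then show "(\<lambda>x. flat len f (e, x)) \<in> borel_measurable lborel"
      using L by (simp add: L2G_def set_borel_measurable_def flat_def)
  qed
  have "integrable (count_space E \<Otimes>\<^sub>M lborel) (\<lambda>p. (cmod (flat len f p))\<^sup>2)"
  proof (rule Fubini_integrable)
    have "(\<lambda>e. edge_int len e (\<lambda>x. (cmod (f e x))\<^sup>2)) summable_on E"
      using L by (simp add: L2G_def)
    moreover have "norm (LINT x|lborel. (cmod (flat len f (e, x)))\<^sup>2) = (LINT x|lborel. (cmod (flat len f (e, x)))\<^sup>2)" for e
      by simp
    ultimately have "Infinite_Sum.abs_summable_on (\<lambda>e. LINT x|lborel. (cmod (flat len f (e, x)))\<^sup>2) E"
      by (simp add: edge_int_norm_sq)
    then show "integrable (count_space E) (\<lambda>e. LINT x|lborel. norm ((cmod (flat len f (e, x)))\<^sup>2))"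
      unfolding abs_summable_equivalent abs_summable_on_def by simp
    show "AE e in count_space E. integrable lborel (\<lambda>x. (cmod (flat len f (e, x)))\<^sup>2)"
      using L by (auto simp: AE_count_space L2G_def set_integrable_def cmod_flat_sq)
  qed simp
  then show "L2_on (edgeM E) (flat len f)"
    unfolding L2_on_def edgeM_def by simp
next
  assume s: "L2_on (edgeM E) (flat len f)"
  then have m: "flat len f \<in> borel_measurable (count_space E \<Otimes>\<^sub>M lborel)"
    and i: "integrable (edgeM E) (\<lambda>p. (cmod (flat len f p))\<^sup>2)"
    by (auto simp: L2_on_def edgeM_def)
  have "set_borel_measurable lborel {0<..<len e} (f e)" if "e \<in> E" for e
    using measurable_compose[OF measurable_Pair1' m, of e] that
    by (simp add: set_borel_measurable_def flat_def)
  moreover have "set_integrable lborel {0<..<len e} (\<lambda>x. (cmod (f e x))\<^sup>2)" if "e \<in> E" for e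
    using integral_edgeM(2)[OF E i that]
    by (simp add: set_integrable_def cmod_flat_sq)
  moreover have "(\<lambda>e. edge_int len e (\<lambda>x. (cmod (f e x))\<^sup>2)) summable_on E"
    using integral_edgeM(3)[OF E i] by (simp add: edge_int_norm_sq)
  ultimately show "L2G E len f" by (simp add: L2G_def)
qed

lemma L2inner_eq_l2_prod:
  assumes E: "countable E" and f: "L2G E len f" and g: "L2G E len g"
  shows "L2inner E len f g = l2_prod (edgeM E) (flat len f) (flat len g)"
  unfolding l2_prod_def L2inner_def edge_int_mult_cnj
  using f g by (intro integral_edgeM(1)[symmetric, OF E] integrable_mult_cnj) (auto simp: L2G_iff_L2_on[OF E])

lemma L2norm_eq_l2_sq:
  assumes E: "countable E" and f: "L2G E len f"
  shows "L2norm E len f = sqrt (l2_sq (edgeM E) (flat len f))"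
  unfolding L2norm_def l2_sq_def edge_int_norm_sq
  using f by (subst integral_edgeM(1)[OF E]) (auto simp: L2G_iff_L2_on[OF E] L2_on_def)

lemma flat_add: "flat len (\<lambda>e x. f e x + g e x) = (\<lambda>p. flat len f p + flat len g p)"
  and flat_diff: "flat len (\<lambda>e x. f e x - g e x) = (\<lambda>p. flat len f p - flat len g p)"
  and flat_cmult: "flat len (\<lambda>e x. c * f e x) = (\<lambda>p. c * flat len f p)"
  by (auto simp: flat_def algebra_simps fun_eq_iff)

lemma L2dist_eq_l2_sq:
  assumes E: "countable E" and f: "L2G E len f" and g: "L2G E len g"
  shows "L2dist E len f g = sqrt (l2_sq (edgeM E) (\<lambda>p. flat len f p - flat len g p))"
proof -
  have "L2G E len (\<lambda>e x. f e x - g e x)"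
    using f g by (simp add: L2G_iff_L2_on[OF E] flat_diff L2_on_diff)
  then show ?thesis
    by (simp add: L2dist_def L2norm_eq_l2_sq[OF E] flat_diff)
qed

text \<open>An element of the product space need not vanish outside the edge intervals. Cutting it
  off there does not change its products with flattened functions, so orthogonality to such
  functions can be tested on an element that comes from \<open>L2G\<close>.\<close>

lemma flat_curry_L2_on:
  assumes E: "countable E" and z: "L2_on (edgeM E) z"
  shows "L2_on (edgeM E) (flat len (\<lambda>e x. z (e, x)))"
    and "l2_prod (edgeM E) (flat len s) z = l2_prod (edgeM E) (flat len s) (flat len (\<lambda>e x. z (e, x)))"
proof -
  have [measurable]: "(\<lambda>(e, x). (indicator {0<..<len e} x :: real)) \<in> borel_measurable (count_space E \<Otimes>\<^sub>M lborel)"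
    by (rule measurable_pair_measure_countable1[OF E]) simp
  have eq: "flat len (\<lambda>e x. z (e, x)) = (\<lambda>p. (case p of (e, x) \<Rightarrow> (indicator {0<..<len e} x :: real)) *\<^sub>R z p)"
    by (auto simp: flat_def fun_eq_iff)
  have [measurable]: "z \<in> borel_measurable (count_space E \<Otimes>\<^sub>M lborel)"
    using z by (simp add: L2_on_def edgeM_def)
  show "L2_on (edgeM E) (flat len (\<lambda>e x. z (e, x)))"
    unfolding L2_on_def
  proof
    show m: "flat len (\<lambda>e x. z (e, x)) \<in> borel_measurable (edgeM E)"
      unfolding eq edgeM_def by measurable
    show "integrable (edgeM E) (\<lambda>p. (cmod (flat len (\<lambda>e x. z (e, x)) p))\<^sup>2)"
    proof (rule Bochner_Integration.integrable_bound)
      show "integrable (edgeM E) (\<lambda>p. (cmod (z p))\<^sup>2)" using z by (simp add: L2_on_def)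
      show "(\<lambda>p. (cmod (flat len (\<lambda>e x. z (e, x)) p))\<^sup>2) \<in> borel_measurable (edgeM E)"
        using m by measurable
    qed (auto simp: eq indicator_def)
  qed
  show "l2_prod (edgeM E) (flat len s) z = l2_prod (edgeM E) (flat len s) (flat len (\<lambda>e x. z (e, x)))"
    unfolding l2_prod_def by (intro Bochner_Integration.integral_cong) (auto simp: flat_def indicator_def)
qed

section \<open>Absolutely continuous functions on an interval\<close>

text \<open>The integral form of absolute continuity: a function in \<open>W^{2,2}\<close> has a
  second derivative only almost everywhere, and the core is given by iterated integrals, so no
  pointwise derivative is demanded. The formula includes both ends of the interval, where the vertex
  conditions are read off.\<close>

definition ac_deriv :: "real \<Rightarrow> (real \<Rightarrow> complex) \<Rightarrow> (real \<Rightarrow> complex) \<Rightarrow> bool" where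
  "ac_deriv l F f \<longleftrightarrow> set_integrable lborel {0..l} f \<and> (\<forall>x\<in>{0..l}. F x = F 0 + (LINT t:{0..x}|lborel. f t))"

lemma ac_deriv_integrable: "ac_deriv l F f \<Longrightarrow> set_integrable lborel {0..l} f"
  and ac_deriv_eq: "ac_deriv l F f \<Longrightarrow> x \<in> {0..l} \<Longrightarrow> F x = F 0 + (LINT t:{0..x}|lborel. f t)"
  unfolding ac_deriv_def by blast+

lemma ac_derivI:
  assumes "set_integrable lborel {0..l} f" "\<And>x. 0 \<le> x \<Longrightarrow> x \<le> l \<Longrightarrow> F x = c + (LINT t:{0..x}|lborel. f t)"
  shows "ac_deriv l F f"
proof (cases "0 \<le> l")
  case True
  have "(LINT t:{0..0}|lborel. f t) = 0"
    unfolding set_lebesgue_integral_def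
    by (rule integral_eq_zero_AE, rule eventually_mono[OF AE_lborel_singleton[of 0]]) auto
  then have "F 0 = c" using assms(2)[of 0] True by simp
  then show ?thesis using assms unfolding ac_deriv_def by auto
next
  case False
  then show ?thesis using assms(1) unfolding ac_deriv_def by auto
qed

lemma set_integrable_sub0: "set_integrable lborel {0..l::real} f \<Longrightarrow> x \<le> l \<Longrightarrow> set_integrable lborel {0..x} f"
  for f :: "real \<Rightarrow> complex"
  by (rule set_integrable_subset) auto

lemma LINT_eq_HK:
  fixes f :: "real \<Rightarrow> complex"
  assumes "set_integrable lborel {0..l} f" "x \<le> l"
  shows "(LINT t:{0..x}|lborel. f t) = integral {0..x} f" "f integrable_on {0..x}"
  using set_borel_integral_eq_integral[OF set_integrable_sub0[OF assms]] by auto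

lemma ac_deriv_continuous: assumes "ac_deriv l F f" shows "continuous_on {0..l} F"
proof -
  have "continuous_on {0..l} (\<lambda>x. F 0 + integral {0..x} f)"
  proof (cases "0 \<le> l")
    case True
    then show ?thesis
      using LINT_eq_HK(2)[OF ac_deriv_integrable[OF assms] order_refl]
      by (intro continuous_intros indefinite_integral_continuous_1)
  qed auto
  moreover have eq: "F 0 + integral {0..x} f = F x" if "x \<in> {0..l}" for x
    using ac_deriv_eq[OF assms that] LINT_eq_HK(1)[OF ac_deriv_integrable[OF assms], of x] that by simp
  ultimately show ?thesis
    using continuous_on_cong[of "{0..l}" "{0..l}" "\<lambda>x. F 0 + integral {0..x} f" F] by blast
qed

lemma set_integrable_cont: "continuous_on {0..l} f \<Longrightarrow> set_integrable lborel {0..l} f"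
  for f :: "real \<Rightarrow> complex"
  using borel_integrable_compact[of "{0..l}" f] unfolding set_integrable_def
  by (simp add: indicator_scaleR_eq_if)

lemma ac_deriv_has_deriv:
  assumes F: "ac_deriv l F f" and f: "continuous_on {0..l} f" and x: "x \<in> {0..l}"
  shows "(F has_vector_derivative f x) (at x within {0..l})"
proof -
  have "((\<lambda>u. F 0 + integral {0..u} f) has_vector_derivative (0 + f x)) (at x within {0..l})"
    by (intro derivative_intros integral_has_vector_derivative f x)
  moreover have "F 0 + integral {0..u} f = F u" if "u \<in> {0..l}" for u
    using ac_deriv_eq[OF F that] LINT_eq_HK(1)[OF ac_deriv_integrable[OF F], of u] that by simp
  ultimately show ?thesis
    using has_vector_derivative_transform[OF x, of F "\<lambda>u. F 0 + integral {0..u} f" "f x"] by simp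
qed

lemma ac_deriv_of_deriv:
  assumes d: "\<And>x. x \<in> {0..l} \<Longrightarrow> (F has_vector_derivative f x) (at x within {0..l})"
    and f: "continuous_on {0..l} f"
  shows "ac_deriv l F f"
proof (rule ac_derivI)
  show i: "set_integrable lborel {0..l} f" by (rule set_integrable_cont[OF f])
  fix x :: real assume x: "0 \<le> x" "x \<le> l"
  have "(f has_integral (F x - F 0)) {0..x}"
    using x by (intro fundamental_theorem_of_calculus)
      (auto intro!: has_vector_derivative_within_subset[OF d, of _ "{0..x}"])
  then show "F x = F 0 + (LINT t:{0..x}|lborel. f t)"
    using LINT_eq_HK(1)[OF i x(2)] by (simp add: integral_unique)
qed

section \<open>Calculus of absolutely continuous functions and uniqueness of derivatives\<close>

lemma ac_deriv_add:
  assumes F: "ac_deriv l F f" and G: "ac_deriv l G g"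
  shows "ac_deriv l (\<lambda>x. F x + G x) (\<lambda>x. f x + g x)"
proof (rule ac_derivI[where c = "F 0 + G 0"])
  show "set_integrable lborel {0..l} (\<lambda>x. f x + g x)"
    by (intro set_integral_add(1) ac_deriv_integrable[OF F] ac_deriv_integrable[OF G])
  fix x :: real assume x: "0 \<le> x" "x \<le> l"
  then show "F x + G x = F 0 + G 0 + (LINT t:{0..x}|lborel. f t + g t)"
    using ac_deriv_eq[OF F, of x] ac_deriv_eq[OF G, of x]
    by (simp add: set_integral_add(2)[OF set_integrable_sub0[OF ac_deriv_integrable[OF F]]
          set_integrable_sub0[OF ac_deriv_integrable[OF G]]])
qed

lemma ac_deriv_cmult:
  assumes F: "ac_deriv l F f"
  shows "ac_deriv l (\<lambda>x. c * F x) (\<lambda>x. c * f x)"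
proof (rule ac_derivI[where c = "c * F 0"])
  show "set_integrable lborel {0..l} (\<lambda>x. c * f x)"
    using ac_deriv_integrable[OF F] by simp
  fix x :: real assume "0 \<le> x" "x \<le> l"
  then have "F x = F 0 + (LINT t:{0..x}|lborel. f t)" using ac_deriv_eq[OF F, of x] by auto
  then show "c * F x = c * F 0 + (LINT t:{0..x}|lborel. c * f t)"
    by (simp only: distrib_left set_integral_mult_right)
qed

lemma ac_deriv_cnj: "ac_deriv l F f \<Longrightarrow> ac_deriv l (\<lambda>x. cnj (F x)) (\<lambda>x. cnj (f x))"
proof (rule ac_derivI[where c = "cnj (F 0)"])
  assume a: "ac_deriv l F f"
  have *: "indicator A x *\<^sub>R cnj (f x) = cnj (indicator A x *\<^sub>R f x)" for A and x :: real by simp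
  show "set_integrable lborel {0..l} (\<lambda>x. cnj (f x))"
    using ac_deriv_integrable[OF a] unfolding set_integrable_def * complex_integrable_cnj .
  fix x :: real assume "0 \<le> x" "x \<le> l"
  then have "F x = F 0 + (LINT t:{0..x}|lborel. f t)" using ac_deriv_eq[OF a, of x] by auto
  then show "cnj (F x) = cnj (F 0) + (LINT t:{0..x}|lborel. cnj (f t))"
    unfolding set_lebesgue_integral_def * Bochner_Integration.integral_cnj by simp
qed

lemma ac_deriv_const: "ac_deriv l (\<lambda>_. c) (\<lambda>_. 0)"
  by (rule ac_derivI[where c = c]) (auto simp: set_integrable_def)

lemma ac_deriv_cong:
  assumes "ac_deriv l F f" "\<And>x. 0 \<le> x \<Longrightarrow> x \<le> l \<Longrightarrow> G x = F x"
    and g: "set_borel_measurable lborel {0..l} g" "AE x in lborel. x \<in> {0<..<l} \<longrightarrow> g x = f x"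
  shows "ac_deriv l G g"
proof (rule ac_derivI[where c = "F 0"])
  have "AE x in lborel. x \<noteq> (0::real)" "AE x in lborel. x \<noteq> l"
    by (rule AE_lborel_singleton)+
  with g(2) have ae: "AE x in lborel. x \<in> {0..l} \<longrightarrow> g x = f x"
    by eventually_elim auto
  have fi: "set_integrable lborel {0..l} f" by (rule ac_deriv_integrable[OF assms(1)])
  show gi: "set_integrable lborel {0..l} g"
    using fi g(1) ae unfolding set_integrable_def set_borel_measurable_def
    by (subst integrable_cong_AE[where g = "\<lambda>x. indicat_real {0..l} x *\<^sub>R f x"])
       (auto elim!: eventually_mono simp: indicator_def)
  fix x :: real assume x: "0 \<le> x" "x \<le> l"
  have "(LINT t:{0..x}|lborel. g t) = (LINT t:{0..x}|lborel. f t)"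
    using set_integrable_sub0[OF fi x(2)] set_integrable_sub0[OF gi x(2)] ae x
    unfolding set_integrable_def set_lebesgue_integral_def
    by (intro integral_cong_AE) (auto elim!: eventually_mono simp: indicator_def)
  then show "G x = F 0 + (LINT t:{0..x}|lborel. g t)"
    using assms(2)[OF x] ac_deriv_eq[OF assms(1), of x] x by simp
qed

text \<open>Fubini on the square \<open>{0..x}\<times>{0..x}\<close>, cut along the diagonal.\<close>

lemma ac_deriv_mult_indefinite:
  fixes f g :: "real \<Rightarrow> complex"
  assumes f: "set_integrable lborel {0..x} f" and g: "set_integrable lborel {0..x} g"
  shows "(LINT t:{0..x}|lborel. f t) * (LINT t:{0..x}|lborel. g t) =
    (LINT t:{0..x}|lborel. f t * (LINT s:{0..t}|lborel. g s) + (LINT s:{0..t}|lborel. f s) * g t)" (is ?th1)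
    and "set_integrable lborel {0..x} (\<lambda>t. f t * (LINT s:{0..t}|lborel. g s) + (LINT s:{0..t}|lborel. f s) * g t)" (is ?th2)
proof -
  define f' where "f' t = indicator {0..x} t *\<^sub>R f t" for t
  define g' where "g' t = indicator {0..x} t *\<^sub>R g t" for t
  have f'i: "integrable lborel f'" and g'i: "integrable lborel g'"
    using f g unfolding f'_def g'_def set_integrable_def by auto
  have [measurable]: "f' \<in> borel_measurable borel" "g' \<in> borel_measurable borel"
    using borel_measurable_integrable[OF f'i] borel_measurable_integrable[OF g'i] by simp_all
  have int: "integrable (lborel \<Otimes>\<^sub>M lborel) (\<lambda>(s,t). f' s * g' t)"
    by (rule lborel_pair.Fubini_integrable) (use f'i g'i in \<open>auto simp: norm_mult\<close>)
  let ?A = "\<lambda>p. indicator {(s,t). s \<le> t} p *\<^sub>R (case p of (s,t) \<Rightarrow> f' s * g' t)"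
  let ?B = "\<lambda>p. indicator {(s,t). t < s} p *\<^sub>R (case p of (s,t) \<Rightarrow> f' s * g' t)"
  have m: "{(s,t). s \<le> t} \<in> sets (lborel \<Otimes>\<^sub>M (lborel::real measure))" "{(s,t). t < s} \<in> sets (lborel \<Otimes>\<^sub>M (lborel::real measure))"
  proof -
    have "{p \<in> space (lborel \<Otimes>\<^sub>M (lborel::real measure)). fst p \<le> snd p} \<in> sets (lborel \<Otimes>\<^sub>M (lborel::real measure))"
      "{p \<in> space (lborel \<Otimes>\<^sub>M (lborel::real measure)). snd p < fst p} \<in> sets (lborel \<Otimes>\<^sub>M (lborel::real measure))"
      by measurable
    then show "{(s,t). s \<le> t} \<in> sets (lborel \<Otimes>\<^sub>M (lborel::real measure))"
      "{(s,t). t < s} \<in> sets (lborel \<Otimes>\<^sub>M (lborel::real measure))"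
      by (simp_all add: space_pair_measure split_beta')
  qed
  have iA: "integrable (lborel \<Otimes>\<^sub>M lborel) ?A" and iB: "integrable (lborel \<Otimes>\<^sub>M lborel) ?B"
    using m int by (auto intro!: integrable_mult_indicator)
  have iA': "integrable (lborel \<Otimes>\<^sub>M lborel) (case_prod (\<lambda>s t. indicator {(s,t). s \<le> t} (s,t) *\<^sub>R (f' s * g' t)))"
    by (rule Bochner_Integration.integrable_cong[THEN iffD1, OF refl _ iA]) auto
  have low: "(LINT s|lborel. indicator {(s,t). s \<le> t} (s,t) *\<^sub>R (f' s * g' t)) = indicator {0..x} t *\<^sub>R ((LINT s:{0..t}|lborel. f s) * g t)" for t
  proof (cases "t \<in> {0..x}")
    case True
    then have "(LINT s|lborel. indicator {(s,t). s \<le> t} (s,t) *\<^sub>R (f' s * g' t)) = (LINT s|lborel. (indicator {0..t} s *\<^sub>R f s) * g t)"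
      by (intro Bochner_Integration.integral_cong) (auto simp: f'_def g'_def indicator_def)
    also have "\<dots> = (LINT s:{0..t}|lborel. f s) * g t"
      unfolding set_lebesgue_integral_def by (rule integral_mult_left_zero)
    finally show ?thesis using True by simp
  qed (simp add: g'_def)
  have up: "(LINT t|lborel. indicator {(s,t). t < s} (s,t) *\<^sub>R (f' s * g' t)) = indicator {0..x} s *\<^sub>R (f s * (LINT t:{0..s}|lborel. g t))" for s
  proof (cases "s \<in> {0..x}")
    case True
    \<comment> \<open>The inner range is \<open>t < s\<close>, while the indefinite integral
      includes \<open>t = s\<close>. The integrands therefore agree only almost everywhere, unlike
      for the other half of the square.\<close>
    have "(LINT t|lborel. indicator {(s,t). t < s} (s,t) *\<^sub>R (f' s * g' t)) = (LINT t|lborel. f s * (indicator {0..s} t *\<^sub>R g t))"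
    proof (rule integral_cong_AE)
      have "AE t in lborel. t \<noteq> s" by (rule AE_lborel_singleton)
      then show "AE t in lborel. indicator {(s,t). t < s} (s,t) *\<^sub>R (f' s * g' t) = f s * (indicator {0..s} t *\<^sub>R g t)"
        by eventually_elim (use True in \<open>auto simp: f'_def g'_def indicator_def\<close>)
      have "set_integrable lborel {0..s} g" using g True by (intro set_integrable_sub0[OF g]) auto
      then show "(\<lambda>t. f s * (indicator {0..s} t *\<^sub>R g t)) \<in> borel_measurable lborel"
        unfolding set_integrable_def by (intro borel_measurable_integrable integrable_mult_right)
      show "(\<lambda>t. indicator {(s,t). t < s} (s,t) *\<^sub>R (f' s * g' t)) \<in> borel_measurable lborel"
        by (simp add: indicator_def)
    qed
    also have "\<dots> = f s * (LINT t:{0..s}|lborel. g t)"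
      unfolding set_lebesgue_integral_def by (rule integral_mult_right_zero)
    finally show ?thesis using True by simp
  qed (simp add: f'_def)
  have IA: "integrable lborel (\<lambda>t. indicator {0..x} t *\<^sub>R ((LINT s:{0..t}|lborel. f s) * g t))"
    using lborel_pair.integrable_snd[OF iA'] by (simp add: low)
  have IB: "integrable lborel (\<lambda>s. indicator {0..x} s *\<^sub>R (f s * (LINT t:{0..s}|lborel. g t)))"
    using lborel_pair.integrable_fst'[OF iB] by (simp add: up)
  have "(LINT t:{0..x}|lborel. f t) * (LINT t:{0..x}|lborel. g t) = (LINT s|lborel. LINT t|lborel. f' s * g' t)"
    unfolding integral_mult_right_zero integral_mult_left_zero
    by (simp only: f'_def[abs_def] g'_def[abs_def] set_lebesgue_integral_def)
  also have "\<dots> = (LINT p|(lborel \<Otimes>\<^sub>M lborel). (case p of (s,t) \<Rightarrow> f' s * g' t))"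
    using lborel_pair.integral_fst'[OF int] by simp
  also have "\<dots> = (LINT p|(lborel \<Otimes>\<^sub>M lborel). ?A p + ?B p)"
    by (intro Bochner_Integration.integral_cong) (auto simp: indicator_def)
  also have "\<dots> = integral\<^sup>L (lborel \<Otimes>\<^sub>M lborel) ?A + integral\<^sup>L (lborel \<Otimes>\<^sub>M lborel) ?B"
    by (intro Bochner_Integration.integral_add iA iB)
  also have "integral\<^sup>L (lborel \<Otimes>\<^sub>M lborel) ?B = (LINT s:{0..x}|lborel. f s * (LINT t:{0..s}|lborel. g t))"
    using lborel_pair.integral_fst'[OF iB] by (simp add: up set_lebesgue_integral_def)
  also have "integral\<^sup>L (lborel \<Otimes>\<^sub>M lborel) ?A = (LINT t:{0..x}|lborel. (LINT s:{0..t}|lborel. f s) * g t)"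
  proof -
    have "integral\<^sup>L (lborel \<Otimes>\<^sub>M lborel) ?A
        = integral\<^sup>L (lborel \<Otimes>\<^sub>M lborel) (case_prod (\<lambda>s t. indicator {(s,t). s \<le> t} (s,t) *\<^sub>R (f' s * g' t)))"
      by (rule Bochner_Integration.integral_cong) auto
    also have "\<dots> = (LINT t:{0..x}|lborel. (LINT s:{0..t}|lborel. f s) * g t)"
      unfolding lborel_pair.integral_snd[OF iA', symmetric] low set_lebesgue_integral_def ..
    finally show ?thesis .
  qed
  finally show ?th1
    using IA IB by (subst set_integral_add(2)) (auto simp: set_integrable_def)
  show ?th2
    using IA IB by (intro set_integral_add(1)) (auto simp: set_integrable_def)
qed

lemma ac_deriv_mult:
  assumes F: "ac_deriv l F f" and G: "ac_deriv l G g"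
  shows "ac_deriv l (\<lambda>x. F x * G x) (\<lambda>x. f x * G x + F x * g x)"
proof (rule ac_derivI[where c = "F 0 * G 0"])
  let ?h = "\<lambda>t. f t * (LINT s:{0..t}|lborel. g s) + (LINT s:{0..t}|lborel. f s) * g t"
  have eq: "G 0 * f t + F 0 * g t + ?h t = f t * G t + F t * g t" if "t \<in> {0..l}" for t
    by (subst ac_deriv_eq[OF F that], subst ac_deriv_eq[OF G that]) (simp add: algebra_simps)
  note fi = ac_deriv_integrable[OF F] and gi = ac_deriv_integrable[OF G]
  have i: "set_integrable lborel {0..x} (\<lambda>t. G 0 * f t + F 0 * g t)" if "x \<le> l" for x
    using set_integrable_sub0[OF fi that] set_integrable_sub0[OF gi that]
    by (intro set_integral_add(1)) simp_all
  have ih: "set_integrable lborel {0..x} ?h" if "x \<le> l" for x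
    by (rule ac_deriv_mult_indefinite(2)[OF set_integrable_sub0[OF fi that] set_integrable_sub0[OF gi that]])
  have "set_integrable lborel {0..l} (\<lambda>t. G 0 * f t + F 0 * g t + ?h t)"
    by (rule set_integral_add(1)[OF i[OF order_refl] ih[OF order_refl]])
  then show "set_integrable lborel {0..l} (\<lambda>t. f t * G t + F t * g t)"
    by (rule set_integrable_cong[THEN iffD1, rotated -1]) (use eq in auto)
  fix x :: real assume x: "0 \<le> x" "x \<le> l"
  have "(LINT t:{0..x}|lborel. f t * G t + F t * g t) = (LINT t:{0..x}|lborel. G 0 * f t + F 0 * g t + ?h t)"
    using x by (intro set_lebesgue_integral_cong allI impI eq[symmetric]) auto
  also have "\<dots> = G 0 * (LINT t:{0..x}|lborel. f t) + F 0 * (LINT t:{0..x}|lborel. g t) + (LINT t:{0..x}|lborel. ?h t)"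
    using set_integrable_sub0[OF fi x(2)] set_integrable_sub0[OF gi x(2)]
    by (simp only: set_integral_add(2)[OF i[OF x(2)] ih[OF x(2)]])
       (subst set_integral_add(2), simp_all)
  also have "(LINT t:{0..x}|lborel. ?h t) = (LINT t:{0..x}|lborel. f t) * (LINT t:{0..x}|lborel. g t)"
    by (rule ac_deriv_mult_indefinite(1)[OF set_integrable_sub0[OF fi x(2)] set_integrable_sub0[OF gi x(2)], symmetric])
  finally show "F x * G x = F 0 * G 0 + (LINT t:{0..x}|lborel. f t * G t + F t * g t)"
    using ac_deriv_eq[OF F, of x] ac_deriv_eq[OF G, of x] x by (simp add: algebra_simps)
qed

text \<open>The half-lines are stable under intersection and generate the Borel sets, so a Dynkin
  argument extends the vanishing integrals to every Borel set; the total integral \<open>tot\<close>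
  supplies the complements.\<close>

lemma AE_zero_if_integrals_atMost_zero:
  fixes h :: "real \<Rightarrow> complex"
  assumes h: "integrable lborel h" and z: "\<And>x. (LINT t:{..x}|lborel. h t) = 0" and tot: "(LINT t|lborel. h t) = 0"
  shows "AE x in lborel. h x = 0"
proof (rule sigma_finite_measure.density_zero[OF sigma_finite_lborel h])
  have si: "set_integrable lborel A h" if "A \<in> sets borel" for A
    using integrable_mult_indicator[OF _ h, of A] that by (simp add: set_integrable_def)
  have b: "sets borel = sigma_sets UNIV (range (\<lambda>a::real. {..a}))"
    by (subst borel_eq_atMost) (simp add: sets_measure_of)
  fix A :: "real set" assume "A \<in> sets lborel"
  then have A: "A \<in> sigma_sets UNIV (range (\<lambda>a::real. {..a}))" by (simp add: b)
  have I: "Int_stable (range (\<lambda>a::real. {..a}))" by (auto simp: Int_stable_def)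
  have S: "range (\<lambda>a::real. {..a}) \<subseteq> Pow UNIV" by simp
  show "(LINT t:A|lborel. h t) = 0"
    using I S A
  proof (induction rule: sigma_sets_induct_disjoint)
    case (basic A) then show ?case using z by auto
  next
    case empty then show ?case by (simp add: set_lebesgue_integral_def)
  next
    case (compl A)
    have A: "A \<in> sets borel" using compl.hyps by (simp add: b)
    have "(LINT t:UNIV - A|lborel. h t) = (LINT t:UNIV|lborel. h t) - (LINT t:A|lborel. h t)"
    proof -
      have "(LINT t:A \<union> (UNIV - A)|lborel. h t) = (LINT t:A|lborel. h t) + (LINT t:UNIV - A|lborel. h t)"
        using A by (intro set_integral_Un si) auto
      then show ?thesis by simp
    qed
    then show ?case using tot compl.IH by (simp add: set_lebesgue_integral_def)
  next
    case (union A)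
    have A: "A i \<in> sets borel" for i using union.hyps by (auto simp: b)
    have "(LINT t:(\<Union>i. A i)|lborel. h t) = (\<Sum>i. (LINT t:(A i)|lborel. h t))"
      using A union.hyps(1)
      by (intro lebesgue_integral_countable_add si) (auto simp: disjoint_family_on_def)
    then show ?case using union.IH by simp
  qed
qed

text \<open>The integral of the zero extension \<open>h\<close> over a half-line ending at
  \<open>x\<close> is the primitive of \<open>f\<close> at \<open>x\<close> clamped to
  \<open>{0..l}\<close>, so vanishing of \<open>F\<close> makes all half-line integrals of
  \<open>h\<close> vanish.\<close>

lemma ac_deriv_zero_imp_AE_zero:
  assumes F: "ac_deriv l F f" and z: "\<And>x. 0 \<le> x \<Longrightarrow> x \<le> l \<Longrightarrow> F x = 0"
  shows "AE x in lborel. x \<in> {0..l} \<longrightarrow> f x = 0"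
proof (cases "0 \<le> l")
  case True
  define h where "h t = indicator {0..l} t *\<^sub>R f t" for t
  have h: "integrable lborel h"
    using ac_deriv_integrable[OF F] unfolding set_integrable_def h_def .
  have zero: "(LINT t:{0..x}|lborel. f t) = 0" if "0 \<le> x" "x \<le> l" for x
    using ac_deriv_eq[OF F, of x] z[of x] z[of 0] that True by simp
  have tot: "(LINT t|lborel. h t) = 0"
    using zero[OF True order_refl] by (simp add: h_def set_lebesgue_integral_def)
  have "(LINT t:{..x}|lborel. h t) = 0" for x
  proof (cases "x < 0")
    case True
    then show ?thesis unfolding set_lebesgue_integral_def h_def
      by (intro integral_eq_zero_AE AE_I2) (auto simp: indicator_def)
  next
    case False
    have "(LINT t:{..x}|lborel. h t) = (LINT t:{0..min x l}|lborel. f t)"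
      unfolding set_lebesgue_integral_def h_def
      by (intro Bochner_Integration.integral_cong) (auto simp: indicator_def)
    also have "\<dots> = 0" using False True by (intro zero) auto
    finally show ?thesis .
  qed
  from AE_zero_if_integrals_atMost_zero[OF h this tot] show ?thesis
    by eventually_elim (auto simp: h_def indicator_def)
qed auto

lemma ac_deriv_deriv_unique:
  assumes l: "0 < l" and F: "ac_deriv l F f" "ac_deriv l G g"
    and eq: "\<And>x. 0 \<le> x \<Longrightarrow> x \<le> l \<Longrightarrow> F x = G x"
    and c: "continuous_on {0..l} f" "continuous_on {0..l} g" and x: "0 \<le> x" "x \<le> l"
  shows "f x = g x"
proof -
  have 1: "(F has_vector_derivative f x) (at x within cbox 0 l)"
    using ac_deriv_has_deriv[OF F(1) c(1)] x by simp
  have "(G has_vector_derivative g x) (at x within {0..l})"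
    using ac_deriv_has_deriv[OF F(2) c(2)] x by simp
  then have 2: "(F has_vector_derivative g x) (at x within cbox 0 l)"
    using has_vector_derivative_transform[of x "{0..l}" F G "g x"] x eq by simp
  show ?thesis
    by (rule vector_derivative_unique_within_closed_interval[OF l _ 1 2]) (use x in auto)
qed

lemma set_borel_measurable_cont: "continuous_on {0..l} f \<Longrightarrow> set_borel_measurable lborel {0..l} f"
  for f :: "real \<Rightarrow> complex"
  using set_integrable_cont[of l f] unfolding set_integrable_def set_borel_measurable_def
  by (rule borel_measurable_integrable)

text \<open>Such an \<open>f\<close> is an almost-everywhere derivative of the zero function, and a
  continuous derivative is unique, including at the ends, where the derivative within
  \<open>{0..l}\<close> is one-sided.\<close>

lemma cont_AE_zero:
  fixes f :: "real \<Rightarrow> complex"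
  assumes l: "0 < l" and c: "continuous_on {0..l} f"
    and ae: "AE x in lborel. x \<in> {0<..<l} \<longrightarrow> f x = 0" and x: "0 \<le> x" "x \<le> l"
  shows "f x = 0"
proof -
  have "ac_deriv l (\<lambda>_. 0) f"
    by (rule ac_deriv_cong[OF ac_deriv_const[where c = 0] refl set_borel_measurable_cont[OF c] ae])
  then show ?thesis
    by (rule ac_deriv_deriv_unique[OF l _ ac_deriv_const[where c = 0] refl c continuous_on_const x])
qed

section \<open>Orthogonality on a single edge\<close>

text \<open>Single-edge counterpart of \<open>flat\<close>: extension by zero makes the
  \<open>L2_on\<close> calculus over \<open>lborel\<close> available on an interval.\<close>

definition cut :: "real \<Rightarrow> (real \<Rightarrow> complex) \<Rightarrow> real \<Rightarrow> complex" where
  "cut l g x = indicator {0<..<l} x *\<^sub>R g x"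

lemma cmod_cut_sq: "(cmod (cut l g x))\<^sup>2 = indicator {0<..<l} x *\<^sub>R (cmod (g x))\<^sup>2"
  by (auto simp: cut_def indicator_def)

lemma sq_int_iff: "sq_int l g \<longleftrightarrow> L2_on lborel (cut l g)"
proof -
  have "cut l g = (\<lambda>x. indicator {0<..<l} x *\<^sub>R g x)" by (auto simp: cut_def)
  then show ?thesis
    unfolding sq_int_def L2_on_def cmod_cut_sq set_borel_measurable_def set_integrable_def by simp
qed

lemma cut_add: "cut l (\<lambda>x. f x + g x) = (\<lambda>x. cut l f x + cut l g x)"
  and cut_diff: "cut l (\<lambda>x. f x - g x) = (\<lambda>x. cut l f x - cut l g x)"
  and cut_cmult: "cut l (\<lambda>x. c * f x) = (\<lambda>x. c * cut l f x)"
  by (auto simp: cut_def algebra_simps fun_eq_iff)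

lemma sq_int_add: "sq_int l f \<Longrightarrow> sq_int l g \<Longrightarrow> sq_int l (\<lambda>x. f x + g x)"
  and sq_int_diff: "sq_int l f \<Longrightarrow> sq_int l g \<Longrightarrow> sq_int l (\<lambda>x. f x - g x)"
  and sq_int_cmult: "sq_int l f \<Longrightarrow> sq_int l (\<lambda>x. c * f x)"
  unfolding sq_int_iff cut_add cut_diff cut_cmult by (rule L2_on_add L2_on_diff L2_on_cmult; assumption)+

lemma sq_int_cnj: "sq_int l f \<Longrightarrow> sq_int l (\<lambda>x. cnj (f x))"
proof -
  have "cut l (\<lambda>x. cnj (f x)) = (\<lambda>x. cnj (cut l f x))" by (auto simp: cut_def)
  then show "sq_int l f \<Longrightarrow> sq_int l (\<lambda>x. cnj (f x))"
    unfolding sq_int_iff by (auto simp: L2_on_def intro!: borel_measurable_cnj)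
qed

lemma LINT_Icc_Ioo: "(LINT t:{0..l}|lborel. f t) = (LINT t:{0<..<l::real}|lborel. f t)"
  for f :: "real \<Rightarrow> complex"
  by (rule set_integral_discrete_difference[where X = "{0, l}"]) auto

lemma set_integrable_Icc_Ioo: "set_integrable lborel {0..l} f \<longleftrightarrow> set_integrable lborel {0<..<l::real} f"
  for f :: "real \<Rightarrow> complex"
  by (rule set_integrable_discrete_difference[where X = "{0, l}"]) auto

lemma LINT_mult_cnj: "(LINT x:{0<..<l}|lborel. f x * cnj (g x)) = l2_prod lborel (cut l f) (cut l g)"
  unfolding l2_prod_def set_lebesgue_integral_def
  by (intro Bochner_Integration.integral_cong) (auto simp: cut_def indicator_def)

lemma set_integrable_mult_cnj:
  assumes "sq_int l f" "sq_int l g"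
  shows "set_integrable lborel {0..l} (\<lambda>x. f x * cnj (g x))"
proof -
  have "integrable lborel (\<lambda>x. cut l f x * cnj (cut l g x))"
    using assms unfolding sq_int_iff by (rule integrable_mult_cnj)
  moreover have "(\<lambda>x. cut l f x * cnj (cut l g x)) = (\<lambda>x. indicator {0<..<l} x *\<^sub>R (f x * cnj (g x)))"
    by (auto simp: cut_def fun_eq_iff indicator_def)
  ultimately have "set_integrable lborel {0<..<l} (\<lambda>x. f x * cnj (g x))"
    unfolding set_integrable_def by simp
  then show ?thesis by (simp only: set_integrable_Icc_Ioo)
qed

lemma sq_int_cont: assumes "continuous_on {0..l} g" shows "sq_int l g"
proof -
  have sub: "{0<..<l} \<subseteq> {0..l}" by auto
  have "set_borel_measurable lborel {0<..<l} g"
    using set_integrable_subset[OF set_integrable_cont[OF assms] _ sub]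
    unfolding set_borel_measurable_def set_integrable_def by (intro borel_measurable_integrable) auto
  moreover have "continuous_on {0..l} (\<lambda>x. (cmod (g x))\<^sup>2)"
    using assms by (intro continuous_intros)
  then have "set_integrable lborel {0..l} (\<lambda>x. (cmod (g x))\<^sup>2)"
    unfolding set_integrable_def using borel_integrable_compact[of "{0..l}" "\<lambda>x. (cmod (g x))\<^sup>2"]
    by (simp add: indicator_scaleR_eq_if)
  then have "set_integrable lborel {0<..<l} (\<lambda>x. (cmod (g x))\<^sup>2)"
    by (rule set_integrable_subset[OF _ _ sub]) simp
  ultimately show ?thesis by (simp add: sq_int_def)
qed

lemma sq_int_integrable: assumes "sq_int l g" shows "set_integrable lborel {0..l} g"
  using set_integrable_mult_cnj[OF assms sq_int_cont[of l "\<lambda>_. 1"]] by simp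

lemma ac_deriv_indefinite:
  assumes "set_integrable lborel {0..l} f"
  shows "ac_deriv l (\<lambda>x. c + (LINT t:{0..x}|lborel. f t)) f"
  by (rule ac_derivI[OF assms refl])

lemma LINT_singleton [simp]: "(LINT t:{0::real}|lborel. f t) = (0::complex)"
  unfolding set_lebesgue_integral_def
  by (rule integral_eq_zero_AE, rule eventually_mono[OF AE_lborel_singleton[of 0]]) auto

lemma ac_deriv_integral:
  assumes "ac_deriv l F f" "0 \<le> l" shows "(LINT t:{0..l}|lborel. f t) = F l - F 0"
  using ac_deriv_eq[OF assms(1), of l] assms(2) by simp

lemma l2_sq_zero_AE:
  assumes "L2_on M f" "l2_sq M f = 0" shows "AE x in M. f x = 0"
proof -
  have "AE x in M. (cmod (f x))\<^sup>2 = 0"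
    using assms by (subst integral_nonneg_eq_0_iff_AE[symmetric]) (auto simp: L2_on_def l2_sq_def)
  then show ?thesis by simp
qed

lemma ac_deriv_of_real:
  assumes "\<And>x. x \<in> {0..l} \<Longrightarrow> (F has_real_derivative f x) (at x within {0..l})" "continuous_on {0..l} f"
  shows "ac_deriv l (\<lambda>x. complex_of_real (F x)) (\<lambda>x. complex_of_real (f x))"
  using assms by (intro ac_deriv_of_deriv has_vector_derivative_of_real continuous_intros)

lemma ac_deriv_id: "ac_deriv l (\<lambda>x. complex_of_real x) (\<lambda>_. 1)"
  using ac_deriv_of_real[of l "\<lambda>x. x" "\<lambda>_. 1"] by simp

lemma ac_deriv_diff: "ac_deriv l F f \<Longrightarrow> ac_deriv l G g \<Longrightarrow> ac_deriv l (\<lambda>x. F x - G x) (\<lambda>x. f x - g x)"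
  using ac_deriv_add[of l F f "\<lambda>x. (-1) * G x" "\<lambda>x. (-1) * g x"] ac_deriv_cmult[of l G g "-1"] by simp

section \<open>Distributional equations on one interval\<close>

lemma centered_moments:
  assumes l: "0 < l"
  shows "(LINT x:{0..l}|lborel. complex_of_real (x - l/2)) = 0"
    and "(LINT x:{0..l}|lborel. complex_of_real ((x - l/2)\<^sup>2)) = of_real (l^3/12)"
proof -
  have "ac_deriv l (\<lambda>x. complex_of_real ((x - l/2)\<^sup>2 / 2)) (\<lambda>x. complex_of_real (x - l/2))"
    by (rule ac_deriv_of_real) (auto intro!: derivative_eq_intros continuous_intros)
  from ac_deriv_integral[OF this] l show "(LINT x:{0..l}|lborel. complex_of_real (x - l/2)) = 0"
    by (simp add: power2_eq_square)
  have "ac_deriv l (\<lambda>x. complex_of_real ((x - l/2)^3 / 3)) (\<lambda>x. complex_of_real ((x - l/2)\<^sup>2))"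
    by (rule ac_deriv_of_real) (auto intro!: derivative_eq_intros continuous_intros)
  from ac_deriv_integral[OF this] l
  have "(LINT x:{0..l}|lborel. complex_of_real ((x - l/2)\<^sup>2)) = of_real ((l - l/2)^3/3 - (0 - l/2)^3/3)"
    by (simp only: of_real_diff)
  also have "(l - l/2)^3/3 - (0 - l/2)^3/3 = l^3/12"
    by (simp add: power3_eq_cube field_simps)
  finally show "(LINT x:{0..l}|lborel. complex_of_real ((x - l/2)\<^sup>2)) = of_real (l^3/12)" .
qed

text \<open>The double orthogonal complement of the span of \<open>1\<close> and \<open>x\<close> is
  that span. The residual \<open>g\<close> of \<open>y\<close> after projection satisfies both
  moment conditions, so it is orthogonal to \<open>y\<close> as well as to the projection, hence to
  itself. Replacing \<open>x\<close> by \<open>x - l/2\<close> gives an orthogonal basis, so the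
  coefficients are plain quotients.\<close>

lemma affine_if_orthogonal:
  assumes l: "0 < l" and y: "sq_int l y"
    and orth: "\<And>g. sq_int l g \<Longrightarrow> (LINT x:{0..l}|lborel. g x) = 0 \<Longrightarrow> (LINT x:{0..l}|lborel. of_real x * g x) = 0
      \<Longrightarrow> (LINT x:{0..l}|lborel. g x * cnj (y x)) = 0"
  shows "\<exists>\<alpha> \<beta>. AE x in lborel. x \<in> {0<..<l} \<longrightarrow> y x = \<alpha> + \<beta> * of_real x"
proof -
  define u :: "real \<Rightarrow> complex" where "u = (\<lambda>_. 1)"
  define v where "v x = complex_of_real (x - l/2)" for x
  let ?L = "\<lambda>f. cut l f" and ?i = "\<lambda>f g. l2_prod lborel (cut l f) (cut l g)"
  have u: "sq_int l u" unfolding u_def by (intro sq_int_cont continuous_intros)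
  have v: "sq_int l v" unfolding v_def by (intro sq_int_cont continuous_intros)
  have I: "?i f h = (LINT x:{0..l}|lborel. f x * cnj (h x))" for f h
    unfolding LINT_Icc_Ioo LINT_mult_cnj ..
  have vu: "?i v u = 0" unfolding I u_def v_def using centered_moments(1)[OF l] by simp
  then have uv: "?i u v = 0" by (subst l2_prod_cnj) simp
  have uu: "?i u u = of_real l"
    unfolding I u_def using ac_deriv_integral[OF ac_deriv_id, of l] l by simp
  have vv: "?i v v = of_real (l^3/12)"
    unfolding I v_def using centered_moments(2)[OF l] by (simp add: power2_eq_square)
  define \<alpha> where "\<alpha> = ?i y u / of_real l"
  define \<beta> where "\<beta> = ?i y v / of_real (l^3/12)"
  define g where "g x = y x - (\<alpha> * u x + \<beta> * v x)" for x
  have gs: "sq_int l g" unfolding g_def by (intro sq_int_diff sq_int_add sq_int_cmult y u v)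
  have Lg: "?L g = (\<lambda>x. ?L y x - (\<alpha> * ?L u x + \<beta> * ?L v x))"
    unfolding g_def cut_diff cut_add cut_cmult ..
  note s = y[unfolded sq_int_iff] u[unfolded sq_int_iff] v[unfolded sq_int_iff] gs[unfolded sq_int_iff]
  have left: "?i g h = ?i y h - (\<alpha> * ?i u h + \<beta> * ?i v h)" if "L2_on lborel (?L h)" for h
    unfolding Lg using that s
    by (simp add: l2_prod_diff_left l2_prod_add_left L2_on_add L2_on_cmult l2_prod_cmult_left)
  have right: "?i h g = ?i h y - (cnj \<alpha> * ?i h u + cnj \<beta> * ?i h v)" if "L2_on lborel (?L h)" for h
    unfolding Lg using that s
    by (simp add: l2_prod_diff_right l2_prod_add_right L2_on_add L2_on_cmult l2_prod_cmult_right)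
  have gu: "?i g u = 0" using left[OF s(2)] uu vu l by (simp add: \<alpha>_def)
  have gv: "?i g v = 0" using left[OF s(3)] vv uv l by (simp add: \<beta>_def)
  have "(LINT x:{0..l}|lborel. g x) = 0" using gu unfolding I by (simp add: u_def)
  moreover have "(LINT x:{0..l}|lborel. of_real x * g x) = 0"
  proof -
    have "(LINT x:{0..l}|lborel. of_real x * g x) = (LINT x:{0..l}|lborel. g x * cnj (v x) + of_real (l/2) * (g x * cnj (u x)))"
      by (intro set_lebesgue_integral_cong) (auto simp: v_def u_def algebra_simps)
    also have "\<dots> = (LINT x:{0..l}|lborel. g x * cnj (v x)) + (LINT x:{0..l}|lborel. of_real (l/2) * (g x * cnj (u x)))"
      using set_integrable_mult_cnj[OF gs u] set_integrable_mult_cnj[OF gs v]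
      by (intro set_integral_add(2) set_integrable_mult_right) auto
    also have "\<dots> = ?i g v + of_real (l/2) * ?i g u" unfolding I set_integral_mult_right ..
    finally show ?thesis using gu gv by simp
  qed
  ultimately have "?i g y = 0" unfolding I using orth[OF gs] by simp
  then have "?i g g = 0" using right[OF s(4)] gu gv by simp
  then have "l2_sq lborel (?L g) = 0" by (simp add: l2_prod_self)
  then have "AE x in lborel. ?L g x = 0" by (rule l2_sq_zero_AE[OF s(4)])
  then have "AE x in lborel. x \<in> {0<..<l} \<longrightarrow> y x = (\<alpha> - \<beta> * of_real (l/2)) + \<beta> * of_real x"
    by eventually_elim (auto simp: cut_def g_def u_def v_def algebra_simps)
  then show ?thesis by blast
qed

text \<open>\<open>\<phi>\<close> is the second antiderivative of \<open>g\<close>; the two moment conditions say that its Cauchy data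
  vanish at \<open>l\<close> as well, so two integrations by parts move both antiderivatives onto \<open>z\<close>.\<close>

lemma twice_integrated:
  assumes l: "0 < l" and z: "sq_int l z" and g: "sq_int l g"
    and g0: "(LINT x:{0..l}|lborel. g x) = 0" and g1: "(LINT x:{0..l}|lborel. of_real x * g x) = 0"
    and Z: "ac_deriv l Z Z1" "ac_deriv l Z1 (\<lambda>x. cnj (z x))"
  shows "\<exists>\<phi> \<phi>1. ac_deriv l \<phi> \<phi>1 \<and> ac_deriv l \<phi>1 g \<and> \<phi> 0 = 0 \<and> \<phi>1 0 = 0 \<and> \<phi> l = 0 \<and> \<phi>1 l = 0 \<and>
    (LINT x:{0..l}|lborel. \<phi> x * cnj (z x)) = (LINT x:{0..l}|lborel. g x * Z x)"
proof -
  define \<phi>1 where "\<phi>1 x = 0 + (LINT t:{0..x}|lborel. g t)" for x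
  have 1: "ac_deriv l \<phi>1 g"
    unfolding \<phi>1_def[abs_def] by (rule ac_deriv_indefinite[OF sq_int_integrable[OF g]])
  define \<phi> where "\<phi> x = 0 + (LINT t:{0..x}|lborel. \<phi>1 t)" for x
  have 2: "ac_deriv l \<phi> \<phi>1"
    unfolding \<phi>_def[abs_def] by (rule ac_deriv_indefinite[OF set_integrable_cont[OF ac_deriv_continuous[OF 1]]])
  have z0: "\<phi>1 0 = 0" "\<phi> 0 = 0" "\<phi>1 l = 0" using g0 by (simp_all add: \<phi>_def \<phi>1_def)
  \<comment> \<open>Integrating the derivative of \<open>x * \<phi>1 x\<close>, a function that
    vanishes at both ends, turns the first moment of \<open>g\<close> into minus the integral of
    \<open>\<phi>1\<close>, that is into \<open>- \<phi> l\<close>.\<close>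
  have "(LINT x:{0..l}|lborel. 1 * \<phi>1 x + of_real x * g x) = 0"
    using ac_deriv_integral[OF ac_deriv_mult[OF ac_deriv_id 1]] l z0 by simp
  moreover have "set_integrable lborel {0..l} (\<lambda>x. of_real x * g x)"
  proof -
    have "continuous_on {0..l} complex_of_real" by (intro continuous_intros)
    then show ?thesis
      using set_integrable_mult_cnj[OF g sq_int_cont[of l complex_of_real]] by (simp add: mult.commute)
  qed
  then have "(LINT x:{0..l}|lborel. 1 * \<phi>1 x + of_real x * g x)
      = (LINT x:{0..l}|lborel. \<phi>1 x) + (LINT x:{0..l}|lborel. of_real x * g x)"
    using ac_deriv_integrable[OF 2] by (simp add: set_integral_add(2))
  ultimately have zl: "\<phi> l = 0" using g1 by (simp add: \<phi>_def)
  have A: "ac_deriv l (\<lambda>x. \<phi> x * Z1 x - \<phi>1 x * Z x)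
      (\<lambda>x. (\<phi>1 x * Z1 x + \<phi> x * cnj (z x)) - (g x * Z x + \<phi>1 x * Z1 x))"
    by (intro ac_deriv_diff ac_deriv_mult 1 2 Z)
  have i1: "set_integrable lborel {0..l} (\<lambda>x. \<phi> x * cnj (z x))"
    by (intro set_integrable_mult_cnj z sq_int_cont ac_deriv_continuous[OF 2])
  have i2: "set_integrable lborel {0..l} (\<lambda>x. g x * Z x)"
    using set_integrable_mult_cnj[OF g sq_int_cnj[OF sq_int_cont[OF ac_deriv_continuous[OF Z(1)]]]] by simp
  have "(LINT x:{0..l}|lborel. \<phi> x * cnj (z x)) - (LINT x:{0..l}|lborel. g x * Z x)
      = (LINT x:{0..l}|lborel. \<phi> x * cnj (z x) - g x * Z x)"
    by (rule set_integral_diff(2)[OF i1 i2, symmetric])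
  also have "\<dots> = (LINT x:{0..l}|lborel. (\<phi>1 x * Z1 x + \<phi> x * cnj (z x)) - (g x * Z x + \<phi>1 x * Z1 x))"
    by (intro set_lebesgue_integral_cong) auto
  also have "\<dots> = 0" using ac_deriv_integral[OF A] l z0 zl by simp
  finally show ?thesis using 1 2 z0 zl by auto
qed

lemma ac_deriv_second_antiderivative:
  assumes "set_integrable lborel {0..l} f"
  obtains Z Z1 where "ac_deriv l Z Z1" "ac_deriv l Z1 f"
proof -
  have 1: "ac_deriv l (\<lambda>x. 0 + (LINT t:{0..x}|lborel. f t)) f" by (rule ac_deriv_indefinite[OF assms])
  show thesis
    by (rule that[OF ac_deriv_indefinite[OF set_integrable_cont[OF ac_deriv_continuous[OF 1]]] 1])
qed

text \<open>Two integrations by parts replace \<open>z\<close> by the second antiderivative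
  \<open>Z\<close> of \<open>cnj z\<close>, which is then orthogonal, up to conjugation, to every
  \<open>g\<close> with vanishing moments. So \<open>Z\<close> is affine, and its second derivative
  vanishes.\<close>

lemma edge_orthogonal_bumps_imp_zero:
  assumes l: "0 < l" and z: "sq_int l z"
    and orth: "\<And>\<phi> \<phi>1 g. sq_int l g \<Longrightarrow> ac_deriv l \<phi> \<phi>1 \<Longrightarrow> ac_deriv l \<phi>1 g \<Longrightarrow> \<phi> 0 = 0 \<Longrightarrow> \<phi>1 0 = 0
      \<Longrightarrow> \<phi> l = 0 \<Longrightarrow> \<phi>1 l = 0 \<Longrightarrow> (LINT x:{0..l}|lborel. \<phi> x * cnj (z x)) = 0"
  shows "AE x in lborel. x \<in> {0<..<l} \<longrightarrow> z x = 0"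
proof -
  obtain Z Z1 where Z: "ac_deriv l Z Z1" "ac_deriv l Z1 (\<lambda>x. cnj (z x))"
    by (rule ac_deriv_second_antiderivative[OF sq_int_integrable[OF sq_int_cnj[OF z]]])
  have "\<exists>\<alpha> \<beta>. AE x in lborel. x \<in> {0<..<l} \<longrightarrow> cnj (Z x) = \<alpha> + \<beta> * of_real x"
  proof (rule affine_if_orthogonal[OF l sq_int_cnj[OF sq_int_cont[OF ac_deriv_continuous[OF Z(1)]]]])
    fix g assume g: "sq_int l g" "(LINT x:{0..l}|lborel. g x) = 0" "(LINT x:{0..l}|lborel. of_real x * g x) = 0"
    show "(LINT x:{0..l}|lborel. g x * cnj (cnj (Z x))) = 0"
      using twice_integrated[OF l z g Z] orth[OF g(1)] by auto
  qed
  then obtain \<alpha> \<beta> where ae: "AE x in lborel. x \<in> {0<..<l} \<longrightarrow> cnj (Z x) = \<alpha> + \<beta> * of_real x" by blast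
  have D: "ac_deriv l (\<lambda>x. cnj (Z x) - (\<alpha> + \<beta> * of_real x)) (\<lambda>x. cnj (Z1 x) - (0 + \<beta> * 1))"
    by (intro ac_deriv_diff ac_deriv_cnj ac_deriv_add ac_deriv_const ac_deriv_cmult ac_deriv_id Z)
  have z0: "cnj (Z x) - (\<alpha> + \<beta> * of_real x) = 0" if "0 \<le> x" "x \<le> l" for x
    by (rule cont_AE_zero[OF l ac_deriv_continuous[OF D] _ that]) (use ae in \<open>auto elim!: eventually_mono\<close>)
  have D1: "ac_deriv l (\<lambda>x. cnj (Z1 x) - (0 + \<beta> * 1)) (\<lambda>x. cnj (cnj (z x)) - 0)"
    by (intro ac_deriv_diff ac_deriv_cnj ac_deriv_const Z)
  have z1: "cnj (Z1 x) - (0 + \<beta> * 1) = 0" if "0 \<le> x" "x \<le> l" for x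
    by (rule ac_deriv_deriv_unique[OF l D ac_deriv_const[of l 0] z0 ac_deriv_continuous[OF D1] continuous_on_const that])
  have "AE x in lborel. x \<in> {0..l} \<longrightarrow> cnj (cnj (z x)) - 0 = 0"
    by (rule ac_deriv_zero_imp_AE_zero[OF D1]) (rule z1)
  then show ?thesis by eventually_elim auto
qed

text \<open>Weak solutions of \<open>z'' = z\<close> are classical. A bump \<open>\<phi>\<close>
  with second derivative \<open>g\<close> contributes \<open>\<phi> - g\<close> to the range of the
  operator plus one. Orthogonality makes \<open>z - cnj Z\<close> affine, so \<open>z\<close> agrees
  almost everywhere with a function \<open>W\<close> satisfying \<open>W'' = W\<close>. Centring the
  hyperbolic functions at the midpoint makes them even and odd, which treats the two ends
  alike.\<close>

lemma edge_deficiency: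
  assumes l: "0 < l" and z: "sq_int l z"
    and orth: "\<And>\<phi> \<phi>1 g. sq_int l g \<Longrightarrow> ac_deriv l \<phi> \<phi>1 \<Longrightarrow> ac_deriv l \<phi>1 g \<Longrightarrow> \<phi> 0 = 0 \<Longrightarrow> \<phi>1 0 = 0
      \<Longrightarrow> \<phi> l = 0 \<Longrightarrow> \<phi>1 l = 0 \<Longrightarrow> (LINT x:{0..l}|lborel. (\<phi> x - g x) * cnj (z x)) = 0"
  shows "\<exists>p q. AE x in lborel. x \<in> {0<..<l} \<longrightarrow>
    z x = p * of_real (cosh (x - l/2)) + q * of_real (sinh (x - l/2))"
proof -
  obtain Z Z1 where Z: "ac_deriv l Z Z1" "ac_deriv l Z1 (\<lambda>x. cnj (z x))"
    by (rule ac_deriv_second_antiderivative[OF sq_int_integrable[OF sq_int_cnj[OF z]]])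
  have Zs: "sq_int l (\<lambda>x. cnj (Z x))" by (rule sq_int_cnj[OF sq_int_cont[OF ac_deriv_continuous[OF Z(1)]]])
  have "\<exists>\<alpha> \<beta>. AE x in lborel. x \<in> {0<..<l} \<longrightarrow> z x - cnj (Z x) = \<alpha> + \<beta> * of_real x"
  proof (rule affine_if_orthogonal[OF l sq_int_diff[OF z Zs]])
    fix g assume g: "sq_int l g" "(LINT x:{0..l}|lborel. g x) = 0" "(LINT x:{0..l}|lborel. of_real x * g x) = 0"
    obtain \<phi> \<phi>1 where p: "ac_deriv l \<phi> \<phi>1" "ac_deriv l \<phi>1 g" "\<phi> 0 = 0" "\<phi>1 0 = 0" "\<phi> l = 0" "\<phi>1 l = 0"
      and eq: "(LINT x:{0..l}|lborel. \<phi> x * cnj (z x)) = (LINT x:{0..l}|lborel. g x * Z x)"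
      using twice_integrated[OF l z g Z] by blast
    have i1: "set_integrable lborel {0..l} (\<lambda>x. \<phi> x * cnj (z x))"
      by (intro set_integrable_mult_cnj z sq_int_cont ac_deriv_continuous[OF p(1)])
    have i2: "set_integrable lborel {0..l} (\<lambda>x. g x * cnj (z x))"
      by (intro set_integrable_mult_cnj z g)
    have i3: "set_integrable lborel {0..l} (\<lambda>x. g x * Z x)"
      using set_integrable_mult_cnj[OF g(1) Zs] by simp
    have "0 = (LINT x:{0..l}|lborel. (\<phi> x - g x) * cnj (z x))" using orth[OF g(1) p] by simp
    also have "\<dots> = (LINT x:{0..l}|lborel. \<phi> x * cnj (z x)) - (LINT x:{0..l}|lborel. g x * cnj (z x))"
      unfolding left_diff_distrib by (rule set_integral_diff(2)[OF i1 i2])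
    also have "\<dots> = - (LINT x:{0..l}|lborel. g x * cnj (z x) - g x * Z x)"
      unfolding eq set_integral_diff(2)[OF i2 i3] by simp
    finally have "(LINT x:{0..l}|lborel. g x * cnj (z x) - g x * Z x) = 0" by simp
    then show "(LINT x:{0..l}|lborel. g x * cnj (z x - cnj (Z x))) = 0"
      by (simp add: right_diff_distrib)
  qed
  then obtain \<alpha> \<beta> where ae: "AE x in lborel. x \<in> {0<..<l} \<longrightarrow> z x - cnj (Z x) = \<alpha> + \<beta> * of_real x" by blast
  define W where "W x = cnj (Z x) + (\<alpha> + \<beta> * of_real x)" for x
  define W1 where "W1 x = cnj (Z1 x) + (0 + \<beta> * 1)" for x
  have W: "ac_deriv l W W1"
    unfolding W_def[abs_def] W1_def[abs_def] by (intro ac_deriv_add ac_deriv_cnj ac_deriv_const ac_deriv_cmult ac_deriv_id Z)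
  have "ac_deriv l W1 (\<lambda>x. cnj (cnj (z x)) + 0)"
    unfolding W1_def[abs_def] by (intro ac_deriv_add ac_deriv_cnj ac_deriv_const Z)
  then have W1: "ac_deriv l W1 W"
    by (rule ac_deriv_cong[OF _ refl set_borel_measurable_cont[OF ac_deriv_continuous[OF W]]])
       (use ae in \<open>auto simp: W_def diff_eq_eq add.commute elim!: eventually_mono\<close>)
  define C where "C x = complex_of_real (cosh (x - l/2))" for x
  define S where "S x = complex_of_real (sinh (x - l/2))" for x
  have C: "ac_deriv l C S" unfolding C_def[abs_def] S_def[abs_def]
    by (rule ac_deriv_of_real) (auto intro!: derivative_eq_intros continuous_intros)
  have S: "ac_deriv l S C" unfolding C_def[abs_def] S_def[abs_def]
    by (rule ac_deriv_of_real) (auto intro!: derivative_eq_intros continuous_intros)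
  have CS: "C x * C x - S x * S x = 1" for x
  proof -
    have "complex_of_real ((cosh (x - l/2))\<^sup>2 - (sinh (x - l/2))\<^sup>2) = 1" by (simp add: hyperbolic_pythagoras)
    then show ?thesis unfolding C_def S_def power2_eq_square by simp
  qed
  have const: "F x = F 0" if "ac_deriv l F f" "\<And>t. f t = 0" "0 \<le> x" "x \<le> l" for F f x
    using ac_deriv_eq[OF that(1), of x] that(2-) by simp
  \<comment> \<open>Wronskian-type combinations: differentiation exchanges \<open>W\<close> with
    \<open>W1\<close> and \<open>C\<close> with \<open>S\<close>, so both combinations are constant,
    and \<open>CS\<close> solves for \<open>W\<close>.\<close>
  have P: "W x * C x - W1 x * S x = W 0 * C 0 - W1 0 * S 0" if "0 \<le> x" "x \<le> l" for x
    by (rule const[OF ac_deriv_diff[OF ac_deriv_mult[OF W C] ac_deriv_mult[OF W1 S]] _ that]) simp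
  have Q: "W1 x * C x - W x * S x = W1 0 * C 0 - W 0 * S 0" if "0 \<le> x" "x \<le> l" for x
    by (rule const[OF ac_deriv_diff[OF ac_deriv_mult[OF W1 C] ac_deriv_mult[OF W S]] _ that]) simp
  have "W x = (W 0 * C 0 - W1 0 * S 0) * C x + (W1 0 * C 0 - W 0 * S 0) * S x" if "0 \<le> x" "x \<le> l" for x
  proof -
    have "(W x * C x - W1 x * S x) * C x + (W1 x * C x - W x * S x) * S x = W x * (C x * C x - S x * S x)"
      by (simp add: algebra_simps)
    then show ?thesis unfolding P[OF that] Q[OF that] CS by simp
  qed
  then have "AE x in lborel. x \<in> {0<..<l} \<longrightarrow>
      z x = (W 0 * C 0 - W1 0 * S 0) * of_real (cosh (x - l/2)) + (W1 0 * C 0 - W 0 * S 0) * of_real (sinh (x - l/2))"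
    using ae by (auto elim!: eventually_mono simp: W_def C_def S_def algebra_simps)
  then show ?thesis by blast
qed

section \<open>The discrete equation on the vertices\<close>

definition other_end :: "'v edge \<Rightarrow> 'v \<Rightarrow> 'v" where
  "other_end e v = (if fst e = v then snd e else fst e)"

lemma graphD:
  assumes "metric_graph V E len"
  shows "countable V" "countable E" "\<And>v. v \<in> V \<Longrightarrow> finite (incident_edges E v)"
    "\<And>v. v \<in> V \<Longrightarrow> incident_edges E v \<noteq> {}"
    "\<And>e. e \<in> E \<Longrightarrow> fst e \<in> V" "\<And>e. e \<in> E \<Longrightarrow> snd e \<in> V" "\<And>e. e \<in> E \<Longrightarrow> fst e \<noteq> snd e"
    "\<And>u v. (u, v) \<in> E \<Longrightarrow> (v, u) \<notin> E" "\<And>e. e \<in> E \<Longrightarrow> 0 < len e"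
proof -
  have s: "countable V" "E \<subseteq> V \<times> V" "\<forall>(u, v) \<in> E. u \<noteq> v \<and> (v, u) \<notin> E"
    "\<forall>v \<in> V. finite (incident_edges E v) \<and> card (incident_edges E v) \<ge> 1" "\<forall>e \<in> E. len e > 0"
    using assms unfolding metric_graph_def by blast+
  show "countable V" "\<And>v. v \<in> V \<Longrightarrow> finite (incident_edges E v)" "\<And>e. e \<in> E \<Longrightarrow> 0 < len e"
    using s by auto
  show "countable E" using s(1,2) by (meson countable_SIGMA countable_subset)
  show "\<And>v. v \<in> V \<Longrightarrow> incident_edges E v \<noteq> {}" using s(4) by force
  show "\<And>e. e \<in> E \<Longrightarrow> fst e \<in> V" "\<And>e. e \<in> E \<Longrightarrow> snd e \<in> V" using s(2) by auto
  show "\<And>e. e \<in> E \<Longrightarrow> fst e \<noteq> snd e" "\<And>u v. (u, v) \<in> E \<Longrightarrow> (v, u) \<notin> E" using s(3) by auto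
qed

section \<open>Exchanging sums over vertices and over edges\<close>

lemma incident_edges_iff: "e \<in> incident_edges E v \<longleftrightarrow> e \<in> E \<and> (fst e = v \<or> snd e = v)"
  by (simp add: incident_edges_def)

text \<open>Double counting of incidences. The ends of an edge are distinct because there are no
  loops, so each edge contributes one term per end in \<open>K\<close>; an edge leaving
  \<open>K\<close> contributes only at its inner end.\<close>

lemma sum_vertices_incident:
  fixes G :: "'v \<Rightarrow> 'v edge \<Rightarrow> 'b::comm_monoid_add"
  assumes G: "metric_graph V E len" and K: "finite K" "K \<subseteq> V"
  shows "(\<Sum>v\<in>K. \<Sum>e\<in>incident_edges E v. G v e) =
    (\<Sum>e\<in>(\<Union>v\<in>K. incident_edges E v). (if fst e \<in> K then G (fst e) e else 0) + (if snd e \<in> K then G (snd e) e else 0))"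
proof -
  let ?F = "\<Union>v\<in>K. incident_edges E v"
  note g = graphD[OF G]
  have F: "finite ?F" using K g(3) by auto
  have "(\<Sum>v\<in>K. \<Sum>e\<in>incident_edges E v. G v e) = (\<Sum>v\<in>K. \<Sum>e\<in>?F. if e \<in> incident_edges E v then G v e else 0)"
  proof (rule sum.cong[OF refl])
    fix v assume "v \<in> K"
    then have "?F \<inter> incident_edges E v = incident_edges E v" by auto
    then show "(\<Sum>e\<in>incident_edges E v. G v e) = (\<Sum>e\<in>?F. if e \<in> incident_edges E v then G v e else 0)"
      using sum.inter_restrict[OF F, of "G v" "incident_edges E v"] by simp
  qed
  also have "\<dots> = (\<Sum>e\<in>?F. \<Sum>v\<in>K. if e \<in> incident_edges E v then G v e else 0)"
    by (rule sum.swap)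
  also have "\<dots> = (\<Sum>e\<in>?F. (if fst e \<in> K then G (fst e) e else 0) + (if snd e \<in> K then G (snd e) e else 0))"
  proof (rule sum.cong[OF refl])
    fix e assume "e \<in> ?F"
    then have e: "e \<in> E" by (auto simp: incident_edges_iff)
    have "(\<Sum>v\<in>K. if e \<in> incident_edges E v then G v e else 0)
        = (\<Sum>v\<in>K. (if v = fst e then G v e else 0) + (if v = snd e then G v e else 0))"
      using g(7)[OF e] e by (intro sum.cong) (auto simp: incident_edges_iff)
    also have "\<dots> = (if fst e \<in> K then G (fst e) e else 0) + (if snd e \<in> K then G (snd e) e else 0)"
      using K(1) by (simp add: sum.distrib)
    finally show "(\<Sum>v\<in>K. if e \<in> incident_edges E v then G v e else 0)
      = (if fst e \<in> K then G (fst e) e else 0) + (if snd e \<in> K then G (snd e) e else 0)" .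
  qed
  finally show ?thesis .
qed

text \<open>Without multiple edges \<open>other_end\<close> is a bijection from the edges at
  \<open>v\<close> to the neighbours of \<open>v\<close>; this brings \<open>wDeg\<close> and
  \<open>intrinsic\<close>, which are stated with neighbours, into edge form.\<close>

lemma sum_neighbours:
  assumes G: "metric_graph V E len" and v: "v \<in> V"
  shows "(\<Sum>u\<in>neighbours E v. wb E len u v * h u) = (\<Sum>e\<in>incident_edges E v. h (other_end e v) / len e)"
proof -
  note g = graphD[OF G]
  have inj: "inj_on (\<lambda>e. other_end e v) (incident_edges E v)"
  proof (rule inj_onI)
    fix e e' assume a: "e \<in> incident_edges E v" "e' \<in> incident_edges E v" "other_end e v = other_end e' v"
    obtain x y x' y' where e: "e = (x, y)" "e' = (x', y')" by (metis surj_pair)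
    show "e = e'"
      using a g(8)[of x y] unfolding e by (auto simp: incident_edges_iff other_end_def split: if_splits)
  qed
  have img: "(\<lambda>e. other_end e v) ` incident_edges E v = neighbours E v"
    by (force simp: other_end_def incident_edges_iff neighbours_def adjacent_def image_iff)
  have "(\<Sum>u\<in>neighbours E v. wb E len u v * h u) = (\<Sum>e\<in>incident_edges E v. wb E len (other_end e v) v * h (other_end e v))"
    unfolding img[symmetric] by (simp add: sum.reindex[OF inj])
  also have "\<dots> = (\<Sum>e\<in>incident_edges E v. h (other_end e v) / len e)"
  proof (rule sum.cong[OF refl])
    fix e assume a: "e \<in> incident_edges E v"
    obtain x y where e: "e = (x, y)" by (metis surj_pair)
    have "wb E len (other_end e v) v = 1 / len e"
      using a g(8)[of x y] unfolding e
      by (auto simp: incident_edges_iff other_end_def wb_def adjacent_def elen_def)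
    then show "wb E len (other_end e v) v * h (other_end e v) = h (other_end e v) / len e" by simp
  qed
  finally show ?thesis .
qed

lemma vm_pos: assumes "metric_graph V E len" "v \<in> V" shows "0 < vm E len v"
  unfolding vm_def using graphD[OF assms(1)] assms(2)
  by (intro sum_pos) (auto simp: incident_edges_iff)

text \<open>Pairing the edge term of the equation with the squared cutoff times the conjugate
  solution and completing the square leaves \<open>b * |s x - t y|^2\<close>, which is nonnegative
  and dropped, minus \<open>b * (s - t)^2 * Re (x * cnj y)\<close>. So the cutoff enters the error
  only through the difference of its values.\<close>

lemma edge_energy_bound:
  fixes x y :: complex and s t :: real
  assumes b: "0 \<le> b" "b \<le> 1 / l" and \<tau>: "c * l \<le> \<tau>" 
  shows "c * l * (s\<^sup>2 * (cmod x)\<^sup>2 + t\<^sup>2 * (cmod y)\<^sup>2) - (s - t)\<^sup>2 / l * ((cmod x)\<^sup>2 + (cmod y)\<^sup>2) / 2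
    \<le> Re (of_real (s\<^sup>2) * cnj x * (of_real b * (x - y) + of_real \<tau> * x)
        + of_real (t\<^sup>2) * cnj y * (of_real b * (y - x) + of_real \<tau> * y))"
proof -
  define N where "N = (cmod x)\<^sup>2 + (cmod y)\<^sup>2"
  define I where "I = Re x * Re y + Im x * Im y"
  define P where "P = (s * Re x - t * Re y)\<^sup>2 + (s * Im x - t * Im y)\<^sup>2"
  define M where "M = s\<^sup>2 * (cmod x)\<^sup>2 + t\<^sup>2 * (cmod y)\<^sup>2"
  have P: "P \<ge> 0" and M: "M \<ge> 0" by (simp_all add: P_def M_def)
  have I: "I \<le> N / 2"
    using zero_le_power2[of "Re x - Re y"] zero_le_power2[of "Im x - Im y"]
    unfolding I_def N_def cmod_power2 by (simp add: power2_eq_square algebra_simps)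
  have eq: "Re (of_real (s\<^sup>2) * cnj x * (of_real b * (x - y) + of_real \<tau> * x)
        + of_real (t\<^sup>2) * cnj y * (of_real b * (y - x) + of_real \<tau> * y))
      = b * P - b * ((s - t)\<^sup>2 * I) + \<tau> * M"
    unfolding P_def I_def M_def cmod_power2 by (simp add: power2_eq_square algebra_simps)
  have "b * ((s - t)\<^sup>2 * I) \<le> b * ((s - t)\<^sup>2 * (N / 2))"
    by (intro mult_left_mono I b) auto
  also have "\<dots> \<le> 1 / l * ((s - t)\<^sup>2 * (N / 2))"
    by (intro mult_right_mono b) (auto simp: N_def)
  finally have 1: "b * ((s - t)\<^sup>2 * I) \<le> (s - t)\<^sup>2 / l * N / 2" by simp
  have 2: "c * l * M \<le> \<tau> * M" by (intro mult_right_mono \<tau> M)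
  have 3: "0 \<le> b * P" by (intro mult_nonneg_nonneg b P)
  show ?thesis unfolding eq using 1 2 3 unfolding N_def M_def by linarith
qed

text \<open>A Caccioppoli inequality: the equation is tested with \<open>\<phi>^2 * f\<close>, so
  the weighted mass is controlled by the squared gradient of the cutoff. \<open>F\<close> contains
  the edges leaving the finite set \<open>K\<close>, across which \<open>\<phi>\<close> drops to
  zero.\<close>

lemma discrete_energy_estimate:
  fixes f :: "'v \<Rightarrow> complex" and \<phi> :: "'v \<Rightarrow> real"
  assumes G: "metric_graph V E len" and K: "finite K" "K \<subseteq> V" and \<phi>: "\<And>v. v \<notin> K \<Longrightarrow> \<phi> v = 0"
    and b: "\<And>e. e \<in> E \<Longrightarrow> 0 \<le> b e \<and> b e \<le> 1 / len e" and \<tau>: "\<And>e. e \<in> E \<Longrightarrow> c * len e \<le> \<tau> e"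
    and eq: "\<And>v. v \<in> V \<Longrightarrow> (\<Sum>e\<in>incident_edges E v. of_real (b e) * (f v - f (other_end e v)) + of_real (\<tau> e) * f v) = 0"
  defines "F \<equiv> \<Union>v\<in>K. incident_edges E v"
  shows "(\<Sum>e\<in>F. c * len e * ((\<phi> (fst e))\<^sup>2 * (cmod (f (fst e)))\<^sup>2 + (\<phi> (snd e))\<^sup>2 * (cmod (f (snd e)))\<^sup>2))
    \<le> (\<Sum>e\<in>F. (\<phi> (fst e) - \<phi> (snd e))\<^sup>2 / len e * ((cmod (f (fst e)))\<^sup>2 + (cmod (f (snd e)))\<^sup>2) / 2)"
proof -
  note g = graphD[OF G]
  define H where "H v e = of_real ((\<phi> v)\<^sup>2) * cnj (f v) * (of_real (b e) * (f v - f (other_end e v)) + of_real (\<tau> e) * f v)" for v e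
  have "0 = (\<Sum>v\<in>K. of_real ((\<phi> v)\<^sup>2) * cnj (f v) * (\<Sum>e\<in>incident_edges E v. of_real (b e) * (f v - f (other_end e v)) + of_real (\<tau> e) * f v))"
    using K eq by (intro sum.neutral[symmetric]) auto
  also have "\<dots> = (\<Sum>v\<in>K. \<Sum>e\<in>incident_edges E v. H v e)"
    by (simp add: H_def sum_distrib_left)
  also have "\<dots> = (\<Sum>e\<in>F. H (fst e) e + H (snd e) e)"
    unfolding F_def sum_vertices_incident[OF G K]
    by (intro sum.cong) (auto simp: H_def \<phi>)
  finally have "Re 0 = Re (\<Sum>e\<in>F. H (fst e) e + H (snd e) e)"
    by (rule arg_cong)
  then have "0 = (\<Sum>e\<in>F. Re (H (fst e) e + H (snd e) e))"
    unfolding Re_sum by simp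
  moreover have "c * len e * ((\<phi> (fst e))\<^sup>2 * (cmod (f (fst e)))\<^sup>2 + (\<phi> (snd e))\<^sup>2 * (cmod (f (snd e)))\<^sup>2)
      - (\<phi> (fst e) - \<phi> (snd e))\<^sup>2 / len e * ((cmod (f (fst e)))\<^sup>2 + (cmod (f (snd e)))\<^sup>2) / 2
      \<le> Re (H (fst e) e + H (snd e) e)" if "e \<in> F" for e
  proof -
    have e: "e \<in> E" using that by (auto simp: F_def incident_edges_iff)
    have o: "other_end e (fst e) = snd e" "other_end e (snd e) = fst e" using g(7)[OF e] by (auto simp: other_end_def)
    show ?thesis
      using edge_energy_bound[of "b e" "len e" c "\<tau> e" "\<phi> (fst e)" "f (fst e)" "\<phi> (snd e)" "f (snd e)"] b[OF e] \<tau>[OF e]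
      unfolding H_def o by blast
  qed
  then have "(\<Sum>e\<in>F. c * len e * ((\<phi> (fst e))\<^sup>2 * (cmod (f (fst e)))\<^sup>2 + (\<phi> (snd e))\<^sup>2 * (cmod (f (snd e)))\<^sup>2)
      - (\<phi> (fst e) - \<phi> (snd e))\<^sup>2 / len e * ((cmod (f (fst e)))\<^sup>2 + (cmod (f (snd e)))\<^sup>2) / 2)
      \<le> (\<Sum>e\<in>F. Re (H (fst e) e + H (snd e) e))"
    by (rule sum_mono)
  ultimately show ?thesis by (simp add: sum_subtractf)
qed

section \<open>Cutoffs from the intrinsic metric and their truncation\<close>

lemma cutoff_properties:
  assumes \<rho>: "pseudo_metric V \<rho>" and v0: "v0 \<in> V" and R: "0 < R"
  defines "\<eta> \<equiv> \<lambda>v. max 0 (min 1 (2 - \<rho> v v0 / R))"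
  shows "\<eta> v0 = 1" "0 \<le> \<eta> v" "\<eta> v \<le> 1" "\<lbrakk>v \<in> V; \<eta> v \<noteq> 0\<rbrakk> \<Longrightarrow> v \<in> dball V \<rho> (2 * R) v0"
    "\<lbrakk>u \<in> V; v \<in> V\<rbrakk> \<Longrightarrow> \<bar>\<eta> u - \<eta> v\<bar> \<le> \<rho> u v / R"
proof -
  have \<rho>0: "\<rho> v0 v0 = 0" using \<rho> v0 by (auto simp: pseudo_metric_def)
  show "\<eta> v0 = 1" "0 \<le> \<eta> v" "\<eta> v \<le> 1" by (auto simp: \<eta>_def \<rho>0)
  show "v \<in> dball V \<rho> (2 * R) v0" if "v \<in> V" "\<eta> v \<noteq> 0"
  proof -
    have "2 - \<rho> v v0 / R > 0" using that(2) by (auto simp: \<eta>_def max_def split: if_splits)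
    then show ?thesis using R that(1) by (simp add: dball_def field_simps)
  qed
  assume u: "u \<in> V" "v \<in> V"
  have "\<rho> u v0 \<le> \<rho> u v + \<rho> v v0" "\<rho> v v0 \<le> \<rho> u v + \<rho> u v0"
    using \<rho> u v0 unfolding pseudo_metric_def by metis+
  then have "\<rho> u v0 / R \<le> \<rho> u v / R + \<rho> v v0 / R" "\<rho> v v0 / R \<le> \<rho> u v / R + \<rho> u v0 / R"
    using R by (simp_all add: divide_right_mono flip: add_divide_distrib)
  then show "\<bar>\<eta> u - \<eta> v\<bar> \<le> \<rho> u v / R"
    unfolding \<eta>_def by (auto simp: max_def min_def abs_if)
qed

text \<open>No bound on the jumps \<open>\<rho> u v\<close> along edges is available, so an edge may join the support of
  the cutoff to a vertex of uncontrolled degree. The Lipschitz bound for \<open>\<eta>\<close> together with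
  intrinsicness controls the contribution of these edges.\<close>

lemma boundary_edge_bound:
  fixes s t r l A B R :: real
  assumes st: "0 \<le> s" "0 \<le> t" "\<bar>s - t\<bar> \<le> r / R" and l: "0 < l" and AB: "0 \<le> A" "0 \<le> B"
  shows "s\<^sup>2 / l * (A + B) \<le> (2 * s\<^sup>2 + 2 * (r\<^sup>2 / R\<^sup>2)) / l * A + (2 * t\<^sup>2 + 2 * (r\<^sup>2 / R\<^sup>2)) / l * B"
proof -
  have "(s - t)\<^sup>2 \<le> (r / R)\<^sup>2" using power_mono[OF st(3), of 2] by simp
  then have d: "(s - t)\<^sup>2 \<le> r\<^sup>2 / R\<^sup>2" by (simp add: power_divide)
  have "s\<^sup>2 \<le> 2 * t\<^sup>2 + 2 * (s - t)\<^sup>2"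
    using zero_le_power2[of "2 * t - s"] by (simp add: power2_eq_square algebra_simps)
  then have "s\<^sup>2 \<le> 2 * t\<^sup>2 + 2 * (r\<^sup>2 / R\<^sup>2)" using d by linarith
  then have "s\<^sup>2 / l * B \<le> (2 * t\<^sup>2 + 2 * (r\<^sup>2 / R\<^sup>2)) / l * B"
    using l AB by (intro mult_right_mono divide_right_mono) auto
  moreover have "s\<^sup>2 \<le> 2 * s\<^sup>2 + 2 * (r\<^sup>2 / R\<^sup>2)" by simp
  then have "s\<^sup>2 / l * A \<le> (2 * s\<^sup>2 + 2 * (r\<^sup>2 / R\<^sup>2)) / l * A"
    using l AB by (intro mult_right_mono divide_right_mono) auto
  ultimately show ?thesis by (simp only: distrib_left)
qed

text \<open>The ball carrying the cutoff \<open>\<eta>\<close> may be infinite, so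
  \<open>\<eta>\<close> is truncated to a finite set \<open>K\<close>. Edges inside \<open>K\<close>
  cost at most the Lipschitz bound, which intrinsicness sums to \<open>vm / R^2\<close> per vertex.
  An edge cut by the truncation costs the square of \<open>\<eta>\<close> over its length; such
  edges have both ends outside \<open>K1\<close>, where the degree bound \<open>C\<close> and a mass
  of at most \<open>\<epsilon>\<close> make their total a multiple of
  \<open>\<epsilon>\<close>.\<close>

lemma discrete_cutoff_estimate:
  fixes f :: "'v \<Rightarrow> complex"
  assumes G: "metric_graph V E len" and \<rho>: "intrinsic V E len \<rho>" and v0: "v0 \<in> V" and R: "0 < R" and \<epsilon>: "0 < \<epsilon>"
    and C: "0 \<le> C" "\<And>u. u \<in> dball V \<rho> (2 * R) v0 \<Longrightarrow> wDeg E len u \<le> C"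
    and b: "\<And>e. e \<in> E \<Longrightarrow> 0 \<le> b e \<and> b e \<le> 1 / len e" and c: "0 < c" and \<tau>: "\<And>e. e \<in> E \<Longrightarrow> c * len e \<le> \<tau> e"
    and eq: "\<And>v. v \<in> V \<Longrightarrow> (\<Sum>e\<in>incident_edges E v. of_real (b e) * (f v - f (other_end e v)) + of_real (\<tau> e) * f v) = 0"
    and sum: "(\<lambda>v. vm E len v * (cmod (f v))\<^sup>2) summable_on V"
  shows "2 * (c * vm E len v0 * (cmod (f v0))\<^sup>2)
    \<le> (\<Sum>\<^sub>\<infinity>v\<in>V. vm E len v * (cmod (f v))\<^sup>2) / R\<^sup>2 + (2 * C + 2 / R\<^sup>2) * \<epsilon>"
proof -
  note g = graphD[OF G]
  have pm: "pseudo_metric V \<rho>" using \<rho> by (simp add: intrinsic_def)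
  have sym: "\<rho> u v = \<rho> v u" if "u \<in> V" "v \<in> V" for u v using pm that unfolding pseudo_metric_def by metis
  define w where "w v = vm E len v * (cmod (f v))\<^sup>2" for v
  define W where "W = infsum w V"
  have w0: "0 \<le> w v" if "v \<in> V" for v using vm_pos[OF G that] by (simp add: w_def)
  have ws: "w summable_on V" using sum by (simp add: w_def[abs_def])
  have wle: "sum w T \<le> W" if "finite T" "T \<subseteq> V" for T
    unfolding W_def by (rule finite_sum_le_infsum[OF ws that]) (use w0 in auto)
  obtain K1 where K1: "finite K1" "K1 \<subseteq> V" "W - \<epsilon> < sum w K1"
  proof -
    have "(w has_sum W) V" unfolding W_def using ws by (rule has_sum_infsum)
    then have "\<forall>\<^sub>F T in finite_subsets_at_top V. W - \<epsilon> < sum w T"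
      unfolding has_sum_def by (rule order_tendstoD) (use \<epsilon> in simp)
    then show thesis using that unfolding eventually_finite_subsets_at_top by blast
  qed
  have tail: "sum w (T - K1) \<le> \<epsilon>" if "finite T" "T \<subseteq> V" for T
  proof -
    have "sum w (T - K1) + sum w K1 = sum w ((T - K1) \<union> K1)"
      using that K1 by (intro sum.union_disjoint[symmetric]) auto
    also have "\<dots> \<le> W" using that K1 by (intro wle) auto
    finally show ?thesis using K1(3) by simp
  qed
  \<comment> \<open>Constant 1 up to distance \<open>R\<close>, then decreasing linearly to 0 at
    distance \<open>2 * R\<close>: hence the Lipschitz constant \<open>1 / R\<close> and the radius
    \<open>2 * R\<close> in the degree hypothesis.\<close>
  define \<eta> where "\<eta> v = max 0 (min 1 (2 - \<rho> v v0 / R))" for v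
  note \<eta> = cutoff_properties[OF pm v0 R, folded \<eta>_def]
  \<comment> \<open>\<open>K1\<close> enlarged by all its neighbours, so that, by \<open>nb\<close>,
    an edge with an end outside \<open>K\<close> has no end in \<open>K1\<close>. Adding
    \<open>v0\<close> keeps the truncated cutoff equal to 1 there.\<close>
  define K where "K = insert v0 (K1 \<union> (\<Union>v\<in>K1. \<Union>e\<in>incident_edges E v. {fst e, snd e}))"
  have K: "finite K" "K \<subseteq> V" "K1 \<subseteq> K" "v0 \<in> K"
    unfolding K_def using K1 v0 g by (auto simp: incident_edges_iff)
  have nb: "fst e \<notin> K1 \<and> snd e \<notin> K1" if "e \<in> E" "fst e \<notin> K \<or> snd e \<notin> K" for e
  proof -
    have "e \<in> incident_edges E (fst e)" "e \<in> incident_edges E (snd e)"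
      using that(1) by (auto simp: incident_edges_iff)
    then show ?thesis using that(2) unfolding K_def by blast
  qed
  define \<phi> where "\<phi> v = (if v \<in> K then \<eta> v else 0)" for v
  define F where "F = (\<Union>v\<in>K. incident_edges E v)"
  have F: "finite F" "F \<subseteq> E" using K g by (auto simp: F_def incident_edges_iff)
  define r where "r e = (\<rho> (fst e) (snd e))\<^sup>2 / R\<^sup>2" for e
  \<comment> \<open>The part of the cost of \<open>e\<close> charged to its end \<open>v\<close>: a
    gradient part \<open>r e\<close>, and off \<open>K1\<close> the surcharge from
    \<open>boundary_edge_bound\<close>, which lets both ends share the cost of a cut edge.\<close>
  define H where "H v e = r e / len e * (cmod (f v))\<^sup>2
    + (if v \<in> K1 then 0 else (2 * (\<eta> v)\<^sup>2 + 2 * r e) / len e * (cmod (f v))\<^sup>2)" for v e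
  have r0: "0 \<le> r e" for e by (simp add: r_def)
  have H0: "0 \<le> H v e" if "e \<in> E" for v e
    using g(9)[OF that] r0[of e] by (auto simp: H_def)
  have edge: "(\<phi> (fst e) - \<phi> (snd e))\<^sup>2 / len e * ((cmod (f (fst e)))\<^sup>2 + (cmod (f (snd e)))\<^sup>2)
      \<le> H (fst e) e + H (snd e) e" if "e \<in> F" for e
  proof -
    have e: "e \<in> E" using that F by auto
    have V: "fst e \<in> V" "snd e \<in> V" and l: "0 < len e" using g e by auto
    have lip: "\<bar>\<eta> (fst e) - \<eta> (snd e)\<bar> \<le> \<rho> (fst e) (snd e) / R" by (rule \<eta>(5)[OF V])
    have p0: "0 \<le> r e / len e * (cmod (f v))\<^sup>2" for v using r0[of e] l by simp
    consider "fst e \<in> K" "snd e \<in> K" | "fst e \<in> K" "snd e \<notin> K" | "fst e \<notin> K" "snd e \<in> K" | "fst e \<notin> K" "snd e \<notin> K" by blast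
    then show ?thesis
    proof cases
      case 1
      have "(\<eta> (fst e) - \<eta> (snd e))\<^sup>2 \<le> (\<rho> (fst e) (snd e) / R)\<^sup>2"
        using power_mono[OF lip, of 2] by simp
      then have "(\<phi> (fst e) - \<phi> (snd e))\<^sup>2 \<le> r e" using 1 by (simp add: \<phi>_def r_def power_divide)
      then have "(\<phi> (fst e) - \<phi> (snd e))\<^sup>2 / len e * ((cmod (f (fst e)))\<^sup>2 + (cmod (f (snd e)))\<^sup>2)
        \<le> r e / len e * ((cmod (f (fst e)))\<^sup>2 + (cmod (f (snd e)))\<^sup>2)"
        using l by (intro mult_right_mono divide_right_mono) auto
      also have "\<dots> \<le> H (fst e) e + H (snd e) e"
        using r0[of e] l unfolding H_def distrib_left by auto
      finally show ?thesis .
    next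
      case 2
      have n: "fst e \<notin> K1" "snd e \<notin> K1" using nb[OF e] 2 by auto
      show ?thesis
        using boundary_edge_bound[OF \<eta>(2) \<eta>(2) lip l, of "(cmod (f (fst e)))\<^sup>2" "(cmod (f (snd e)))\<^sup>2"]
          p0[of "fst e"] p0[of "snd e"] 2 n
        by (simp add: H_def \<phi>_def r_def)
    next
      case 3
      have n: "fst e \<notin> K1" "snd e \<notin> K1" using nb[OF e] 3 by auto
      have lip': "\<bar>\<eta> (snd e) - \<eta> (fst e)\<bar> \<le> \<rho> (fst e) (snd e) / R" using lip by simp
      show ?thesis
        using boundary_edge_bound[OF \<eta>(2) \<eta>(2) lip' l, of "(cmod (f (snd e)))\<^sup>2" "(cmod (f (fst e)))\<^sup>2"]
          p0[of "fst e"] p0[of "snd e"] 3 n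
        by (simp add: H_def \<phi>_def r_def add.commute)
    next
      case 4
      then show ?thesis using H0[OF e] by (simp add: \<phi>_def)
    qed
  qed
  \<comment> \<open>The ends outside \<open>K\<close> are included, because a cut edge is charged to
    its outer end too.\<close>
  define K' where "K' = (\<Union>e\<in>F. {fst e, snd e})"
  have K': "finite K'" "K' \<subseteq> V" using F g by (auto simp: K'_def)
  have vert: "(\<Sum>e\<in>incident_edges E v. H v e) \<le> w v / R\<^sup>2 + (if v \<in> K1 then 0 else (2 * C + 2 / R\<^sup>2) * w v)" if v: "v \<in> V" for v
  proof -
    have "(\<Sum>u \<in> neighbours E v. wb E len u v * (\<rho> u v)\<^sup>2) \<le> vm E len v"
      using \<rho> v by (simp add: intrinsic_def)
    then have "(\<Sum>e\<in>incident_edges E v. (\<rho> (other_end e v) v)\<^sup>2 / len e) \<le> vm E len v"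
      by (simp add: sum_neighbours[OF G v])
    moreover have "(\<Sum>e\<in>incident_edges E v. (\<rho> (other_end e v) v)\<^sup>2 / len e) = (\<Sum>e\<in>incident_edges E v. (\<rho> (fst e) (snd e))\<^sup>2 / len e)"
      by (intro sum.cong refl) (use g sym in \<open>auto simp: incident_edges_iff other_end_def\<close>)
    ultimately have 1: "(\<Sum>e\<in>incident_edges E v. (\<rho> (fst e) (snd e))\<^sup>2 / len e) \<le> vm E len v" by simp
    have rs: "(\<Sum>e\<in>incident_edges E v. r e / len e) \<le> vm E len v / R\<^sup>2"
    proof -
      have "(\<Sum>e\<in>incident_edges E v. r e / len e) = (\<Sum>e\<in>incident_edges E v. (\<rho> (fst e) (snd e))\<^sup>2 / len e) / R\<^sup>2"
        by (simp add: r_def sum_divide_distrib mult.commute)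
      then show ?thesis using 1 by (simp add: divide_right_mono)
    qed
    \<comment> \<open>The sum of inverse lengths at \<open>v\<close> is \<open>wDeg\<close> times
      \<open>vm\<close>. Where \<open>\<eta>\<close> is nonzero the vertex lies in the ball and
      \<open>C\<close> applies; elsewhere the factor \<open>\<eta>\<close> removes a degree that
      nothing controls.\<close>
    have "(\<Sum>e\<in>incident_edges E v. 1 / len e) = wDeg E len v * vm E len v"
      using sum_neighbours[OF G v, of "\<lambda>_. 1"] vm_pos[OF G v] by (simp add: wDeg_def)
    then have ds: "(\<eta> v)\<^sup>2 * (\<Sum>e\<in>incident_edges E v. 1 / len e) \<le> C * vm E len v"
    proof (cases "\<eta> v = 0")
      case True then show ?thesis using C vm_pos[OF G v] by simp
    next
      case False
      assume s: "(\<Sum>e\<in>incident_edges E v. 1 / len e) = wDeg E len v * vm E len v"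
      have "(\<Sum>e\<in>incident_edges E v. 1 / len e) \<ge> 0"
        using g by (intro sum_nonneg) (auto simp: incident_edges_iff less_imp_le)
      moreover have "(\<eta> v)\<^sup>2 \<le> 1" using \<eta>(2,3)[of v] by (simp add: power_le_one)
      ultimately have "(\<eta> v)\<^sup>2 * (\<Sum>e\<in>incident_edges E v. 1 / len e) \<le> (\<Sum>e\<in>incident_edges E v. 1 / len e)"
        by (intro mult_left_le_one_le) auto
      also have "\<dots> \<le> C * vm E len v"
        unfolding s using C(2)[OF \<eta>(4)[OF v False]] vm_pos[OF G v] by (intro mult_right_mono) auto
      finally show ?thesis .
    qed
    have "(\<Sum>e\<in>incident_edges E v. (2 * (\<eta> v)\<^sup>2 + 2 * r e) / len e)
        = 2 * ((\<eta> v)\<^sup>2 * (\<Sum>e\<in>incident_edges E v. 1 / len e)) + 2 * (\<Sum>e\<in>incident_edges E v. r e / len e)"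
      by (simp add: sum_distrib_left sum.distrib add_divide_distrib)
    then have s2: "(\<Sum>e\<in>incident_edges E v. (2 * (\<eta> v)\<^sup>2 + 2 * r e) / len e) \<le> (2 * C + 2 / R\<^sup>2) * vm E len v"
      using rs ds by (simp add: algebra_simps)
    have "(\<Sum>e\<in>incident_edges E v. H v e) = (\<Sum>e\<in>incident_edges E v. r e / len e) * (cmod (f v))\<^sup>2
      + (if v \<in> K1 then 0 else (\<Sum>e\<in>incident_edges E v. (2 * (\<eta> v)\<^sup>2 + 2 * r e) / len e) * (cmod (f v))\<^sup>2)"
      by (simp add: H_def sum.distrib sum_distrib_right)
    also have "\<dots> \<le> vm E len v / R\<^sup>2 * (cmod (f v))\<^sup>2
      + (if v \<in> K1 then 0 else (2 * C + 2 / R\<^sup>2) * vm E len v * (cmod (f v))\<^sup>2)"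
      using mult_right_mono[OF rs, of "(cmod (f v))\<^sup>2"] mult_right_mono[OF s2, of "(cmod (f v))\<^sup>2"] by auto
    finally show ?thesis by (cases "v \<in> K1") (simp_all add: w_def mult.assoc)
  qed
  have le: "(\<Sum>e\<in>F. H (fst e) e + H (snd e) e) \<le> (\<Sum>v\<in>K'. \<Sum>e\<in>incident_edges E v. H v e)"
  proof -
    have "(\<Sum>e\<in>F. H (fst e) e + H (snd e) e)
      = (\<Sum>e\<in>F. (if fst e \<in> K' then H (fst e) e else 0) + (if snd e \<in> K' then H (snd e) e else 0))"
      by (intro sum.cong) (auto simp: K'_def)
    also have "\<dots> \<le> (\<Sum>e\<in>(\<Union>v\<in>K'. incident_edges E v). (if fst e \<in> K' then H (fst e) e else 0) + (if snd e \<in> K' then H (snd e) e else 0))"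
    proof (rule sum_mono2)
      show "finite (\<Union>v\<in>K'. incident_edges E v)" using K' g by auto
      show "F \<subseteq> (\<Union>v\<in>K'. incident_edges E v)" using F by (force simp: K'_def incident_edges_iff)
    qed (auto simp: incident_edges_iff intro!: add_nonneg_nonneg H0)
    finally show ?thesis unfolding sum_vertices_incident[OF G K'] .
  qed
  \<comment> \<open>The edges at \<open>v0\<close>, where the cutoff is 1, already account for
    \<open>vm E len v0\<close>; doubling absorbs the factor 1/2 of the energy estimate.\<close>
  have "2 * (c * vm E len v0 * (cmod (f v0))\<^sup>2)
    = 2 * (\<Sum>e\<in>incident_edges E v0. c * len e * (cmod (f v0))\<^sup>2)"
    by (simp add: vm_def sum_distrib_left sum_distrib_right mult.assoc)
  also have "\<dots> \<le> 2 * (\<Sum>e\<in>incident_edges E v0. c * len e * ((\<phi> (fst e))\<^sup>2 * (cmod (f (fst e)))\<^sup>2 + (\<phi> (snd e))\<^sup>2 * (cmod (f (snd e)))\<^sup>2))"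
  proof (intro mult_left_mono sum_mono)
    fix e assume e: "e \<in> incident_edges E v0"
    then have "fst e = v0 \<or> snd e = v0" "0 < len e" using g by (auto simp: incident_edges_iff)
    then show "(cmod (f v0))\<^sup>2 \<le> (\<phi> (fst e))\<^sup>2 * (cmod (f (fst e)))\<^sup>2 + (\<phi> (snd e))\<^sup>2 * (cmod (f (snd e)))\<^sup>2"
      using K(4) \<eta>(1) by (auto simp: \<phi>_def)
    show "0 \<le> c * len e" using c \<open>0 < len e\<close> by simp
  qed auto
  also have "\<dots> \<le> 2 * (\<Sum>e\<in>F. c * len e * ((\<phi> (fst e))\<^sup>2 * (cmod (f (fst e)))\<^sup>2 + (\<phi> (snd e))\<^sup>2 * (cmod (f (snd e)))\<^sup>2))"
  proof (intro mult_left_mono sum_mono2)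
    show "incident_edges E v0 \<subseteq> F" using K(4) by (auto simp: F_def)
    show "0 \<le> c * len e * ((\<phi> (fst e))\<^sup>2 * (cmod (f (fst e)))\<^sup>2 + (\<phi> (snd e))\<^sup>2 * (cmod (f (snd e)))\<^sup>2)" if "e \<in> F - incident_edges E v0" for e
      using that F(2) g(9)[of e] c by auto
  qed (use F in auto)
  also have "\<dots> \<le> 2 * (\<Sum>e\<in>F. (\<phi> (fst e) - \<phi> (snd e))\<^sup>2 / len e * ((cmod (f (fst e)))\<^sup>2 + (cmod (f (snd e)))\<^sup>2) / 2)"
    unfolding F_def
    by (intro mult_left_mono discrete_energy_estimate[OF G K(1,2) _ b \<tau> eq]) (auto simp: \<phi>_def)
  also have "\<dots> = (\<Sum>e\<in>F. (\<phi> (fst e) - \<phi> (snd e))\<^sup>2 / len e * ((cmod (f (fst e)))\<^sup>2 + (cmod (f (snd e)))\<^sup>2))"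
    by (simp add: sum_distrib_left)
  also have "\<dots> \<le> (\<Sum>e\<in>F. H (fst e) e + H (snd e) e)"
    by (rule sum_mono[OF edge])
  also note le
  also have "(\<Sum>v\<in>K'. \<Sum>e\<in>incident_edges E v. H v e) \<le> (\<Sum>v\<in>K'. w v / R\<^sup>2 + (if v \<in> K1 then 0 else (2 * C + 2 / R\<^sup>2) * w v))"
    using K' by (intro sum_mono vert) auto
  also have "\<dots> = sum w K' / R\<^sup>2 + (2 * C + 2 / R\<^sup>2) * sum w (K' - K1)"
  proof -
    have "(\<Sum>v\<in>K'. if v \<in> K1 then 0 else (2 * C + 2 / R\<^sup>2) * w v) = (\<Sum>v\<in>K' - K1. (2 * C + 2 / R\<^sup>2) * w v)"
      using K'(1) by (intro sum.mono_neutral_cong_right) auto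
    then show ?thesis by (simp add: sum.distrib sum_divide_distrib sum_distrib_left)
  qed
  also have "\<dots> \<le> W / R\<^sup>2 + (2 * C + 2 / R\<^sup>2) * \<epsilon>"
    using C by (intro add_mono divide_right_mono mult_left_mono wle tail K') auto
  finally show ?thesis by (simp add: W_def w_def[abs_def])
qed

text \<open>The degree bound depends on \<open>R\<close>, so \<open>\<epsilon>\<close> is sent to 0
  with \<open>R\<close> fixed, and only the resulting inequality \<open>X \<le> W / R^2\<close>,
  free of \<open>C\<close>, is used for large \<open>R\<close>.\<close>

lemma discrete_uniqueness:
  fixes f :: "'v \<Rightarrow> complex"
  assumes G: "metric_graph V E len" and \<rho>: "intrinsic V E len \<rho>"
    and D: "\<forall>v \<in> V. \<forall>r \<ge> 0. \<exists>C. \<forall>u \<in> dball V \<rho> r v. wDeg E len u \<le> C"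
    and b: "\<And>e. e \<in> E \<Longrightarrow> 0 \<le> b e \<and> b e \<le> 1 / len e" and c: "0 < c" and \<tau>: "\<And>e. e \<in> E \<Longrightarrow> c * len e \<le> \<tau> e"
    and eq: "\<And>v. v \<in> V \<Longrightarrow> (\<Sum>e\<in>incident_edges E v. of_real (b e) * (f v - f (other_end e v)) + of_real (\<tau> e) * f v) = 0"
    and sum: "(\<lambda>v. vm E len v * (cmod (f v))\<^sup>2) summable_on V"
    and v: "v \<in> V"
  shows "f v = 0"
proof -
  define X where "X = 2 * (c * vm E len v * (cmod (f v))\<^sup>2)"
  define W where "W = (\<Sum>\<^sub>\<infinity>v\<in>V. vm E len v * (cmod (f v))\<^sup>2)"
  have XR: "X \<le> W / R\<^sup>2" if R: "0 < R" for R
  proof (rule field_le_epsilon)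
    obtain C where "\<forall>u \<in> dball V \<rho> (2 * R) v. wDeg E len u \<le> C"
      using D v R by (metis less_eq_real_def mult_nonneg_nonneg zero_le_numeral)
    then have C: "\<And>u. u \<in> dball V \<rho> (2 * R) v \<Longrightarrow> wDeg E len u \<le> max C 0" by (auto intro: max.coboundedI1)
    fix \<epsilon> :: real assume \<epsilon>: "0 < \<epsilon>"
    define d where "d = 2 * max C 0 + 2 / R\<^sup>2"
    have d: "0 < d" unfolding d_def using R by (intro add_nonneg_pos) auto
    have "X \<le> W / R\<^sup>2 + d * (\<epsilon> / d)"
      unfolding X_def W_def d_def[symmetric]
      using discrete_cutoff_estimate[OF G \<rho> v R divide_pos_pos[OF \<epsilon> d] _ C b c \<tau> eq sum, folded d_def] by simp
    then show "X \<le> W / R\<^sup>2 + \<epsilon>" using d by simp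
  qed
  have "X \<le> 0"
  proof (rule ccontr)
    assume "\<not> X \<le> 0"
    then have X: "X > 0" by simp
    \<comment> \<open>Makes \<open>X * R^2 = |W| + 1\<close>, which exceeds
      \<open>W\<close>.\<close>
    define R where "R = sqrt ((\<bar>W\<bar> + 1) / X)"
    have R2: "R\<^sup>2 = (\<bar>W\<bar> + 1) / X" and R: "R > 0" using X by (simp_all add: R_def)
    have "X * R\<^sup>2 \<le> W" using XR[OF R] R by (simp add: field_simps)
    then show False unfolding R2 using X by simp
  qed
  then have "vm E len v * (cmod (f v))\<^sup>2 \<le> 0" using c by (simp add: X_def mult.assoc mult_le_0_iff)
  then show ?thesis using vm_pos[OF G v] by (simp add: mult_le_0_iff)
qed

section \<open>The Kirchhoff core\<close>

definition vval :: "('v edge \<Rightarrow> real) \<Rightarrow> 'v gfun \<Rightarrow> 'v edge \<Rightarrow> 'v \<Rightarrow> complex" where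
  "vval len f e v = (if fst e = v then f e 0 else f e (len e))"

definition vder :: "('v edge \<Rightarrow> real) \<Rightarrow> 'v gfun \<Rightarrow> 'v edge \<Rightarrow> 'v \<Rightarrow> complex" where
  "vder len f1 e v = (if fst e = v then f1 e 0 else - f1 e (len e))"

text \<open>The witnesses of \<open>kirchhoff_core\<close>, with the initial slopes and inner
  integrals combined into the first derivative \<open>f1\<close>. Both ends of an edge are then on
  the same footing, and integration by parts applies directly.\<close>

definition core_data :: "'v set \<Rightarrow> 'v edge set \<Rightarrow> ('v edge \<Rightarrow> real) \<Rightarrow> 'v gfun \<Rightarrow> 'v gfun \<Rightarrow> 'v gfun \<Rightarrow> 'v gfun \<Rightarrow> bool" where
  "core_data V E len f h f1 g \<longleftrightarrow>
     finite {e \<in> E. \<exists>x \<in> {0..len e}. f e x \<noteq> 0} \<and>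
     (\<forall>e \<in> E. sq_int (len e) (g e) \<and> ac_deriv (len e) (f e) (f1 e) \<and> ac_deriv (len e) (f1 e) (g e) \<and>
        (\<forall>x \<in> {0<..<len e}. h e x = - g e x)) \<and>
     (\<forall>v \<in> V. \<forall>e \<in> incident_edges E v. \<forall>e' \<in> incident_edges E v. vval len f e v = vval len f e' v) \<and>
     (\<forall>v \<in> V. (\<Sum>e \<in> incident_edges E v. vder len f1 e v) = 0)"

lemma core_dataD:
  assumes "core_data V E len f h f1 g"
  shows "finite {e \<in> E. \<exists>x \<in> {0..len e}. f e x \<noteq> 0}"
    and "e \<in> E \<Longrightarrow> sq_int (len e) (g e)" and "e \<in> E \<Longrightarrow> ac_deriv (len e) (f e) (f1 e)"
    and "e \<in> E \<Longrightarrow> ac_deriv (len e) (f1 e) (g e)"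
    and "e \<in> E \<Longrightarrow> x \<in> {0<..<len e} \<Longrightarrow> h e x = - g e x"
    and "v \<in> V \<Longrightarrow> e \<in> incident_edges E v \<Longrightarrow> e' \<in> incident_edges E v \<Longrightarrow> vval len f e v = vval len f e' v"
    and "v \<in> V \<Longrightarrow> (\<Sum>e \<in> incident_edges E v. vder len f1 e v) = 0"
  using assms unfolding core_data_def by blast+

lemma LINT_affine:
  fixes c :: complex
  assumes g: "set_integrable lborel {0..x} g" and x: "0 \<le> x"
  shows "(LINT t:{0..x}|lborel. c + g t) = c * of_real x + (LINT t:{0..x}|lborel. g t)"
proof -
  have "(LINT t:{0..x}|lborel. c * 1) = c * of_real x"
    using ac_deriv_integral[OF ac_deriv_cmult[OF ac_deriv_id], of x c] x by simp
  moreover have "set_integrable lborel {0..x} (\<lambda>_. c)"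
    by (intro set_integrable_cont continuous_intros)
  ultimately show ?thesis using g by (simp add: set_integral_add(2))
qed

lemma kirchhoff_core_iff:
  assumes G: "metric_graph V E len"
  shows "(f, h) \<in> kirchhoff_core V E len \<longleftrightarrow> (\<exists>f1 g. core_data V E len f h f1 g)"
proof
  note gr = graphD[OF G]
  assume "(f, h) \<in> kirchhoff_core V E len"
  then obtain a b g where
    fin: "finite {e \<in> E. \<exists>x \<in> {0..len e}. f e x \<noteq> 0}" and
    sq: "\<And>e. e \<in> E \<Longrightarrow> sq_int (len e) (g e)" and
    rep: "\<And>e x. e \<in> E \<Longrightarrow> x \<in> {0..len e} \<Longrightarrow> f e x = a e + b e * of_real x +
             (LINT t:{0..x}|lborel. (LINT s:{0..t}|lborel. g e s))" and
    hg: "\<And>e x. e \<in> E \<Longrightarrow> x \<in> {0<..<len e} \<Longrightarrow> h e x = - g e x" and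
    cont: "\<forall>v \<in> V. \<forall>e \<in> incident_edges E v. \<forall>e' \<in> incident_edges E v.
        (if fst e = v then f e 0 else f e (len e)) = (if fst e' = v then f e' 0 else f e' (len e'))" and
    kir: "\<forall>v \<in> V. (\<Sum>e \<in> incident_edges E v.
        (if fst e = v then b e else - (b e + (LINT s:{0..len e}|lborel. g e s)))) = 0"
    unfolding kirchhoff_core_def by blast
  define f1 where "f1 e x = b e + (LINT s:{0..x}|lborel. g e s)" for e x
  have gi: "set_integrable lborel {0..len e} (g e)" if "e \<in> E" for e
    by (rule sq_int_integrable[OF sq[OF that]])
  have 1: "ac_deriv (len e) (f1 e) (g e)" if "e \<in> E" for e
    unfolding f1_def[abs_def] by (rule ac_deriv_indefinite[OF gi[OF that]])
  have 2: "ac_deriv (len e) (f e) (f1 e)" if e: "e \<in> E" for e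
  proof (rule ac_derivI[where c = "a e"])
    show i: "set_integrable lborel {0..len e} (f1 e)"
      by (rule set_integrable_cont[OF ac_deriv_continuous[OF 1[OF e]]])
    fix x assume x: "0 \<le> x" "x \<le> len e"
    have "ac_deriv (len e) (\<lambda>x. 0 + (LINT s:{0..x}|lborel. g e s)) (g e)"
      by (rule ac_deriv_indefinite[OF gi[OF e]])
    then have "set_integrable lborel {0..len e} (\<lambda>x. (LINT s:{0..x}|lborel. g e s))"
      using set_integrable_cont[OF ac_deriv_continuous] by fastforce
    then show "f e x = a e + (LINT t:{0..x}|lborel. f1 e t)"
      unfolding f1_def using x rep[OF e, of x]
      by (subst LINT_affine) (auto intro: set_integrable_sub0)
  qed
  have "vder len f1 e v = (if fst e = v then b e else - (b e + (LINT s:{0..len e}|lborel. g e s)))" for e v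
    by (simp add: vder_def f1_def)
  with kir have "\<forall>v \<in> V. (\<Sum>e \<in> incident_edges E v. vder len f1 e v) = 0" by presburger
  then have "core_data V E len f h f1 g"
    unfolding core_data_def vval_def using fin sq 1 2 hg cont by blast
  then show "\<exists>f1 g. core_data V E len f h f1 g" by blast
next
  note gr = graphD[OF G]
  assume "\<exists>f1 g. core_data V E len f h f1 g"
  then obtain f1 g where d: "core_data V E len f h f1 g" by blast
  then have a: "ac_deriv (len e) (f e) (f1 e)" "ac_deriv (len e) (f1 e) (g e)" if "e \<in> E" for e
    using core_dataD(3,4)[OF d that] by simp_all
  have rep: "f e x = f e 0 + f1 e 0 * of_real x + (LINT t:{0..x}|lborel. (LINT s:{0..t}|lborel. g e s))"
    if e: "e \<in> E" and x: "x \<in> {0..len e}" for e x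
  proof -
    have "(LINT t:{0..x}|lborel. f1 e t) = (LINT t:{0..x}|lborel. f1 e 0 + (LINT s:{0..t}|lborel. g e s))"
      using x by (intro set_lebesgue_integral_cong) (auto intro!: ac_deriv_eq[OF a(2)[OF e]])
    moreover have "ac_deriv (len e) (\<lambda>x. 0 + (LINT s:{0..x}|lborel. g e s)) (g e)"
      by (rule ac_deriv_indefinite[OF ac_deriv_integrable[OF a(2)[OF e]]])
    then have "set_integrable lborel {0..len e} (\<lambda>x. (LINT s:{0..x}|lborel. g e s))"
      using set_integrable_cont[OF ac_deriv_continuous] by fastforce
    ultimately have "(LINT t:{0..x}|lborel. f1 e t) = f1 e 0 * of_real x + (LINT t:{0..x}|lborel. (LINT s:{0..t}|lborel. g e s))"
      using x by (subst (asm) LINT_affine) (auto intro: set_integrable_sub0)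
    then show ?thesis using ac_deriv_eq[OF a(1)[OF e] x] by simp
  qed
  have der: "vder len f1 e v = (if fst e = v then f1 e 0 else - (f1 e 0 + (LINT s:{0..len e}|lborel. g e s)))" if "e \<in> E" for e v
    using ac_deriv_eq[OF a(2)[OF that], of "len e"] gr(9)[OF that] by (simp add: vder_def)
  have kir: "(\<Sum>e \<in> incident_edges E v.
        (if fst e = v then f1 e 0 else - (f1 e 0 + (LINT s:{0..len e}|lborel. g e s)))) = 0" if "v \<in> V" for v
  proof -
    have "(\<Sum>e \<in> incident_edges E v. vder len f1 e v) = 0" by (rule core_dataD(7)[OF d that])
    moreover have "(\<Sum>e \<in> incident_edges E v. vder len f1 e v) = (\<Sum>e \<in> incident_edges E v.
        (if fst e = v then f1 e 0 else - (f1 e 0 + (LINT s:{0..len e}|lborel. g e s))))"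
      by (intro sum.cong refl der) (simp add: incident_edges_iff)
    ultimately show ?thesis by simp
  qed
  have "finite {e \<in> E. \<exists>x \<in> {0..len e}. f e x \<noteq> 0}" by (rule core_dataD(1)[OF d])
  moreover have "\<forall>e \<in> E. sq_int (len e) (g e) \<and>
        (\<forall>x \<in> {0..len e}. f e x = f e 0 + f1 e 0 * of_real x +
             (LINT t:{0..x}|lborel. (LINT s:{0..t}|lborel. g e s))) \<and>
        (\<forall>x \<in> {0<..<len e}. h e x = - g e x)"
    using rep core_dataD(2,5)[OF d] by blast
  moreover have "\<forall>v \<in> V. \<forall>e \<in> incident_edges E v. \<forall>e' \<in> incident_edges E v.
        (if fst e = v then f e 0 else f e (len e)) = (if fst e' = v then f e' 0 else f e' (len e'))"
    using core_dataD(6)[OF d] unfolding vval_def by blast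
  ultimately show "(f, h) \<in> kirchhoff_core V E len"
    unfolding kirchhoff_core_def using kir
    by (intro CollectI case_prodI exI[of _ "\<lambda>e. f e 0"] exI[of _ "\<lambda>e. f1 e 0"] exI[of _ g]) blast
qed

lemma core_data_comb:
  assumes d: "core_data V E len f h f1 g" and d': "core_data V E len f' h' f1' g'"
  shows "core_data V E len (\<lambda>e x. f e x + c * f' e x) (\<lambda>e x. h e x + c * h' e x)
    (\<lambda>e x. f1 e x + c * f1' e x) (\<lambda>e x. g e x + c * g' e x)"
proof -
  have 1: "vval len (\<lambda>e x. f e x + c * f' e x) e v = vval len f e v + c * vval len f' e v"
    and 2: "vder len (\<lambda>e x. f1 e x + c * f1' e x) e v = vder len f1 e v + c * vder len f1' e v" for e v
    by (auto simp: vval_def vder_def algebra_simps)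
  have "{e \<in> E. \<exists>x \<in> {0..len e}. f e x + c * f' e x \<noteq> 0}
    \<subseteq> {e \<in> E. \<exists>x \<in> {0..len e}. f e x \<noteq> 0} \<union> {e \<in> E. \<exists>x \<in> {0..len e}. f' e x \<noteq> 0}" by auto
  then have fin: "finite {e \<in> E. \<exists>x \<in> {0..len e}. f e x + c * f' e x \<noteq> 0}"
    by (rule finite_subset) (use core_dataD(1)[OF d] core_dataD(1)[OF d'] in simp)
  have edges: "sq_int (len e) (\<lambda>x. g e x + c * g' e x)"
    "ac_deriv (len e) (\<lambda>x. f e x + c * f' e x) (\<lambda>x. f1 e x + c * f1' e x)"
    "ac_deriv (len e) (\<lambda>x. f1 e x + c * f1' e x) (\<lambda>x. g e x + c * g' e x)" if "e \<in> E" for e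
    using core_dataD(2-4)[OF d that] core_dataD(2-4)[OF d' that]
    by (auto intro!: sq_int_add sq_int_cmult ac_deriv_add ac_deriv_cmult)
  have "(\<Sum>e \<in> incident_edges E v. vder len f1 e v + c * vder len f1' e v) = 0" if "v \<in> V" for v
    using core_dataD(7)[OF d that] core_dataD(7)[OF d' that] by (simp add: sum.distrib flip: sum_distrib_left)
  moreover have "vval len f e v + c * vval len f' e v = vval len f e' v + c * vval len f' e' v"
    if "v \<in> V" "e \<in> incident_edges E v" "e' \<in> incident_edges E v" for v e e'
    using core_dataD(6)[OF d that] core_dataD(6)[OF d' that] by simp
  ultimately show ?thesis
    unfolding core_data_def 1 2 using fin edges core_dataD(5)[OF d] core_dataD(5)[OF d']
    by (intro conjI ballI) (blast | simp)+
qed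

lemma kirchhoff_core_comb:
  assumes "metric_graph V E len" "(f, h) \<in> kirchhoff_core V E len" "(f', h') \<in> kirchhoff_core V E len"
  shows "(\<lambda>e x. f e x + c * f' e x, \<lambda>e x. h e x + c * h' e x) \<in> kirchhoff_core V E len"
proof -
  obtain f1 g f1' g' where "core_data V E len f h f1 g" "core_data V E len f' h' f1' g'"
    using assms(2,3) unfolding kirchhoff_core_iff[OF assms(1)] by blast
  from core_data_comb[OF this] show ?thesis
    unfolding kirchhoff_core_iff[OF assms(1)] by blast
qed

section \<open>Square integrability and Green's formula on the core\<close>

lemma sq_int_cong: "(\<And>x. x \<in> {0<..<l} \<Longrightarrow> f x = g x) \<Longrightarrow> sq_int l f \<longleftrightarrow> sq_int l g"
proof -
  assume "\<And>x. x \<in> {0<..<l} \<Longrightarrow> f x = g x"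
  then have "cut l f = cut l g" by (auto simp: cut_def fun_eq_iff indicator_def)
  then show ?thesis by (simp add: sq_int_iff)
qed

lemma L2G_sq_int: "L2G E len f \<Longrightarrow> e \<in> E \<Longrightarrow> sq_int (len e) (f e)"
  by (simp add: L2G_def sq_int_def)

lemma L2G_finite_support:
  assumes s: "\<And>e. e \<in> E \<Longrightarrow> sq_int (len e) (f e)" and F: "finite F" "F \<subseteq> E"
    and z: "\<And>e. e \<in> E - F \<Longrightarrow> AE x in lborel. x \<in> {0<..<len e} \<longrightarrow> f e x = 0"
  shows "L2G E len f"
proof -
  have "edge_int len e (\<lambda>x. (cmod (f e x))\<^sup>2) = 0" if "e \<in> E - F" for e
    unfolding edge_int_def set_lebesgue_integral_def
    by (rule integral_eq_zero_AE) (use z[OF that] in \<open>auto elim!: eventually_mono simp: indicator_def\<close>)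
  then have "(\<lambda>e. edge_int len e (\<lambda>x. (cmod (f e x))\<^sup>2)) summable_on E
      \<longleftrightarrow> (\<lambda>e. edge_int len e (\<lambda>x. (cmod (f e x))\<^sup>2)) summable_on F"
    using F(2) by (intro summable_on_cong_neutral) auto
  then show ?thesis using s F(1) by (auto simp: L2G_def sq_int_def)
qed

lemma L2inner_finite_support:
  assumes F: "finite F" "F \<subseteq> E"
    and z: "\<And>e x. e \<in> E - F \<Longrightarrow> x \<in> {0<..<len e} \<Longrightarrow> f e x * cnj (u e x) = 0"
  shows "L2inner E len f u = (\<Sum>e\<in>F. LINT x:{0..len e}|lborel. f e x * cnj (u e x))"
proof -
  have "edge_int len e (\<lambda>x. f e x * cnj (u e x)) = 0" if "e \<in> E - F" for e
    unfolding edge_int_def set_lebesgue_integral_def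
    by (rule integral_eq_zero_AE) (use z[OF that] in \<open>auto simp: indicator_def\<close>)
  then have "L2inner E len f u = (\<Sum>\<^sub>\<infinity>e\<in>F. edge_int len e (\<lambda>x. f e x * cnj (u e x)))"
    unfolding L2inner_def using F(2) by (intro infsum_cong_neutral) auto
  then show ?thesis using F(1) by (simp add: edge_int_def LINT_Icc_Ioo)
qed

lemma core_data_L2G:
  assumes G: "metric_graph V E len" and d: "core_data V E len f h f1 g"
  shows "L2G E len f" "L2G E len h"
proof -
  define F where "F = {e \<in> E. \<exists>x \<in> {0..len e}. f e x \<noteq> 0}"
  have F: "finite F" "F \<subseteq> E" using core_dataD(1)[OF d] by (auto simp: F_def)
  have a: "sq_int (len e) (g e)" "ac_deriv (len e) (f e) (f1 e)" "ac_deriv (len e) (f1 e) (g e)"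
    "\<And>x. x \<in> {0<..<len e} \<Longrightarrow> h e x = (-1) * g e x" if "e \<in> E" for e
    using core_dataD(2-5)[OF d that] by simp_all
  show "L2G E len f"
  proof (rule L2G_finite_support[OF _ F])
    show "sq_int (len e) (f e)" if "e \<in> E" for e
      by (rule sq_int_cont[OF ac_deriv_continuous[OF a(2)[OF that]]])
  qed (auto simp: F_def)
  show "L2G E len h"
  proof (rule L2G_finite_support[OF _ F])
    show "sq_int (len e) (h e)" if "e \<in> E" for e
      by (rule sq_int_cong[THEN iffD2, OF a(4)[OF that] sq_int_cmult[OF a(1)[OF that]]])
    fix e assume e: "e \<in> E - F"
    then have eE: "e \<in> E" by simp
    have l: "0 < len e" by (rule graphD(9)[OF G eE])
    \<comment> \<open>The support condition concerns \<open>f\<close> alone. On an edge where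
      \<open>f\<close> vanishes, \<open>f1\<close> vanishes as a continuous derivative of zero, and
      \<open>g\<close>, hence \<open>h\<close>, vanishes almost everywhere.\<close>
    have f0: "f e x = 0" if "0 \<le> x" "x \<le> len e" for x using e that by (auto simp: F_def)
    have f10: "f1 e x = 0" if "0 \<le> x" "x \<le> len e" for x
      by (rule ac_deriv_deriv_unique[OF l a(2)[OF eE] ac_deriv_const[of _ 0] f0 ac_deriv_continuous[OF a(3)[OF eE]] continuous_on_const that])
    have "AE x in lborel. x \<in> {0..len e} \<longrightarrow> g e x = 0"
      by (rule ac_deriv_zero_imp_AE_zero[OF a(3)[OF eE] f10])
    then show "AE x in lborel. x \<in> {0<..<len e} \<longrightarrow> h e x = 0"
      by eventually_elim (use a(4)[OF eE] in auto)
  qed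
qed

lemma kirchhoff_core_L2G:
  assumes "metric_graph V E len" "(f, h) \<in> kirchhoff_core V E len"
  shows "L2G E len f" "L2G E len h"
  using assms core_data_L2G kirchhoff_core_iff[OF assms(1)] by metis+

text \<open>After integration by parts on each edge, the boundary terms regrouped by vertices are
  the common vertex value of \<open>u\<close> times the Kirchhoff sum of \<open>f1\<close>, hence
  zero. Since \<open>K\<close> contains both ends of every edge in the support of \<open>u\<close>,
  all these edges are counted and the boundary terms at vertices outside \<open>K\<close>
  vanish.\<close>

lemma core_form:
  assumes G: "metric_graph V E len" and d: "core_data V E len f h f1 g" and d': "core_data V E len u w u1 k"
    and K: "finite K" "K \<subseteq> V" and supp: "\<And>e x. e \<in> E \<Longrightarrow> x \<in> {0..len e} \<Longrightarrow> u e x \<noteq> 0 \<Longrightarrow> fst e \<in> K \<and> snd e \<in> K"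
  shows "L2inner E len h u = (\<Sum>e\<in>(\<Union>v\<in>K. incident_edges E v). LINT x:{0..len e}|lborel. f1 e x * cnj (u1 e x))"
proof -
  note gr = graphD[OF G]
  define F where "F = (\<Union>v\<in>K. incident_edges E v)"
  have F: "finite F" "F \<subseteq> E" using K gr by (auto simp: F_def incident_edges_iff)
  have a: "sq_int (len e) (g e)" "ac_deriv (len e) (f1 e) (g e)" "ac_deriv (len e) (u e) (u1 e)" "ac_deriv (len e) (u1 e) (k e)"
    "\<And>x. x \<in> {0<..<len e} \<Longrightarrow> h e x = - g e x" if "e \<in> E" for e
    using core_dataD(2-5)[OF d that] core_dataD(2-5)[OF d' that] by simp_all
  have "L2inner E len h u = (\<Sum>e\<in>F. LINT x:{0..len e}|lborel. h e x * cnj (u e x))"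
  proof (rule L2inner_finite_support[OF F])
    fix e x assume e: "e \<in> E - F" "x \<in> {0<..<len e}"
    have "u e x = 0"
    proof (rule ccontr)
      assume "u e x \<noteq> 0"
      then have "fst e \<in> K" using supp[of e x] e by auto
      then show False using e by (auto simp: F_def incident_edges_iff)
    qed
    then show "h e x * cnj (u e x) = 0" by simp
  qed
  also have "\<dots> = (\<Sum>e\<in>F. (LINT x:{0..len e}|lborel. f1 e x * cnj (u1 e x))
      - (f1 e (len e) * cnj (u e (len e)) - f1 e 0 * cnj (u e 0)))"
  proof (rule sum.cong[OF refl])
    fix e assume "e \<in> F"
    then have e: "e \<in> E" using F by auto
    have l: "0 < len e" by (rule gr(9)[OF e])
    have i1: "set_integrable lborel {0..len e} (\<lambda>x. g e x * cnj (u e x))"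
      by (intro set_integrable_mult_cnj a(1)[OF e] sq_int_cont ac_deriv_continuous[OF a(3)[OF e]])
    have i2: "set_integrable lborel {0..len e} (\<lambda>x. f1 e x * cnj (u1 e x))"
      by (intro set_integrable_mult_cnj sq_int_cont ac_deriv_continuous[OF a(2)[OF e]] ac_deriv_continuous[OF a(4)[OF e]])
    have "ac_deriv (len e) (\<lambda>x. f1 e x * cnj (u e x)) (\<lambda>x. g e x * cnj (u e x) + f1 e x * cnj (u1 e x))"
      by (intro ac_deriv_mult ac_deriv_cnj a e)
    from ac_deriv_integral[OF this] l
    have "(LINT x:{0..len e}|lborel. g e x * cnj (u e x)) + (LINT x:{0..len e}|lborel. f1 e x * cnj (u1 e x))
      = f1 e (len e) * cnj (u e (len e)) - f1 e 0 * cnj (u e 0)"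
      by (simp add: set_integral_add(2)[OF i1 i2])
    moreover have "(LINT x:{0..len e}|lborel. h e x * cnj (u e x)) = (LINT x:{0..len e}|lborel. - (g e x * cnj (u e x)))"
      unfolding LINT_Icc_Ioo by (intro set_lebesgue_integral_cong) (use a(5)[OF e] in auto)
    then have "(LINT x:{0..len e}|lborel. h e x * cnj (u e x)) = - (LINT x:{0..len e}|lborel. g e x * cnj (u e x))"
      by (simp add: set_integral_uminus[OF i1])
    ultimately show "(LINT x:{0..len e}|lborel. h e x * cnj (u e x)) = (LINT x:{0..len e}|lborel. f1 e x * cnj (u1 e x))
      - (f1 e (len e) * cnj (u e (len e)) - f1 e 0 * cnj (u e 0))" by (simp add: algebra_simps)
  qed
  also have "\<dots> = (\<Sum>e\<in>F. LINT x:{0..len e}|lborel. f1 e x * cnj (u1 e x))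
      - (\<Sum>e\<in>F. f1 e (len e) * cnj (u e (len e)) - f1 e 0 * cnj (u e 0))"
    by (rule sum_subtractf)
  also have "(\<Sum>e\<in>F. f1 e (len e) * cnj (u e (len e)) - f1 e 0 * cnj (u e 0)) = 0"
  proof -
    define H where "H v e = cnj (vval len u e v) * vder len f1 e v" for v e
    have "(\<Sum>v\<in>K. \<Sum>e\<in>incident_edges E v. H v e) = 0"
    proof (rule sum.neutral, rule ballI)
      fix v assume "v \<in> K"
      then have v: "v \<in> V" using K by auto
      then obtain e0 where e0: "e0 \<in> incident_edges E v" using gr(4)[OF v] by blast
      have "(\<Sum>e\<in>incident_edges E v. H v e) = (\<Sum>e\<in>incident_edges E v. cnj (vval len u e0 v) * vder len f1 e v)"
        unfolding H_def
      proof (rule sum.cong[OF refl])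
        fix e assume "e \<in> incident_edges E v"
        then have "vval len u e v = vval len u e0 v" using core_dataD(6)[OF d' v _ e0] by blast
        then show "cnj (vval len u e v) * vder len f1 e v = cnj (vval len u e0 v) * vder len f1 e v" by simp
      qed
      also have "\<dots> = 0" using core_dataD(7)[OF d v] by (simp flip: sum_distrib_left)
      finally show "(\<Sum>e\<in>incident_edges E v. H v e) = 0" .
    qed
    moreover have "(if fst e \<in> K then H (fst e) e else 0) + (if snd e \<in> K then H (snd e) e else 0)
        = - (f1 e (len e) * cnj (u e (len e)) - f1 e 0 * cnj (u e 0))" if "e \<in> F" for e
    proof -
      have e: "e \<in> E" using that F by auto
      have "u e 0 = 0" if "fst e \<notin> K" using supp[OF e, of 0] gr(9)[OF e] that by auto
      moreover have "u e (len e) = 0" if "snd e \<notin> K" using supp[OF e, of "len e"] gr(9)[OF e] that by auto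
      ultimately show ?thesis using gr(7)[OF e] by (auto simp: H_def vval_def vder_def)
    qed
    then have "(\<Sum>e\<in>F. (if fst e \<in> K then H (fst e) e else 0) + (if snd e \<in> K then H (snd e) e else 0))
        = - (\<Sum>e\<in>F. f1 e (len e) * cnj (u e (len e)) - f1 e 0 * cnj (u e 0))"
      by (simp add: sum_negf[symmetric])
    ultimately show ?thesis unfolding sum_vertices_incident[OF G K] F_def by simp
  qed
  finally show ?thesis by (simp add: F_def)
qed

lemma core_supports:
  assumes G: "metric_graph V E len" and d: "core_data V E len f h f1 g"
  obtains K where "finite K" "K \<subseteq> V" "\<And>e x. e \<in> E \<Longrightarrow> x \<in> {0..len e} \<Longrightarrow> f e x \<noteq> 0 \<Longrightarrow> fst e \<in> K \<and> snd e \<in> K"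
proof -
  let ?F = "{e \<in> E. \<exists>x \<in> {0..len e}. f e x \<noteq> 0}"
  have "finite ?F" by (rule core_dataD(1)[OF d])
  then have "finite (fst ` ?F \<union> snd ` ?F)" by simp
  moreover have "fst ` ?F \<union> snd ` ?F \<subseteq> V" using graphD(5,6)[OF G] by blast
  moreover have "fst e \<in> fst ` ?F \<union> snd ` ?F \<and> snd e \<in> fst ` ?F \<union> snd ` ?F"
    if "e \<in> E" "x \<in> {0..len e}" "f e x \<noteq> 0" for e x
  proof -
    have "e \<in> ?F" using that by blast
    then show ?thesis by blast
  qed
  ultimately show thesis by (rule that)
qed

lemma L2inner_cnj: "L2inner E len g f = cnj (L2inner E len f g)"
proof -
  have "edge_int len e (\<lambda>x. g e x * cnj (f e x)) = cnj (edge_int len e (\<lambda>x. f e x * cnj (g e x)))" for e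
    unfolding edge_int_def set_lebesgue_integral_def Bochner_Integration.integral_cnj[symmetric]
    by (intro Bochner_Integration.integral_cong) (auto simp: mult.commute)
  then show ?thesis by (simp add: L2inner_def infsum_cnj)
qed

text \<open>Both sides reduce to the same Dirichlet form; taking the union of the two vertex sets
  makes the two sums run over the same edges.\<close>

lemma core_symmetric:
  assumes G: "metric_graph V E len" and "(f, h) \<in> kirchhoff_core V E len" "(u, w) \<in> kirchhoff_core V E len"
  shows "L2inner E len h u = L2inner E len f w"
proof -
  obtain f1 g u1 k where d: "core_data V E len f h f1 g" and d': "core_data V E len u w u1 k"
    using assms kirchhoff_core_iff[OF G] by meson
  obtain K1 where K1: "finite K1" "K1 \<subseteq> V" "\<And>e x. e \<in> E \<Longrightarrow> x \<in> {0..len e} \<Longrightarrow> f e x \<noteq> 0 \<Longrightarrow> fst e \<in> K1 \<and> snd e \<in> K1"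
    using core_supports[OF G d] by blast
  obtain K2 where K2: "finite K2" "K2 \<subseteq> V" "\<And>e x. e \<in> E \<Longrightarrow> x \<in> {0..len e} \<Longrightarrow> u e x \<noteq> 0 \<Longrightarrow> fst e \<in> K2 \<and> snd e \<in> K2"
    using core_supports[OF G d'] by blast
  have K: "finite (K1 \<union> K2)" "K1 \<union> K2 \<subseteq> V" using K1 K2 by auto
  have A: "L2inner E len h u = (\<Sum>e\<in>(\<Union>v\<in>K1 \<union> K2. incident_edges E v). LINT x:{0..len e}|lborel. f1 e x * cnj (u1 e x))"
    by (rule core_form[OF G d d' K]) (use K2(3) in blast)
  have B: "L2inner E len w f = (\<Sum>e\<in>(\<Union>v\<in>K1 \<union> K2. incident_edges E v). LINT x:{0..len e}|lborel. u1 e x * cnj (f1 e x))"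
    by (rule core_form[OF G d' d K]) (use K1(3) in blast)
  have C: "(LINT x:{0..len e}|lborel. f1 e x * cnj (u1 e x)) = cnj (LINT x:{0..len e}|lborel. u1 e x * cnj (f1 e x))" for e
    unfolding set_lebesgue_integral_def Bochner_Integration.integral_cnj[symmetric]
    by (intro Bochner_Integration.integral_cong) (auto simp: mult.commute)
  have "L2inner E len h u = cnj (L2inner E len w f)" unfolding A B C by simp
  also have "\<dots> = L2inner E len f w" by (rule L2inner_cnj[symmetric])
  finally show ?thesis .
qed

lemma core_nonneg:
  assumes G: "metric_graph V E len" and "(f, h) \<in> kirchhoff_core V E len"
  shows "0 \<le> Re (L2inner E len h f)"
proof -
  obtain f1 g where d: "core_data V E len f h f1 g"
    using assms kirchhoff_core_iff[OF G] by meson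
  obtain K where K: "finite K" "K \<subseteq> V" "\<And>e x. e \<in> E \<Longrightarrow> x \<in> {0..len e} \<Longrightarrow> f e x \<noteq> 0 \<Longrightarrow> fst e \<in> K \<and> snd e \<in> K"
    using core_supports[OF G d] by blast
  have "0 \<le> Re (LINT x:{0..len e}|lborel. f1 e x * cnj (f1 e x))" for e
    unfolding LINT_Icc_Ioo LINT_mult_cnj l2_prod_self by simp
  moreover have "L2inner E len h f = (\<Sum>e\<in>(\<Union>v\<in>K. incident_edges E v). LINT x:{0..len e}|lborel. f1 e x * cnj (f1 e x))"
    by (rule core_form[OF G d d K(1,2)]) (use K(3) in blast)
  ultimately show ?thesis by (simp add: sum_nonneg)
qed

section \<open>Test functions\<close>

text \<open>With vanishing Cauchy data at both ends, extension by zero to the other edges satisfies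
  every vertex condition trivially.\<close>

lemma bump_in_core:
  assumes G: "metric_graph V E len" and e0: "e0 \<in> E"
    and g: "sq_int (len e0) g" "ac_deriv (len e0) \<phi> \<phi>1" "ac_deriv (len e0) \<phi>1 g"
    and z: "\<phi> 0 = 0" "\<phi>1 0 = 0" "\<phi> (len e0) = 0" "\<phi>1 (len e0) = 0"
  shows "((\<lambda>e x. if e = e0 then \<phi> x else 0), (\<lambda>e x. if e = e0 then - g x else 0)) \<in> kirchhoff_core V E len"
proof -
  let ?f = "\<lambda>e x. if e = e0 then \<phi> x else 0" and ?f1 = "\<lambda>e x. if e = e0 then \<phi>1 x else 0"
    and ?g = "\<lambda>e x. if e = e0 then g x else 0" and ?h = "\<lambda>e x. if e = e0 then - g x else 0"
  have z0: "sq_int l (\<lambda>_. 0)" for l by (intro sq_int_cont continuous_intros)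
  have "{e \<in> E. \<exists>x \<in> {0..len e}. ?f e x \<noteq> 0} \<subseteq> {e0}" by auto
  then have "finite {e \<in> E. \<exists>x \<in> {0..len e}. ?f e x \<noteq> 0}" by (rule finite_subset) simp
  moreover have "sq_int (len e) (?g e) \<and> ac_deriv (len e) (?f e) (?f1 e) \<and> ac_deriv (len e) (?f1 e) (?g e) \<and>
      (\<forall>x \<in> {0<..<len e}. ?h e x = - ?g e x)" for e
    using g z0 ac_deriv_const[of _ 0] by (cases "e = e0") auto
  moreover have "vval len ?f e v = 0" "vder len ?f1 e v = 0" for e v
    using z by (auto simp: vval_def vder_def)
  ultimately have "core_data V E len ?f ?h ?f1 ?g"
    unfolding core_data_def by (intro conjI ballI) (blast | simp)+
  then show ?thesis unfolding kirchhoff_core_iff[OF G] by blast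
qed

lemma hermite_interpolation:
  fixes a b a' b' :: complex
  assumes l: "0 < l"
  shows "\<exists>\<phi> \<phi>1 g. sq_int l g \<and> ac_deriv l \<phi> \<phi>1 \<and> ac_deriv l \<phi>1 g \<and> \<phi> 0 = a \<and> \<phi>1 0 = b \<and> \<phi> l = a' \<and> \<phi>1 l = b'"
proof -
  let ?X = "complex_of_real"
  define L where "L = complex_of_real l"
  have L: "L \<noteq> 0" using l by (simp add: L_def)
  \<comment> \<open>\<open>c\<close> and \<open>d\<close> solve the two linear equations that
    prescribe value and slope of the cubic at \<open>l\<close>.\<close>
  define c where "c = (3 * (a' - a) - L * (2 * b + b')) / L\<^sup>2"
  define d where "d = (2 * (a - a') + L * (b + b')) / L^3"
  \<comment> \<open>\<open>\<phi>\<close> and \<open>\<phi>1\<close> keep the unsimplified shape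
    produced by the sum and product rules, so that the rules for \<open>ac_deriv\<close> match them
    literally.\<close>
  define \<phi> where "\<phi> x = a + (b * ?X x + (c * (?X x * ?X x) + d * (?X x * (?X x * ?X x))))" for x
  define \<phi>1 where "\<phi>1 x = 0 + (b * 1 + (c * (1 * ?X x + ?X x * 1) + d * (1 * (?X x * ?X x) + ?X x * (1 * ?X x + ?X x * 1))))" for x
  define g where "g x = 2 * c + 6 * d * ?X x" for x
  have 1: "ac_deriv l \<phi> \<phi>1"
    unfolding \<phi>_def[abs_def] \<phi>1_def[abs_def]
    by (intro ac_deriv_add ac_deriv_const ac_deriv_cmult ac_deriv_mult ac_deriv_id)
  have gc: "continuous_on {0..l} g" unfolding g_def by (intro continuous_intros)
  have "ac_deriv l (\<lambda>x. b + (2 * c * ?X x + 3 * d * (?X x * ?X x))) (\<lambda>x. 0 + (2 * c * 1 + 3 * d * (1 * ?X x + ?X x * 1)))"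
    by (intro ac_deriv_add ac_deriv_const ac_deriv_cmult ac_deriv_mult ac_deriv_id)
  then have 2: "ac_deriv l \<phi>1 g"
    by (rule back_subst[of "\<lambda>p. ac_deriv l (fst p) (snd p)" "(_, _)" "(_, _)", simplified])
       (auto simp: \<phi>1_def g_def fun_eq_iff algebra_simps)
  have e: "\<phi> l = a + b * L + c * L\<^sup>2 + d * L^3" "\<phi>1 l = b + 2 * c * L + 3 * d * L\<^sup>2"
    by (simp_all add: \<phi>_def \<phi>1_def L_def power2_eq_square power3_eq_cube algebra_simps)
  have cd: "c * L\<^sup>2 = 3 * (a' - a) - L * (2 * b + b')" "d * L^3 = 2 * (a - a') + L * (b + b')"
    using L by (simp_all add: c_def d_def)
  have "\<phi> l = a'" unfolding e cd by (simp add: algebra_simps)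
  moreover have "L * \<phi>1 l = L * b'"
  proof -
    have "L * \<phi>1 l = L * b + 2 * (c * L\<^sup>2) + 3 * (d * L^3)"
      unfolding e by (simp add: power2_eq_square power3_eq_cube algebra_simps)
    then show ?thesis unfolding cd by (simp add: algebra_simps)
  qed
  then have "\<phi>1 l = b'" using L by simp
  moreover have "\<phi> 0 = a" "\<phi>1 0 = b" by (simp_all add: \<phi>_def \<phi>1_def)
  ultimately show ?thesis using 1 2 sq_int_cont[OF gc] by blast
qed

text \<open>A function on the star of \<open>v\<close> with free value \<open>A\<close> and free
  slopes \<open>D e\<close> at \<open>v\<close>, subject only to the Kirchhoff condition there; zero
  Cauchy data at the far ends settle the conditions at all other vertices. The sign of
  \<open>D e\<close> flips at a terminal end because vertex slopes are taken into the edge.\<close>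

lemma vertex_test_in_core:
  assumes G: "metric_graph V E len" and v: "v \<in> V" and D: "(\<Sum>e\<in>incident_edges E v. D e) = (0::complex)"
  obtains f h f1 g where "core_data V E len f h f1 g" "h = (\<lambda>e x. - g e x)"
    "\<And>e x. e \<notin> incident_edges E v \<Longrightarrow> f e x = 0" "\<And>e x. e \<notin> incident_edges E v \<Longrightarrow> g e x = 0"
    "\<And>e. e \<in> E \<Longrightarrow> f e 0 = (if fst e = v then A else 0)"
    "\<And>e. e \<in> E \<Longrightarrow> f e (len e) = (if snd e = v then A else 0)"
    "\<And>e. e \<in> E \<Longrightarrow> f1 e 0 = (if fst e = v then D e else 0)"
    "\<And>e. e \<in> E \<Longrightarrow> f1 e (len e) = (if snd e = v then - D e else 0)"
proof -
  note gr = graphD[OF G]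
  have z0: "sq_int l (\<lambda>_. 0)" for l by (intro sq_int_cont continuous_intros)
  define Q where "Q e p \<longleftrightarrow> (case p of (\<phi>, \<phi>1, g) \<Rightarrow> sq_int (len e) g \<and> ac_deriv (len e) \<phi> \<phi>1 \<and> ac_deriv (len e) \<phi>1 g
    \<and> \<phi> 0 = (if fst e = v then A else 0) \<and> \<phi>1 0 = (if fst e = v then D e else 0)
    \<and> \<phi> (len e) = (if snd e = v then A else 0) \<and> \<phi>1 (len e) = (if snd e = v then - D e else 0)
    \<and> (e \<notin> incident_edges E v \<longrightarrow> \<phi> = (\<lambda>_. 0) \<and> g = (\<lambda>_. 0)))" for e p
  have "\<exists>p. Q e p" if "e \<in> E" for e
  proof (cases "e \<in> incident_edges E v")
    case True
    then show ?thesis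
      using hermite_interpolation[OF gr(9)[OF that], of "if fst e = v then A else 0" "if fst e = v then D e else 0"
          "if snd e = v then A else 0" "if snd e = v then - D e else 0"]
      unfolding Q_def by auto
  next
    case False
    then have "Q e (\<lambda>_. 0, \<lambda>_. 0, \<lambda>_. 0)"
      unfolding Q_def using that z0 ac_deriv_const[of _ 0] by (auto simp: incident_edges_iff)
    then show ?thesis by blast
  qed
  then obtain p where p: "\<And>e. e \<in> E \<Longrightarrow> Q e (p e)" by metis
  define f where "f e = (if e \<in> E then fst (p e) else (\<lambda>_. 0))" for e
  define f1 where "f1 e = fst (snd (p e))" for e
  define g where "g e = (if e \<in> E then snd (snd (p e)) else (\<lambda>_. 0))" for e
  have q: "sq_int (len e) (g e)" "ac_deriv (len e) (f e) (f1 e)" "ac_deriv (len e) (f1 e) (g e)"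
    "f e 0 = (if fst e = v then A else 0)" "f1 e 0 = (if fst e = v then D e else 0)"
    "f e (len e) = (if snd e = v then A else 0)" "f1 e (len e) = (if snd e = v then - D e else 0)"
    "e \<notin> incident_edges E v \<Longrightarrow> f e = (\<lambda>_. 0) \<and> g e = (\<lambda>_. 0)" if "e \<in> E" for e
    using p[OF that] that unfolding Q_def f_def f1_def g_def by (auto simp: case_prod_beta)
  have out: "f e x = 0" "g e x = 0" if "e \<notin> incident_edges E v" for e x
    using q(8)[OF _ that] by (cases "e \<in> E", auto simp: f_def g_def)+
  have "{e \<in> E. \<exists>x \<in> {0..len e}. f e x \<noteq> 0} \<subseteq> incident_edges E v" using out(1) by blast
  then have "finite {e \<in> E. \<exists>x \<in> {0..len e}. f e x \<noteq> 0}" by (rule finite_subset[OF _ gr(3)[OF v]])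
  moreover have "vval len f e w = (if w = v then A else 0)" if "e \<in> incident_edges E w" for e w
    using that q(4,6)[of e] gr(7)[of e] by (auto simp: vval_def incident_edges_iff)
  moreover have "(\<Sum>e \<in> incident_edges E w. vder len f1 e w) = 0" if w: "w \<in> V" for w
  proof -
    have "vder len f1 e w = (if w = v then D e else 0)" if "e \<in> incident_edges E w" for e
      using that q(5,7)[of e] gr(7)[of e] by (auto simp: vder_def incident_edges_iff)
    then have "(\<Sum>e \<in> incident_edges E w. vder len f1 e w) = (\<Sum>e \<in> incident_edges E w. if w = v then D e else 0)"
      by (rule sum.cong[OF refl])
    then show ?thesis using D by (cases "w = v") auto
  qed
  ultimately have "core_data V E len f (\<lambda>e x. - g e x) f1 g"
    unfolding core_data_def using q(1-3) by simp
  then show thesis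
    by (rule that[OF _ refl out q(4) q(6) q(5) q(7)])
qed

text \<open>Lagrange's identity: since \<open>s'' = s\<close>, the function
  \<open>(\<phi> - g) * cnj s\<close> is the derivative of
  \<open>\<phi> * cnj s1 - \<phi>1 * cnj s\<close>, so only boundary terms survive.\<close>

lemma green_edge:
  assumes l: "0 < l" and \<phi>: "ac_deriv l \<phi> \<phi>1" "ac_deriv l \<phi>1 g" "sq_int l g" and s: "ac_deriv l s s1" "ac_deriv l s1 s"
    and z: "AE x in lborel. x \<in> {0<..<l} \<longrightarrow> z x = s x" and zs: "sq_int l z"
  shows "(LINT x:{0..l}|lborel. (\<phi> x - g x) * cnj (z x))
    = (\<phi> l * cnj (s1 l) - \<phi>1 l * cnj (s l)) - (\<phi> 0 * cnj (s1 0) - \<phi>1 0 * cnj (s 0))"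
proof -
  have A: "ac_deriv l (\<lambda>x. \<phi> x * cnj (s1 x) - \<phi>1 x * cnj (s x))
      (\<lambda>x. (\<phi>1 x * cnj (s1 x) + \<phi> x * cnj (s x)) - (g x * cnj (s x) + \<phi>1 x * cnj (s1 x)))"
    by (intro ac_deriv_diff ac_deriv_mult ac_deriv_cnj \<phi> s)
  have d: "sq_int l (\<lambda>x. \<phi> x - g x)"
    by (intro sq_int_diff \<phi> sq_int_cont ac_deriv_continuous[OF \<phi>(1)])
  have "(LINT x:{0<..<l}|lborel. (\<phi> x - g x) * cnj (z x)) = (LINT x:{0<..<l}|lborel. (\<phi> x - g x) * cnj (s x))"
    using set_integrable_mult_cnj[OF d zs, unfolded set_integrable_Icc_Ioo]
      set_integrable_mult_cnj[OF d sq_int_cont[OF ac_deriv_continuous[OF s(1)]], unfolded set_integrable_Icc_Ioo]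
    unfolding set_integrable_def set_lebesgue_integral_def
    by (intro integral_cong_AE borel_measurable_integrable)
       (use z in \<open>auto elim!: eventually_mono simp: indicator_def\<close>)
  also have "\<dots> = (LINT x:{0..l}|lborel. (\<phi>1 x * cnj (s1 x) + \<phi> x * cnj (s x)) - (g x * cnj (s x) + \<phi>1 x * cnj (s1 x)))"
    unfolding LINT_Icc_Ioo[symmetric] by (intro set_lebesgue_integral_cong) (auto simp: algebra_simps)
  finally show ?thesis using ac_deriv_integral[OF A] l by (simp add: LINT_Icc_Ioo)
qed

text \<open>Green's identity against the Hermite interpolants of \<open>vertex_test_in_core\<close>: varying \<open>D\<close> with \<open>A = 0\<close>
  gives continuity of \<open>s\<close> at \<open>v\<close>, and \<open>A = 1\<close>, \<open>D = 0\<close> gives the Kirchhoff condition.\<close>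

lemma deficiency_element_vertex_condition:
  assumes G: "metric_graph V E len" and z: "L2G E len z"
    and orth: "\<And>f h. (f, h) \<in> kirchhoff_core V E len \<Longrightarrow> L2inner E len (\<lambda>e x. f e x + h e x) z = 0"
    and s: "\<And>e. e \<in> E \<Longrightarrow> ac_deriv (len e) (s e) (s1 e) \<and> ac_deriv (len e) (s1 e) (s e)"
    and ae: "\<And>e. e \<in> E \<Longrightarrow> AE x in lborel. x \<in> {0<..<len e} \<longrightarrow> z e x = s e x"
    and v: "v \<in> V" and D: "(\<Sum>e\<in>incident_edges E v. D e) = 0"
  shows "(\<Sum>e\<in>incident_edges E v. D e * cnj (vval len s e v) - A * cnj (vder len s1 e v)) = 0"
proof -
  note gr = graphD[OF G]
  obtain f h f1 g where c: "core_data V E len f h f1 g" and h: "h = (\<lambda>e x. - g e x)" and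
    out: "\<And>e x. e \<notin> incident_edges E v \<Longrightarrow> f e x = 0" "\<And>e x. e \<notin> incident_edges E v \<Longrightarrow> g e x = 0" and
    d: "\<And>e. e \<in> E \<Longrightarrow> f e 0 = (if fst e = v then A else 0)"
    "\<And>e. e \<in> E \<Longrightarrow> f e (len e) = (if snd e = v then A else 0)"
    "\<And>e. e \<in> E \<Longrightarrow> f1 e 0 = (if fst e = v then D e else 0)"
    "\<And>e. e \<in> E \<Longrightarrow> f1 e (len e) = (if snd e = v then - D e else 0)"
    using vertex_test_in_core[OF G v D, of A] by blast
  have fin: "finite (incident_edges E v)" "incident_edges E v \<subseteq> E" using gr(3)[OF v] by (auto simp: incident_edges_iff)
  have "0 = L2inner E len (\<lambda>e x. f e x + h e x) z"
    using orth c unfolding kirchhoff_core_iff[OF G] by metis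
  also have "\<dots> = (\<Sum>e\<in>incident_edges E v. LINT x:{0..len e}|lborel. (f e x + h e x) * cnj (z e x))"
    by (rule L2inner_finite_support[OF fin]) (simp add: h out)
  also have "\<dots> = (\<Sum>e\<in>incident_edges E v. D e * cnj (vval len s e v) - A * cnj (vder len s1 e v))"
  proof (rule sum.cong[OF refl])
    fix e assume i: "e \<in> incident_edges E v"
    then have e: "e \<in> E" by (simp add: incident_edges_iff)
    have "(LINT x:{0..len e}|lborel. (f e x - g e x) * cnj (z e x))
      = (f e (len e) * cnj (s1 e (len e)) - f1 e (len e) * cnj (s e (len e))) - (f e 0 * cnj (s1 e 0) - f1 e 0 * cnj (s e 0))"
      using s[OF e] by (intro green_edge gr(9) core_dataD[OF c] ae L2G_sq_int[OF z] e) auto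
    then show "(LINT x:{0..len e}|lborel. (f e x + h e x) * cnj (z e x)) = D e * cnj (vval len s e v) - A * cnj (vder len s1 e v)"
      using i gr(7)[OF e] by (auto simp: h d e vval_def vder_def incident_edges_iff)
  qed
  finally show ?thesis by simp
qed

section \<open>Triviality of the deficiency space\<close>

lemma sinh_ge_self: "0 \<le> x \<Longrightarrow> x \<le> sinh (x::real)"
  using real_le_x_sinh[of x] by (simp add: sinh_field_def exp_minus)

lemma sinh_le_mult_cosh: assumes "0 \<le> x" shows "sinh x \<le> x * cosh (x::real)"
proof -
  have "(\<lambda>y. y * cosh y - sinh y) 0 \<le> (\<lambda>y. y * cosh y - sinh y) x"
  proof (rule DERIV_nonneg_imp_nondecreasing[OF assms])
    fix y :: real assume "0 \<le> y" "y \<le> x"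
    then show "\<exists>D. ((\<lambda>y. y * cosh y - sinh y) has_real_derivative D) (at y) \<and> 0 \<le> D"
      by (intro exI[of _ "y * sinh y"]) (auto intro!: derivative_eq_intros)
  qed
  then show ?thesis by simp
qed

lemma set_integrable_cont_real: "continuous_on {0..l} f \<Longrightarrow> set_integrable lborel {0..l} f"
  for f :: "real \<Rightarrow> real"
  using borel_integrable_compact[of "{0..l}" f] unfolding set_integrable_def
  by (simp add: indicator_scaleR_eq_if)

text \<open>The lower bounds come from \<open>cosh \<ge> 1\<close> and
  \<open>|sinh y| \<ge> |y|\<close>. The mixed integrand is odd about the midpoint, so the two
  components of a solution are orthogonal on the edge.\<close>

lemma cosh_sinh_moments:
  fixes l :: real
  assumes l: "0 < l"
  defines "C \<equiv> \<lambda>x. cosh (x - l/2)" and "S \<equiv> \<lambda>x. sinh (x - l/2)"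
  shows "l \<le> (LINT x:{0..l}|lborel. (C x)\<^sup>2)" "l^3/12 \<le> (LINT x:{0..l}|lborel. (S x)\<^sup>2)"
    "(LINT x:{0..l}|lborel. C x * S x) = 0"
proof -
  note int = set_integrable_cont_real
  have "complex_of_real (LINT x:{0..l}|lborel. 1) = of_real l"
    using ac_deriv_integral[OF ac_deriv_id, of l] l by (simp flip: set_integral_complex_of_real)
  then have "l = (LINT x:{0..l}|lborel. 1)" by (simp only: of_real_eq_iff)
  also have "\<dots> \<le> (LINT x:{0..l}|lborel. (C x)\<^sup>2)"
    unfolding C_def
    by (intro set_integral_mono int continuous_intros) (auto intro!: one_le_power cosh_real_ge_1)
  finally show "l \<le> (LINT x:{0..l}|lborel. (C x)\<^sup>2)" .
  have "complex_of_real (LINT x:{0..l}|lborel. (x - l/2)\<^sup>2) = of_real (l^3/12)"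
    using centered_moments(2)[OF l] by (simp only: set_integral_complex_of_real)
  then have "l^3/12 = (LINT x:{0..l}|lborel. (x - l/2)\<^sup>2)" by (simp only: of_real_eq_iff)
  also have "\<dots> \<le> (LINT x:{0..l}|lborel. (S x)\<^sup>2)"
  proof (unfold S_def, intro set_integral_mono int continuous_intros)
    fix x :: real
    have "\<bar>x - l/2\<bar> \<le> sinh \<bar>x - l/2\<bar>" by (intro sinh_ge_self) simp
    then have "\<bar>x - l/2\<bar> \<le> \<bar>sinh (x - l/2)\<bar>" by simp
    then show "(x - l/2)\<^sup>2 \<le> (sinh (x - l/2))\<^sup>2" by (simp only: abs_le_square_iff)
  qed
  finally show "l^3/12 \<le> (LINT x:{0..l}|lborel. (S x)\<^sup>2)" .
  have "ac_deriv l (\<lambda>x. complex_of_real ((S x)\<^sup>2 / 2)) (\<lambda>x. complex_of_real (C x * S x))"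
    unfolding C_def S_def
    by (rule ac_deriv_of_real) (auto intro!: derivative_eq_intros continuous_intros)
  from ac_deriv_integral[OF this] l have "complex_of_real (LINT x:{0..l}|lborel. C x * S x) = 0"
    unfolding set_integral_complex_of_real by (simp add: S_def)
  then show "(LINT x:{0..l}|lborel. C x * S x) = 0" by (simp only: of_real_eq_0_iff)
qed

lemma cmod_add_sq_diff_sq: "(cmod (a - b))\<^sup>2 + (cmod (a + b))\<^sup>2 = 2 * ((cmod a)\<^sup>2 + (cmod b)\<^sup>2)"
  unfolding cmod_power2 by (simp add: power2_eq_square algebra_simps)

text \<open>A trace inequality uniform over edges of length at most \<open>L\<close>. The factor
  \<open>l\<close> on the left turns into the vertex weight \<open>vm\<close> after summation. It
  also makes the odd component work on short edges: its squared end values are of order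
  \<open>l^2\<close> and its integral only of order \<open>l^3\<close>. The constant 6 is the ratio
  of \<open>2 * l * (l/2)^2 = l^3 / 2\<close> to \<open>l^3 / 12\<close>.\<close>

lemma edge_trace_bound:
  fixes p q :: complex
  assumes l: "0 < l" "l \<le> L"
  defines "s \<equiv> \<lambda>x. p * of_real (cosh (x - l/2)) + q * of_real (sinh (x - l/2))"
  shows "l * ((cmod (s 0))\<^sup>2 + (cmod (s l))\<^sup>2) \<le> 6 * (cosh (L/2))\<^sup>2 * Re (LINT x:{0..l}|lborel. s x * cnj (s x))"
proof -
  define C where "C x = cosh (x - l/2)" for x
  define S where "S x = sinh (x - l/2)" for x
  note m = cosh_sinh_moments[OF l(1), folded C_def S_def]
  note int = set_integrable_cont_real
  have cC: "continuous_on {0..l} C" and cS: "continuous_on {0..l} S"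
    unfolding C_def S_def by (intro continuous_intros)+
  let ?P = "(cmod p)\<^sup>2" and ?Q = "(cmod q)\<^sup>2" and ?T = "2 * Re (p * cnj q)"
  have pt: "s x * cnj (s x) = complex_of_real (?P * (C x)\<^sup>2 + ?Q * (S x)\<^sup>2 + ?T * (C x * S x))" for x
    unfolding complex_norm_square[symmetric] s_def C_def[symmetric] S_def[symmetric]
    by (simp only: of_real_eq_iff cmod_power2) (simp add: power2_eq_square algebra_simps)
  have "(LINT x:{0..l}|lborel. s x * cnj (s x))
      = complex_of_real (LINT x:{0..l}|lborel. ?P * (C x)\<^sup>2 + ?Q * (S x)\<^sup>2 + ?T * (C x * S x))"
    unfolding pt by (rule set_integral_complex_of_real)
  also have "(LINT x:{0..l}|lborel. ?P * (C x)\<^sup>2 + ?Q * (S x)\<^sup>2 + ?T * (C x * S x))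
      = (LINT x:{0..l}|lborel. ?P * (C x)\<^sup>2 + ?Q * (S x)\<^sup>2) + (LINT x:{0..l}|lborel. ?T * (C x * S x))"
    by (intro set_integral_add(2) int continuous_intros cC cS)
  also have "(LINT x:{0..l}|lborel. ?P * (C x)\<^sup>2 + ?Q * (S x)\<^sup>2)
      = (LINT x:{0..l}|lborel. ?P * (C x)\<^sup>2) + (LINT x:{0..l}|lborel. ?Q * (S x)\<^sup>2)"
    by (intro set_integral_add(2) int continuous_intros cC cS)
  finally have eq: "Re (LINT x:{0..l}|lborel. s x * cnj (s x))
      = ?P * (LINT x:{0..l}|lborel. (C x)\<^sup>2) + ?Q * (LINT x:{0..l}|lborel. (S x)\<^sup>2)"
    by (simp add: m(3))
  define K where "K = cosh (L/2)"
  define \<kappa> where "\<kappa> = cosh (l/2)"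
  define \<sigma> where "\<sigma> = sinh (l/2)"
  have k: "0 \<le> \<kappa>" "\<kappa> \<le> K" unfolding \<kappa>_def K_def using l by (simp_all add: cosh_real_nonneg_le_iff)
  have "0 \<le> \<sigma>" "\<sigma> \<le> l/2 * \<kappa>" unfolding \<sigma>_def \<kappa>_def using l sinh_le_mult_cosh[of "l/2"] by simp_all
  moreover have "l/2 * \<kappa> \<le> l/2 * K" using k l by (intro mult_left_mono) auto
  ultimately have sg: "\<sigma>\<^sup>2 \<le> (l/2 * K)\<^sup>2" by (intro power_mono) auto
  have k2: "\<kappa>\<^sup>2 \<le> K\<^sup>2" using k by (intro power_mono) auto
  have "s 0 = p * of_real \<kappa> - q * of_real \<sigma>" "s l = p * of_real \<kappa> + q * of_real \<sigma>"
    by (simp_all add: s_def \<kappa>_def \<sigma>_def)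
  then have "l * ((cmod (s 0))\<^sup>2 + (cmod (s l))\<^sup>2) = 2 * l * (?P * \<kappa>\<^sup>2 + ?Q * \<sigma>\<^sup>2)"
    by (simp add: cmod_add_sq_diff_sq norm_mult power_mult_distrib)
  also have "\<dots> \<le> 2 * l * (?P * K\<^sup>2 + ?Q * (l/2 * K)\<^sup>2)"
    using l k2 sg by (intro mult_left_mono add_mono) auto
  also have "\<dots> \<le> 6 * K\<^sup>2 * (?P * l + ?Q * (l^3/12))"
    using l k
    by (simp add: power2_eq_square power3_eq_cube algebra_simps)
  also have "\<dots> \<le> 6 * K\<^sup>2 * (?P * (LINT x:{0..l}|lborel. (C x)\<^sup>2) + ?Q * (LINT x:{0..l}|lborel. (S x)\<^sup>2))"
    using m by (intro mult_left_mono add_mono) auto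
  finally show ?thesis unfolding eq K_def .
qed

text \<open>Here \<open>\<sigma> = sinh(l/2)\<close> and \<open>\<kappa> = cosh(l/2)\<close>, so \<open>2\<sigma>\<kappa> = sinh l\<close>; the solution \<open>p cosh(x - l/2) + q sinh(x - l/2)\<close>
  has endpoint values \<open>p\<kappa> \<mp> q\<sigma>\<close>, and the right-hand sides are minus its derivatives into the edge.\<close>

lemma edge_vertex_identity:
  fixes p q :: complex and \<sigma> \<kappa> :: real
  assumes "0 < \<sigma>" "0 < \<kappa>" and h: "\<kappa>\<^sup>2 = 1 + \<sigma>\<^sup>2"
  shows "of_real (1 / (2 * \<sigma> * \<kappa>)) * ((p * \<kappa> - q * \<sigma>) - (p * \<kappa> + q * \<sigma>)) + of_real (\<sigma> / \<kappa>) * (p * \<kappa> - q * \<sigma>)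
    = p * \<sigma> - q * \<kappa>"
    and "of_real (1 / (2 * \<sigma> * \<kappa>)) * ((p * \<kappa> + q * \<sigma>) - (p * \<kappa> - q * \<sigma>)) + of_real (\<sigma> / \<kappa>) * (p * \<kappa> + q * \<sigma>)
    = p * \<sigma> + q * \<kappa>"
proof -
  define k where "k = complex_of_real \<kappa>"
  define g where "g = complex_of_real \<sigma>"
  have nz: "k \<noteq> 0" "g \<noteq> 0" using assms by (auto simp: k_def g_def)
  have h': "k * k = 1 + g * g"
    using arg_cong[OF h, of complex_of_real] by (simp add: k_def g_def power2_eq_square)
  have c: "of_real (1 / (2 * \<sigma> * \<kappa>)) = 1 / (2 * g * k)" "of_real (\<sigma> / \<kappa>) = g / k"
    by (simp_all add: k_def g_def)
  have qk: "q * (1 + g * g) / k = q * k" unfolding h'[symmetric] using nz by simp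
  have "1 / (2 * g * k) * ((p * k - q * g) - (p * k + q * g)) + g / k * (p * k - q * g) = p * g - q * (1 + g * g) / k"
    using nz by (simp add: field_simps)
  then show "of_real (1 / (2 * \<sigma> * \<kappa>)) * ((p * \<kappa> - q * \<sigma>) - (p * \<kappa> + q * \<sigma>)) + of_real (\<sigma> / \<kappa>) * (p * \<kappa> - q * \<sigma>)
    = p * \<sigma> - q * \<kappa>" unfolding c qk unfolding k_def g_def .
  have "1 / (2 * g * k) * ((p * k + q * g) - (p * k - q * g)) + g / k * (p * k + q * g) = p * g + q * (1 + g * g) / k"
    using nz by (simp add: field_simps)
  then show "of_real (1 / (2 * \<sigma> * \<kappa>)) * ((p * \<kappa> + q * \<sigma>) - (p * \<kappa> - q * \<sigma>)) + of_real (\<sigma> / \<kappa>) * (p * \<kappa> + q * \<sigma>)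
    = p * \<sigma> + q * \<kappa>" unfolding c qk unfolding k_def g_def .
qed

lemma deficiency_element_zero:
  assumes G: "metric_graph V E len" and \<rho>: "intrinsic V E len \<rho>"
    and Dg: "\<forall>v \<in> V. \<forall>r \<ge> 0. \<exists>C. \<forall>u \<in> dball V \<rho> r v. wDeg E len u \<le> C"
    and z: "L2G E len z"
    and orth: "\<And>f h. (f, h) \<in> kirchhoff_core V E len \<Longrightarrow> L2inner E len (\<lambda>e x. f e x + h e x) z = 0"
    and e: "e \<in> E"
  shows "AE x in lborel. x \<in> {0<..<len e} \<longrightarrow> z e x = 0"
proof -
  note gr = graphD[OF G]
  obtain L0 where L0: "\<And>e. e \<in> E \<Longrightarrow> len e \<le> L0" using G unfolding metric_graph_def by blast
  define L where "L = max L0 1"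
  have L: "\<And>e. e \<in> E \<Longrightarrow> len e \<le> L" "0 < L" using L0 by (auto simp: L_def intro: max.coboundedI1)
  define hyperbolic where "hyperbolic e p q \<longleftrightarrow> (AE x in lborel. x \<in> {0<..<len e} \<longrightarrow>
      z e x = p * of_real (cosh (x - len e/2)) + q * of_real (sinh (x - len e/2)))" for e p q
  have "\<exists>p q. hyperbolic e p q" if e: "e \<in> E" for e
    unfolding hyperbolic_def
  proof (rule edge_deficiency[OF gr(9)[OF e] L2G_sq_int[OF z e]])
    fix \<phi> \<phi>1 g assume a: "sq_int (len e) g" "ac_deriv (len e) \<phi> \<phi>1" "ac_deriv (len e) \<phi>1 g" "\<phi> 0 = 0" "\<phi>1 0 = 0" "\<phi> (len e) = 0" "\<phi>1 (len e) = 0"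
    have "0 = L2inner E len (\<lambda>e' x. (if e' = e then \<phi> x else 0) + (if e' = e then - g x else 0)) z"
      by (rule orth[OF bump_in_core[OF G e a], symmetric])
    also have "\<dots> = (\<Sum>e'\<in>{e}. LINT x:{0..len e'}|lborel. ((if e' = e then \<phi> x else 0) + (if e' = e then - g x else 0)) * cnj (z e' x))"
      by (rule L2inner_finite_support) (use e in auto)
    finally show "(LINT x:{0..len e}|lborel. (\<phi> x - g x) * cnj (z e x)) = 0" by simp
  qed
  then obtain p q where pq: "\<And>e. e \<in> E \<Longrightarrow> hyperbolic e (p e) (q e)" by metis
  define s where "s e x = p e * complex_of_real (cosh (x - len e/2)) + q e * complex_of_real (sinh (x - len e/2))" for e x
  define s1 where "s1 e x = p e * complex_of_real (sinh (x - len e/2)) + q e * complex_of_real (cosh (x - len e/2))" for e x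
  have ae: "AE x in lborel. x \<in> {0<..<len e} \<longrightarrow> z e x = s e x" if "e \<in> E" for e
    using pq[OF that] unfolding s_def hyperbolic_def .
  have ac: "ac_deriv (len e) (s e) (s1 e) \<and> ac_deriv (len e) (s1 e) (s e)" for e
    unfolding s_def[abs_def] s1_def[abs_def]
    by (intro conjI ac_deriv_add ac_deriv_cmult ac_deriv_of_real) (auto intro!: derivative_eq_intros continuous_intros)
  have vc: "(\<Sum>e\<in>incident_edges E v. D e * cnj (vval len s e v) - A * cnj (vder len s1 e v)) = 0"
    if "v \<in> V" "(\<Sum>e\<in>incident_edges E v. D e) = 0" for v D A
    by (rule deficiency_element_vertex_condition[OF G z _ _ _ that]) (erule orth, rule ac, erule ae)
  have cont: "vval len s e v = vval len s e' v" if v: "v \<in> V" and e: "e \<in> incident_edges E v" "e' \<in> incident_edges E v" for v e e'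
  proof (cases "e = e'")
    case False
    \<comment> \<open>Slopes \<open>1\<close> on \<open>e\<close> and \<open>-1\<close> on
      \<open>e'\<close> satisfy the Kirchhoff condition; with \<open>A = 0\<close> the identity
      compares the two values at \<open>v\<close>.\<close>
    define D where "D x = (if x = e then 1 else 0) - (if x = e' then 1 else 0 :: complex)" for x
    have D0: "(\<Sum>x\<in>incident_edges E v. D x) = 0"
      using e gr(3)[OF v] by (simp add: D_def sum_subtractf)
    have "(\<Sum>x\<in>incident_edges E v. D x * cnj (vval len s x v)) = 0"
      using vc[OF v D0, of 0] by simp
    moreover have "(\<Sum>x\<in>incident_edges E v. D x * cnj (vval len s x v))
      = (\<Sum>x\<in>incident_edges E v. (if x = e then cnj (vval len s x v) else 0) - (if x = e' then cnj (vval len s x v) else 0))"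
      by (intro sum.cong) (auto simp: D_def)
    ultimately have "cnj (vval len s e v) - cnj (vval len s e' v) = 0"
      using e gr(3)[OF v] by (simp add: sum_subtractf)
    then show ?thesis by simp
  qed auto
  have kir: "(\<Sum>e\<in>incident_edges E v. vder len s1 e v) = 0" if v: "v \<in> V" for v
  proof -
    have "(\<Sum>e\<in>incident_edges E v. 0 * cnj (vval len s e v) - 1 * cnj (vder len s1 e v)) = 0"
      by (rule vc[OF v]) simp
    then have "(\<Sum>e\<in>incident_edges E v. cnj (vder len s1 e v)) = 0" by (simp add: sum_negf)
    then show ?thesis by (simp only: cnj_sum[symmetric] complex_cnj_zero_iff)
  qed
  \<comment> \<open>By \<open>cont\<close> the value does not depend on the edge chosen at
    \<open>v\<close>.\<close>
  define f where "f v = vval len s (SOME e. e \<in> incident_edges E v) v" for v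
  have fv: "vval len s e v = f v" if "v \<in> V" "e \<in> incident_edges E v" for e v
    unfolding f_def by (rule cont[OF that]) (use that in \<open>auto intro: someI\<close>)
  define \<kappa> where "\<kappa> e = cosh (len e/2)" for e
  define \<sigma> where "\<sigma> e = sinh (len e/2)" for e
  \<comment> \<open>The Dirichlet-to-Neumann map of \<open>- z'' + z\<close> on an edge of length
    \<open>l\<close> has coupling \<open>1 / sinh l\<close> and potential \<open>tanh (l/2)\<close>;
    both are written with the half-length functions in which the end values are expressed.\<close>
  define b where "b e = 1 / (2 * \<sigma> e * \<kappa> e)" for e
  define \<tau> where "\<tau> e = \<sigma> e / \<kappa> e" for e
  \<comment> \<open>From \<open>sinh (l/2) \<ge> l/2\<close> and
    \<open>cosh (l/2) \<le> cosh (L/2)\<close>; the common length bound \<open>L\<close> makes the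
    constant the same for all edges.\<close>
  define c where "c = 1 / (2 * cosh (L/2))"
  have pos: "0 < \<sigma> e" "0 < \<kappa> e" "(\<kappa> e)\<^sup>2 = 1 + (\<sigma> e)\<^sup>2" "len e / 2 \<le> \<sigma> e" "1 \<le> \<kappa> e" "\<kappa> e \<le> cosh (L/2)" if "e \<in> E" for e
    using gr(9)[OF that] L(1)[OF that] sinh_ge_self[of "len e / 2"]
    by (auto simp: \<sigma>_def \<kappa>_def cosh_square_eq cosh_real_ge_1 cosh_real_nonneg_le_iff)
  have ends: "s e 0 = p e * \<kappa> e - q e * \<sigma> e" "s e (len e) = p e * \<kappa> e + q e * \<sigma> e"
    "s1 e 0 = q e * \<kappa> e - p e * \<sigma> e" "s1 e (len e) = p e * \<sigma> e + q e * \<kappa> e" for e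
    by (simp_all add: s_def s1_def \<kappa>_def \<sigma>_def)
  have fends: "f (fst e) = s e 0" "f (snd e) = s e (len e)" if "e \<in> E" for e
  proof -
    have i: "e \<in> incident_edges E (fst e)" "e \<in> incident_edges E (snd e)" using that by (auto simp: incident_edges_iff)
    show "f (fst e) = s e 0" "f (snd e) = s e (len e)"
      using fv[OF gr(5)[OF that] i(1)] fv[OF gr(6)[OF that] i(2)] gr(7)[OF that] by (simp_all add: vval_def)
  qed
  have f0: "f v = 0" if v: "v \<in> V" for v
  proof (rule discrete_uniqueness[OF G \<rho> Dg _ _ _ _ _ v])
    show "0 \<le> b e \<and> b e \<le> 1 / len e" if "e \<in> E" for e
    proof
      note P = pos[OF that] and l = gr(9)[OF that]
      show "0 \<le> b e" using P by (simp add: b_def)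
      have "len e / 2 * 1 \<le> \<sigma> e * \<kappa> e" using P l by (intro mult_mono) auto
      then show "b e \<le> 1 / len e" unfolding b_def using l P by (intro divide_left_mono) auto
    qed
    show "0 < c" by (simp add: c_def cosh_real_pos)
    show "c * len e \<le> \<tau> e" if "e \<in> E" for e
    proof -
      note P = pos[OF that] and l = gr(9)[OF that]
      have "c * len e = (len e / 2) / cosh (L/2)" by (simp add: c_def)
      also have "\<dots> \<le> \<sigma> e / \<kappa> e" using P l by (intro frac_le) auto
      finally show ?thesis by (simp add: \<tau>_def)
    qed
    show "(\<Sum>e\<in>incident_edges E w. of_real (b e) * (f w - f (other_end e w)) + of_real (\<tau> e) * f w) = 0" if w: "w \<in> V" for w
    proof -
      have "of_real (b e) * (f w - f (other_end e w)) + of_real (\<tau> e) * f w = - vder len s1 e w" if i: "e \<in> incident_edges E w" for e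
      proof -
        have eE: "e \<in> E" using i by (simp add: incident_edges_iff)
        note id = edge_vertex_identity[OF pos(1-3)[OF eE], of "p e" "q e", folded b_def \<tau>_def]
        show ?thesis
        proof (cases "fst e = w")
          case True
          then have "f w = s e 0" "f (other_end e w) = s e (len e)" using fends[OF eE] by (auto simp: other_end_def)
          then show ?thesis using True id(1) by (simp add: vder_def ends)
        next
          case False
          then have "snd e = w" using i by (auto simp: incident_edges_iff)
          then have "f w = s e (len e)" "f (other_end e w) = s e 0" using fends[OF eE] False by (auto simp: other_end_def)
          then show ?thesis using False id(2) by (simp add: vder_def ends)
        qed
      qed
      then have "(\<Sum>e\<in>incident_edges E w. of_real (b e) * (f w - f (other_end e w)) + of_real (\<tau> e) * f w)
        = (\<Sum>e\<in>incident_edges E w. - vder len s1 e w)" by (rule sum.cong[OF refl])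
      then show ?thesis using kir[OF w] by (simp add: sum_negf)
    qed
    define I where "I e = edge_int len e (\<lambda>x. (cmod (z e x))\<^sup>2)" for e
    define M where "M = 6 * (cosh (L/2))\<^sup>2"
    have I0: "0 \<le> I e" for e
      unfolding I_def edge_int_def set_lebesgue_integral_def by (intro integral_nonneg_AE) auto
    have Is: "I summable_on E" using z by (simp add: L2G_def I_def[abs_def])
    \<comment> \<open>The trace bound is applied to the continuous representative \<open>s\<close>,
      whose end values are the vertex values \<open>f\<close>; its integral is that of
      \<open>z\<close> because the two agree almost everywhere.\<close>
    have tr: "len e * ((cmod (f (fst e)))\<^sup>2 + (cmod (f (snd e)))\<^sup>2) \<le> M * I e" if eE: "e \<in> E" for e
    proof -
      have "(LINT x:{0..len e}|lborel. s e x * cnj (s e x)) = (LINT x:{0<..<len e}|lborel. z e x * cnj (z e x))"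
        unfolding LINT_Icc_Ioo
        using set_integrable_mult_cnj[OF L2G_sq_int[OF z eE] L2G_sq_int[OF z eE], unfolded set_integrable_Icc_Ioo]
          set_integrable_mult_cnj[OF sq_int_cont sq_int_cont, OF ac_deriv_continuous ac_deriv_continuous, OF conjunct1[OF ac] conjunct1[OF ac], unfolded set_integrable_Icc_Ioo]
        unfolding set_integrable_def set_lebesgue_integral_def
        by (intro integral_cong_AE borel_measurable_integrable)
           (use ae[OF eE] in \<open>auto elim!: eventually_mono simp: indicator_def\<close>)
      also have "\<dots> = of_real (l2_sq lborel (cut (len e) (z e)))"
        by (simp only: LINT_mult_cnj l2_prod_self)
      also have "l2_sq lborel (cut (len e) (z e)) = I e"
        by (simp only: l2_sq_def cmod_cut_sq I_def edge_int_def set_lebesgue_integral_def)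
      finally show ?thesis
        using edge_trace_bound[OF gr(9)[OF eE] L(1)[OF eE], of "p e" "q e", folded s_def] fends[OF eE]
        by (simp add: M_def)
    qed
    have M0: "0 \<le> M" by (simp add: M_def)
    show "(\<lambda>v. vm E len v * (cmod (f v))\<^sup>2) summable_on V"
    proof (rule nonneg_bdd_above_summable_on)
      show "0 \<le> vm E len v * (cmod (f v))\<^sup>2" if "v \<in> V" for v using vm_pos[OF G that] by simp
      show "bdd_above (sum (\<lambda>v. vm E len v * (cmod (f v))\<^sup>2) ` {F. F \<subseteq> V \<and> finite F})"
      proof (rule bdd_aboveI2)
        fix K assume "K \<in> {F. F \<subseteq> V \<and> finite F}"
        then have K: "finite K" "K \<subseteq> V" by auto
        let ?F = "\<Union>v\<in>K. incident_edges E v"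
        have F: "finite ?F" "?F \<subseteq> E" using K gr(3) by (auto simp: incident_edges_iff)
        have "(\<Sum>v\<in>K. vm E len v * (cmod (f v))\<^sup>2) = (\<Sum>v\<in>K. \<Sum>e\<in>incident_edges E v. len e * (cmod (f v))\<^sup>2)"
          by (simp add: vm_def sum_distrib_right)
        also have "\<dots> = (\<Sum>e\<in>?F. (if fst e \<in> K then len e * (cmod (f (fst e)))\<^sup>2 else 0) + (if snd e \<in> K then len e * (cmod (f (snd e)))\<^sup>2 else 0))"
          by (rule sum_vertices_incident[OF G K])
        also have "\<dots> \<le> (\<Sum>e\<in>?F. M * I e)"
        proof (rule sum_mono)
          fix e assume "e \<in> ?F"
          then have eE: "e \<in> E" using F by auto
          have "0 \<le> len e * (cmod (f (fst e)))\<^sup>2" "0 \<le> len e * (cmod (f (snd e)))\<^sup>2" using gr(9)[OF eE] by simp_all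
          then show "(if fst e \<in> K then len e * (cmod (f (fst e)))\<^sup>2 else 0) + (if snd e \<in> K then len e * (cmod (f (snd e)))\<^sup>2 else 0) \<le> M * I e"
            using tr[OF eE] by (auto simp: distrib_left)
        qed
        also have "\<dots> \<le> M * infsum I E"
          unfolding sum_distrib_left[symmetric]
          by (intro mult_left_mono finite_sum_le_infsum[OF Is] F M0 I0)
        finally show "(\<Sum>v\<in>K. vm E len v * (cmod (f v))\<^sup>2) \<le> M * infsum I E" .
      qed
    qed
  qed
  \<comment> \<open>Sum and difference of the two end values isolate the even and the odd
    coefficient.\<close>
  have "s e 0 = 0" "s e (len e) = 0" using f0 fends[OF e] gr(5,6)[OF e] by auto
  then have "p e * \<kappa> e = 0" "q e * \<sigma> e = 0" unfolding ends by (auto simp: algebra_simps)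
  then have "p e = 0" "q e = 0" using pos[OF e] by auto
  then show ?thesis using ae[OF e] by (simp add: s_def)
qed

section \<open>Self-adjointness\<close>

text \<open>A pair \<open>(u, w)\<close> of \<open>R\<close> with \<open>u + w\<close> near
  \<open>h + k\<close> is itself near \<open>(h, k)\<close>. With \<open>d = h - u\<close> and
  \<open>r = (h + k) - (u + w)\<close>, adjointness and symmetry give
  \<open><f + g, d> = <f, r>\<close> on \<open>R\<close>, and nonnegativity gives
  \<open>norm f \<le> norm (f + g)\<close>. Letting \<open>f + g\<close> tend to \<open>d\<close>
  bounds \<open>d\<close> by a multiple of \<open>r\<close> in norm, and
  \<open>k - w = r - d\<close>.\<close>

lemma nonneg_symmetric_closure_of_adjoint:
  assumes R: "\<And>f g. (f, g) \<in> R \<Longrightarrow> L2_on M f \<and> L2_on M g"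
    and sym: "\<And>f g u w. (f, g) \<in> R \<Longrightarrow> (u, w) \<in> R \<Longrightarrow> l2_prod M g u = l2_prod M f w"
    and nonneg: "\<And>f g. (f, g) \<in> R \<Longrightarrow> 0 \<le> Re (l2_prod M g f)"
    and h: "L2_on M h" and k: "L2_on M k"
    and adj: "\<And>f g. (f, g) \<in> R \<Longrightarrow> l2_prod M g h = l2_prod M f k"
    and dense: "\<And>\<epsilon>. \<epsilon> > 0 \<Longrightarrow> \<exists>(f, g)\<in>R. l2_sq M (\<lambda>x. (f x + g x) - (h x + k x)) < \<epsilon>"
    and dense': "\<And>u w \<epsilon>. (u, w) \<in> R \<Longrightarrow> \<epsilon> > 0 \<Longrightarrow> \<exists>(f, g)\<in>R. l2_sq M (\<lambda>x. (f x + g x) - (h x - u x)) < \<epsilon>"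
    and \<epsilon>: "\<epsilon> > 0"
  shows "\<exists>(f, g)\<in>R. l2_sq M (\<lambda>x. f x - h x) < \<epsilon> \<and> l2_sq M (\<lambda>x. g x - k x) < \<epsilon>"
proof -
  \<comment> \<open>Squared error \<open>\<epsilon> / 8\<close> for \<open>r\<close> leads to
    \<open>\<epsilon> / 4\<close> for \<open>d\<close> and to \<open>3 * \<epsilon> / 4\<close> for
    \<open>k - w\<close>.\<close>
  obtain u w where uw: "(u, w) \<in> R" and small: "l2_sq M (\<lambda>x. (u x + w x) - (h x + k x)) < \<epsilon> / 8"
    using dense[of "\<epsilon> / 8"] \<epsilon> by auto
  have us: "L2_on M u" "L2_on M w" using R[OF uw] by auto
  define d where "d x = h x - u x" for x
  define r where "r x = (h x + k x) - (u x + w x)" for x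
  have ds: "L2_on M d" unfolding d_def[abs_def] by (intro L2_on_diff h us)
  have rs: "L2_on M r" unfolding r_def[abs_def] by (intro L2_on_diff L2_on_add h k us)
  have nr: "l2_sq M r < \<epsilon> / 8" using small unfolding r_def[abs_def] by (subst l2_sq_diff_commute)
  have bound: "(cmod (l2_prod M (\<lambda>x. f x + g x) d))\<^sup>2 \<le> l2_sq M (\<lambda>x. f x + g x) * l2_sq M r" if fg: "(f, g) \<in> R" for f g
  proof -
    have fs: "L2_on M f" "L2_on M g" using R[OF fg] by auto
    have "l2_prod M (\<lambda>x. f x + g x) d = l2_prod M f r"
      unfolding d_def[abs_def] r_def[abs_def] using fs us h k
      by (simp add: l2_prod_add_left l2_prod_diff_right l2_prod_add_right L2_on_add L2_on_diff adj[OF fg] sym[OF fg uw])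
    moreover have "(cmod (l2_prod M f r))\<^sup>2 \<le> l2_sq M f * l2_sq M r" by (rule l2_prod_Cauchy_Schwarz[OF fs(1) rs])
    moreover have "l2_sq M f \<le> l2_sq M (\<lambda>x. f x + g x)"
      using nonneg[OF fg] l2_sq_add[OF fs] l2_prod_cnj[of M f g] by simp
    then have "l2_sq M f * l2_sq M r \<le> l2_sq M (\<lambda>x. f x + g x) * l2_sq M r" by (intro mult_right_mono) auto
    ultimately show ?thesis by simp
  qed
  have "\<exists>s. L2_on M s \<and> l2_sq M (\<lambda>x. s x - d x) < inverse (real (Suc n)) \<and> (cmod (l2_prod M s d))\<^sup>2 \<le> l2_sq M s * l2_sq M r" for n
  proof -
    obtain f g where fg: "(f, g) \<in> R" and "l2_sq M (\<lambda>x. (f x + g x) - d x) < inverse (real (Suc n))"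
      using dense'[OF uw, of "inverse (real (Suc n))"] unfolding d_def by auto
    then show ?thesis using bound[OF fg] R[OF fg] L2_on_add by blast
  qed
  then obtain s where s: "\<And>n. L2_on M (s n)" "\<And>n. l2_sq M (\<lambda>x. s n x - d x) < inverse (real (Suc n))"
      "\<And>n. (cmod (l2_prod M (s n) d))\<^sup>2 \<le> l2_sq M (s n) * l2_sq M r" by metis
  have l0: "(\<lambda>n. l2_sq M (\<lambda>x. s n x - d x)) \<longlonglongrightarrow> 0"
    by (rule Lim_null_comparison[OF always_eventually LIMSEQ_inverse_real_of_nat])
       (use s(2) less_imp_le in auto)
  have l1: "(\<lambda>n. (cmod (l2_prod M (s n) d))\<^sup>2) \<longlonglongrightarrow> (cmod (l2_prod M d d))\<^sup>2"
    by (intro tendsto_power tendsto_norm l2_prod_tendsto_left s ds l0)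
  have l2: "(\<lambda>n. (2 * l2_sq M (\<lambda>x. s n x - d x) + 2 * l2_sq M d) * l2_sq M r) \<longlonglongrightarrow> (2 * 0 + 2 * l2_sq M d) * l2_sq M r"
    by (intro tendsto_mult tendsto_add tendsto_const l0)
  have "(cmod (l2_prod M (s n) d))\<^sup>2 \<le> (2 * l2_sq M (\<lambda>x. s n x - d x) + 2 * l2_sq M d) * l2_sq M r" for n
  proof -
    have "l2_sq M (s n) \<le> 2 * l2_sq M (\<lambda>x. s n x - d x) + 2 * l2_sq M d"
      using l2_sq_add_le[OF L2_on_diff[OF s(1) ds] ds, of n] by simp
    then have "l2_sq M (s n) * l2_sq M r \<le> (2 * l2_sq M (\<lambda>x. s n x - d x) + 2 * l2_sq M d) * l2_sq M r"
      by (intro mult_right_mono) auto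
    then show ?thesis using s(3)[of n] by linarith
  qed
  then have "(cmod (l2_prod M d d))\<^sup>2 \<le> (2 * 0 + 2 * l2_sq M d) * l2_sq M r"
    by (intro LIMSEQ_le[OF l1 l2]) auto
  then have "l2_sq M d * l2_sq M d \<le> l2_sq M d * (2 * l2_sq M r)"
    by (simp add: l2_prod_self power2_eq_square)
  then have nd: "l2_sq M d \<le> 2 * l2_sq M r"
    using l2_sq_nonneg[of M d] l2_sq_nonneg[of M r] mult_le_cancel_left_pos[of "l2_sq M d"]
    by (cases "l2_sq M d = 0") auto
  have "(\<lambda>x. k x - w x) = (\<lambda>x. r x - d x)" by (auto simp: r_def d_def)
  then have "l2_sq M (\<lambda>x. k x - w x) = l2_sq M (\<lambda>x. r x - d x)" by simp
  also have "\<dots> \<le> 2 * l2_sq M r + 2 * l2_sq M d"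
    using l2_sq_parallelogram[OF rs ds] l2_sq_nonneg[of M "\<lambda>x. r x + d x"] by linarith
  finally have "l2_sq M (\<lambda>x. w x - k x) < \<epsilon>" using nd nr \<epsilon> by (subst l2_sq_diff_commute) linarith
  moreover have "l2_sq M (\<lambda>x. u x - h x) < \<epsilon>"
    using nd nr \<epsilon> by (subst l2_sq_diff_commute) (simp add: d_def[abs_def])
  ultimately show ?thesis using uw by blast
qed

section \<open>Density of the range and of the domain of the core\<close>

lemma L2G_dense:
  assumes G: "metric_graph V E len"
    and S: "\<And>s. s \<in> S \<Longrightarrow> L2G E len s"
    and comb: "\<And>s t c. s \<in> S \<Longrightarrow> t \<in> S \<Longrightarrow> (\<lambda>e x. s e x + c * t e x) \<in> S"
    and ne: "S \<noteq> {}"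
    and orth: "\<And>z e. L2G E len z \<Longrightarrow> (\<And>s. s \<in> S \<Longrightarrow> L2inner E len s z = 0) \<Longrightarrow> e \<in> E
      \<Longrightarrow> AE x in lborel. x \<in> {0<..<len e} \<longrightarrow> z e x = 0"
    and w: "L2G E len w" and \<epsilon>: "\<epsilon> > 0"
  shows "\<exists>s\<in>S. l2_sq (edgeM E) (\<lambda>p. flat len s p - flat len w p) < \<epsilon>"
proof -
  have E: "countable E" by (rule graphD(2)[OF G])
  note iff = L2G_iff_L2_on[OF E]
  have "\<exists>t\<in>flat len ` S. l2_sq (edgeM E) (\<lambda>p. t p - flat len w p) < \<epsilon>"
  proof (rule subspace_dense_if_orthogonal_trivial)
    show "\<And>t. t \<in> flat len ` S \<Longrightarrow> L2_on (edgeM E) t" using S iff by auto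
    show "(\<lambda>x. s x + c * t x) \<in> flat len ` S" if st: "s \<in> flat len ` S" "t \<in> flat len ` S" for s t c
    proof -
      obtain a b where ab: "a \<in> S" "b \<in> S" "s = flat len a" "t = flat len b" using st by auto
      have "flat len (\<lambda>e x. a e x + c * b e x) = (\<lambda>x. s x + c * t x)"
        unfolding ab flat_add flat_cmult ..
      from this[symmetric] comb[OF ab(1,2)] show ?thesis by (rule image_eqI)
    qed
    show "flat len ` S \<noteq> {}" using ne by simp
    show "L2_on (edgeM E) (flat len w)" using w iff by simp
    show "\<epsilon> > 0" by (rule \<epsilon>)
    fix z assume z: "L2_on (edgeM E) z" and o: "\<And>s. s \<in> flat len ` S \<Longrightarrow> l2_prod (edgeM E) s z = 0"
    \<comment> \<open>\<open>z\<close> may be nonzero outside the edge intervals, so only its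
      restriction to them is shown to vanish; this is enough for its product with \<open>w\<close>,
      whose flattening is zero elsewhere.\<close>
    define y where "y = (\<lambda>e x. z (e, x))"
    have y: "L2G E len y" unfolding iff y_def by (rule flat_curry_L2_on(1)[OF E z])
    have yi: "l2_prod (edgeM E) (flat len s) z = L2inner E len s y" if "L2G E len s" for s
      unfolding L2inner_eq_l2_prod[OF E that y] unfolding y_def by (rule flat_curry_L2_on(2)[OF E z])
    have "L2inner E len s y = 0" if "s \<in> S" for s
      using o[of "flat len s"] yi[OF S[OF that]] that by simp
    then have ae: "AE x in lborel. x \<in> {0<..<len e} \<longrightarrow> y e x = 0" if "e \<in> E" for e
      using orth[OF y _ that] by blast
    have "edge_int len e (\<lambda>x. w e x * cnj (y e x)) = 0" if "e \<in> E" for e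
      unfolding edge_int_def set_lebesgue_integral_def
      by (rule integral_eq_zero_AE) (use ae[OF that] in \<open>auto elim!: eventually_mono simp: indicator_def\<close>)
    then have "L2inner E len w y = 0" unfolding L2inner_def by (intro infsum_0) auto
    then show "l2_prod (edgeM E) (flat len w) z = 0" using yi[OF w] by simp
  qed
  then show ?thesis by blast
qed

lemma kirchhoff_core_zero:
  assumes "metric_graph V E len"
  shows "(\<lambda>_ _. 0, \<lambda>_ _. 0) \<in> kirchhoff_core V E len"
proof -
  have "vval len (\<lambda>_ _. 0) e v = 0" "vder len (\<lambda>_ _. 0) e v = 0" for e :: "'a edge" and v
    by (simp_all add: vval_def vder_def)
  then have "core_data V E len (\<lambda>_ _. 0) (\<lambda>_ _. 0) (\<lambda>_ _. 0) (\<lambda>_ _. 0)"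
    unfolding core_data_def by (auto simp: ac_deriv_const intro!: sq_int_cont continuous_intros)
  then show ?thesis unfolding kirchhoff_core_iff[OF assms] by blast
qed

lemma core_range_dense:
  assumes G: "metric_graph V E len" and \<rho>: "intrinsic V E len \<rho>"
    and Dg: "\<forall>v \<in> V. \<forall>r \<ge> 0. \<exists>C. \<forall>u \<in> dball V \<rho> r v. wDeg E len u \<le> C"
    and w: "L2G E len w" and \<epsilon>: "\<epsilon> > 0"
  shows "\<exists>(f, h)\<in>kirchhoff_core V E len. l2_sq (edgeM E) (\<lambda>p. flat len (\<lambda>e x. f e x + h e x) p - flat len w p) < \<epsilon>"
proof -
  define S where "S = {(\<lambda>e x. f e x + h e x) | f h. (f, h) \<in> kirchhoff_core V E len}"
  have E: "countable E" by (rule graphD(2)[OF G])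
  have "\<exists>s\<in>S. l2_sq (edgeM E) (\<lambda>p. flat len s p - flat len w p) < \<epsilon>"
  proof (rule L2G_dense[OF G _ _ _ _ w \<epsilon>])
    show "L2G E len s" if "s \<in> S" for s
      using that kirchhoff_core_L2G[OF G] unfolding S_def
      by (auto simp: L2G_iff_L2_on[OF E] flat_add intro!: L2_on_add)
    show "(\<lambda>e x. s e x + c * t e x) \<in> S" if st: "s \<in> S" "t \<in> S" for s t c
    proof -
      obtain f h f' h' where c: "(f, h) \<in> kirchhoff_core V E len" "(f', h') \<in> kirchhoff_core V E len"
        and eq: "s = (\<lambda>e x. f e x + h e x)" "t = (\<lambda>e x. f' e x + h' e x)"
        using st unfolding S_def by blast
      have "(\<lambda>e x. s e x + c * t e x) = (\<lambda>e x. (f e x + c * f' e x) + (h e x + c * h' e x))"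
        unfolding eq by (simp add: algebra_simps)
      then show ?thesis
        unfolding S_def using kirchhoff_core_comb[OF G c, of c]
        by (intro CollectI exI[of _ "\<lambda>e x. f e x + c * f' e x"] exI[of _ "\<lambda>e x. h e x + c * h' e x"] conjI)
    qed
    show "S \<noteq> {}" using kirchhoff_core_zero[OF G] unfolding S_def by blast
    show "AE x in lborel. x \<in> {0<..<len e} \<longrightarrow> z e x = 0"
      if z: "L2G E len z" "\<And>s. s \<in> S \<Longrightarrow> L2inner E len s z = 0" "e \<in> E" for z e
      by (rule deficiency_element_zero[OF G \<rho> Dg z(1) _ z(3)]) (rule z(2), auto simp: S_def)
  qed
  then show ?thesis unfolding S_def by blast
qed

text \<open>Bumps supported on single edges already have a trivial orthogonal complement.\<close>

lemma core_domain_dense: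
  assumes G: "metric_graph V E len" and w: "L2G E len w" and \<epsilon>: "\<epsilon> > 0"
  shows "\<exists>(f, h)\<in>kirchhoff_core V E len. l2_sq (edgeM E) (\<lambda>p. flat len f p - flat len w p) < \<epsilon>"
proof -
  note gr = graphD[OF G]
  have "\<exists>s\<in>fst ` kirchhoff_core V E len. l2_sq (edgeM E) (\<lambda>p. flat len s p - flat len w p) < \<epsilon>"
  proof (rule L2G_dense[OF G _ _ _ _ w \<epsilon>])
    show "L2G E len s" if "s \<in> fst ` kirchhoff_core V E len" for s
      using that kirchhoff_core_L2G[OF G] by auto
    show "(\<lambda>e x. s e x + c * t e x) \<in> fst ` kirchhoff_core V E len"
      if st: "s \<in> fst ` kirchhoff_core V E len" "t \<in> fst ` kirchhoff_core V E len" for s t c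
    proof -
      obtain h h' where "(s, h) \<in> kirchhoff_core V E len" "(t, h') \<in> kirchhoff_core V E len" using st by auto
      from fst_conv[symmetric] kirchhoff_core_comb[OF G this, of c] show ?thesis by (rule image_eqI)
    qed
    show "fst ` kirchhoff_core V E len \<noteq> {}" using kirchhoff_core_zero[OF G] by blast
    fix z e assume z: "L2G E len z" "\<And>s. s \<in> fst ` kirchhoff_core V E len \<Longrightarrow> L2inner E len s z = 0" and e: "e \<in> E"
    show "AE x in lborel. x \<in> {0<..<len e} \<longrightarrow> z e x = 0"
    proof (rule edge_orthogonal_bumps_imp_zero[OF gr(9)[OF e] L2G_sq_int[OF z(1) e]])
      fix \<phi> \<phi>1 g assume a: "sq_int (len e) g" "ac_deriv (len e) \<phi> \<phi>1" "ac_deriv (len e) \<phi>1 g" "\<phi> 0 = 0" "\<phi>1 0 = 0" "\<phi> (len e) = 0" "\<phi>1 (len e) = 0"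
      have "(\<lambda>e' x. if e' = e then \<phi> x else 0) \<in> fst ` kirchhoff_core V E len"
        by (rule image_eqI[OF _ bump_in_core[OF G e a]]) simp
      then have "0 = L2inner E len (\<lambda>e' x. if e' = e then \<phi> x else 0) z" using z(2) by simp
      also have "\<dots> = (\<Sum>e'\<in>{e}. LINT x:{0..len e'}|lborel. (if e' = e then \<phi> x else 0) * cnj (z e' x))"
        by (rule L2inner_finite_support) (use e in auto)
      finally show "(LINT x:{0..len e}|lborel. \<phi> x * cnj (z e x)) = 0" by simp
    qed
  qed
  then show ?thesis by force
qed

section \<open>The closed operator and its adjoint\<close>

lemma H0_iff:
  assumes G: "metric_graph V E len"
  shows "(f, g) \<in> H0 V E len \<longleftrightarrow> L2G E len f \<and> L2G E len g \<and>
    (\<exists>F H. (\<forall>n. (F n, H n) \<in> kirchhoff_core V E len) \<and>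
      (\<lambda>n. l2_sq (edgeM E) (\<lambda>p. flat len (F n) p - flat len f p)) \<longlonglongrightarrow> 0 \<and>
      (\<lambda>n. l2_sq (edgeM E) (\<lambda>p. flat len (H n) p - flat len g p)) \<longlonglongrightarrow> 0)"
proof -
  have E: "countable E" by (rule graphD(2)[OF G])
  have conv: "(\<lambda>n. L2dist E len (F n) f) \<longlonglongrightarrow> 0 \<longleftrightarrow> (\<lambda>n. l2_sq (edgeM E) (\<lambda>p. flat len (F n) p - flat len f p)) \<longlonglongrightarrow> 0"
    if "\<And>n. L2G E len (F n)" "L2G E len f" for F f
  proof -
    have eq: "(\<lambda>n. L2dist E len (F n) f) = (\<lambda>n. sqrt (l2_sq (edgeM E) (\<lambda>p. flat len (F n) p - flat len f p)))"
      using that by (simp add: L2dist_eq_l2_sq[OF E])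
    show ?thesis
    proof
      assume "(\<lambda>n. L2dist E len (F n) f) \<longlonglongrightarrow> 0"
      then have "(\<lambda>n. sqrt (l2_sq (edgeM E) (\<lambda>p. flat len (F n) p - flat len f p))) \<longlonglongrightarrow> 0"
        by (simp only: eq)
      from tendsto_power[OF this, of 2] show "(\<lambda>n. l2_sq (edgeM E) (\<lambda>p. flat len (F n) p - flat len f p)) \<longlonglongrightarrow> 0"
        by simp
    next
      assume "(\<lambda>n. l2_sq (edgeM E) (\<lambda>p. flat len (F n) p - flat len f p)) \<longlonglongrightarrow> 0"
      from tendsto_real_sqrt[OF this] show "(\<lambda>n. L2dist E len (F n) f) \<longlonglongrightarrow> 0"
        by (simp only: eq real_sqrt_zero)
    qed
  qed
  show ?thesis
    unfolding H0_def graph_closure_def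
    using conv kirchhoff_core_L2G[OF G] by (auto; blast)
qed

lemma kirchhoff_core_subset_H0:
  assumes G: "metric_graph V E len" and c: "(f, h) \<in> kirchhoff_core V E len"
  shows "(f, h) \<in> H0 V E len"
  unfolding H0_iff[OF G] using kirchhoff_core_L2G[OF G c] c
  by (intro conjI exI[of _ "\<lambda>_. f"] exI[of _ "\<lambda>_. h"]) (auto simp: l2_sq_def)

lemma H0_densely_defined:
  assumes G: "metric_graph V E len"
  shows "densely_defined E len (H0 V E len)"
  unfolding densely_defined_def
proof (intro allI impI)
  fix f and \<epsilon> :: real assume f: "L2G E len f" and \<epsilon>: "0 < \<epsilon>"
  have E: "countable E" by (rule graphD(2)[OF G])
  obtain u h where c: "(u, h) \<in> kirchhoff_core V E len" and l: "l2_sq (edgeM E) (\<lambda>p. flat len u p - flat len f p) < \<epsilon>\<^sup>2"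
    using core_domain_dense[OF G f, of "\<epsilon>\<^sup>2"] \<epsilon> by auto
  have "L2dist E len u f < \<epsilon>"
    unfolding L2dist_eq_l2_sq[OF E kirchhoff_core_L2G(1)[OF G c] f]
    using l \<epsilon> by (intro real_less_lsqrt) auto
  then show "\<exists>(u, w)\<in>H0 V E len. L2dist E len u f < \<epsilon>"
    using kirchhoff_core_subset_H0[OF G c] by blast
qed

text \<open>Limits are taken in one slot at a time: with \<open>n\<close> fixed the second pair is
  replaced by its limit, conjugation exchanges the slots, and the first pair follows. Convergence of
  the products is needed only against a fixed element.\<close>

lemma H0_symmetric:
  assumes G: "metric_graph V E len" and fg: "(f, g) \<in> H0 V E len" and hk: "(h, k) \<in> H0 V E len"
  shows "L2inner E len g h = L2inner E len f k"
proof -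
  have E: "countable E" by (rule graphD(2)[OF G])
  let ?M = "edgeM E"
  obtain F Gn where FG: "\<And>n. (F n, Gn n) \<in> kirchhoff_core V E len"
    "(\<lambda>n. l2_sq ?M (\<lambda>p. flat len (F n) p - flat len f p)) \<longlonglongrightarrow> 0"
    "(\<lambda>n. l2_sq ?M (\<lambda>p. flat len (Gn n) p - flat len g p)) \<longlonglongrightarrow> 0" and fgL: "L2G E len f" "L2G E len g"
    using fg unfolding H0_iff[OF G] by blast
  obtain H K where HK: "\<And>n. (H n, K n) \<in> kirchhoff_core V E len"
    "(\<lambda>n. l2_sq ?M (\<lambda>p. flat len (H n) p - flat len h p)) \<longlonglongrightarrow> 0"
    "(\<lambda>n. l2_sq ?M (\<lambda>p. flat len (K n) p - flat len k p)) \<longlonglongrightarrow> 0" and hkL: "L2G E len h" "L2G E len k"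
    using hk unfolding H0_iff[OF G] by blast
  note L = kirchhoff_core_L2G[OF G FG(1)] kirchhoff_core_L2G[OF G HK(1)] fgL hkL
  note s = L[unfolded L2G_iff_L2_on[OF E]]
  have 1: "l2_prod ?M (flat len (H m)) (flat len (Gn n)) = l2_prod ?M (flat len (K m)) (flat len (F n))" for m n
    using core_symmetric[OF G HK(1) FG(1), of m n] L by (simp add: L2inner_eq_l2_prod[OF E])
  have 2: "l2_prod ?M (flat len h) (flat len (Gn n)) = l2_prod ?M (flat len k) (flat len (F n))" for n
    using l2_prod_tendsto_left[OF s(3) s(7) s(2)[of n] HK(2)] l2_prod_tendsto_left[OF s(4) s(8) s(1)[of n] HK(3)]
    unfolding 1 by (rule LIMSEQ_unique)
  have 3: "l2_prod ?M (flat len (Gn n)) (flat len h) = l2_prod ?M (flat len (F n)) (flat len k)" for n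
    using 2[of n] by (metis l2_prod_cnj)
  have "l2_prod ?M (flat len g) (flat len h) = l2_prod ?M (flat len f) (flat len k)"
    using l2_prod_tendsto_left[OF s(2) s(6) s(7) FG(3)] l2_prod_tendsto_left[OF s(1) s(5) s(8) FG(2)]
    unfolding 3 by (rule LIMSEQ_unique)
  then show ?thesis using L by (simp add: L2inner_eq_l2_prod[OF E])
qed

theorem mainTheorem6:
  fixes V :: "'v set" and E :: "'v edge set" and len :: "'v edge \<Rightarrow> real"
    and \<rho> :: "'v \<Rightarrow> 'v \<Rightarrow> real"
  assumes "metric_graph V E len"
    and "intrinsic V E len \<rho>"
    and "\<forall>v \<in> V. \<forall>r \<ge> 0. \<exists>C. \<forall>u \<in> dball V \<rho> r v. wDeg E len u \<le> C"
  shows "self_adjoint_op E len (H0 V E len)"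
proof -
  note G = assms(1)
  have E: "countable E" by (rule graphD(2)[OF G])
  let ?M = "edgeM E"
  let ?R = "map_prod (flat len) (flat len) ` kirchhoff_core V E len"
  note iff = L2G_iff_L2_on[OF E]
  have core: "L2G E len f" "L2G E len h" if "(f, h) \<in> kirchhoff_core V E len" for f h
    using kirchhoff_core_L2G[OF G that] by auto
  \<comment> \<open>The half that relies on the metric. Equality of the two graphs as sets of
    functions is possible because both see a function only through its values on the open
    edges.\<close>
  have "(h, k) \<in> H0 V E len" if adj: "(h, k) \<in> graph_adjoint E len (H0 V E len)" for h k
  proof -
    have L: "L2G E len h" "L2G E len k" and
      A0: "\<forall>(f, g)\<in>H0 V E len. L2inner E len g h = L2inner E len f k"
      using adj unfolding graph_adjoint_def by auto
    have A: "L2inner E len g h = L2inner E len f k" if "(f, g) \<in> kirchhoff_core V E len" for f g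
      using A0 kirchhoff_core_subset_H0[OF G that] by blast
    have dense: "\<exists>(f, g)\<in>?R. l2_sq ?M (\<lambda>p. (f p + g p) - flat len w p) < \<epsilon>" if w: "L2G E len w" "\<epsilon> > 0" for w \<epsilon>
      using core_range_dense[OF G assms(2,3) w] by (force simp: flat_add)
    have approx: "\<exists>(f, g)\<in>?R. l2_sq ?M (\<lambda>p. f p - flat len h p) < \<epsilon> \<and> l2_sq ?M (\<lambda>p. g p - flat len k p) < \<epsilon>"
      if \<epsilon>: "\<epsilon> > 0" for \<epsilon>
    proof (rule nonneg_symmetric_closure_of_adjoint[OF _ _ _ _ _ _ _ _ \<epsilon>])
      show "L2_on ?M f \<and> L2_on ?M g" if "(f, g) \<in> ?R" for f g
        using that core iff by auto
      show "l2_prod ?M g u = l2_prod ?M f w" if "(f, g) \<in> ?R" "(u, w) \<in> ?R" for f g u w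
        using that core core_symmetric[OF G] by (auto simp flip: L2inner_eq_l2_prod[OF E])
      show "0 \<le> Re (l2_prod ?M g f)" if "(f, g) \<in> ?R" for f g
        using that core core_nonneg[OF G] by (auto simp flip: L2inner_eq_l2_prod[OF E])
      show "l2_prod ?M g (flat len h) = l2_prod ?M f (flat len k)" if "(f, g) \<in> ?R" for f g
        using that core A L by (auto simp flip: L2inner_eq_l2_prod[OF E])
      show "L2_on ?M (flat len h)" "L2_on ?M (flat len k)" using L iff by auto
      show "\<exists>(f, g)\<in>?R. l2_sq ?M (\<lambda>p. (f p + g p) - (flat len h p + flat len k p)) < \<delta>" if "\<delta> > 0" for \<delta>
        using dense[of "\<lambda>e x. h e x + k e x" \<delta>] L that by (simp add: iff flat_add L2_on_add)
      show "\<exists>(f, g)\<in>?R. l2_sq ?M (\<lambda>p. (f p + g p) - (flat len h p - u p)) < \<delta>" if uw: "(u, w) \<in> ?R" and \<delta>: "\<delta> > 0" for u w \<delta>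
      proof -
        obtain a a' where a: "(a, a') \<in> kirchhoff_core V E len" "u = flat len a" using uw by auto
        with core(1)[OF a(1)] show ?thesis
          using dense[of "\<lambda>e x. h e x - a e x" \<delta>] L \<delta> by (simp add: iff flat_diff L2_on_diff)
      qed
    qed
    \<comment> \<open>Errors below \<open>1 / (n + 1)\<close> turn the approximation for each
      \<open>\<epsilon>\<close> into one sequence of core pairs, as the closure demands; a single
      predicate lets both components be chosen together.\<close>
    define near where "near n f g \<longleftrightarrow> (f, g) \<in> kirchhoff_core V E len
      \<and> l2_sq ?M (\<lambda>p. flat len f p - flat len h p) < inverse (real (Suc n))
      \<and> l2_sq ?M (\<lambda>p. flat len g p - flat len k p) < inverse (real (Suc n))" for n f g
    have "\<exists>f g. near n f g" for n
    proof -
      have "0 < inverse (real (Suc n))" by simp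
      from approx[OF this] obtain a b where "(a, b) \<in> kirchhoff_core V E len"
        "l2_sq ?M (\<lambda>p. flat len a p - flat len h p) < inverse (real (Suc n))"
        "l2_sq ?M (\<lambda>p. flat len b p - flat len k p) < inverse (real (Suc n))" by auto
      then show ?thesis unfolding near_def by blast
    qed
    then obtain F K where "\<And>n. near n (F n) (K n)" by metis
    then have FK: "\<And>n. (F n, K n) \<in> kirchhoff_core V E len"
      "\<And>n. l2_sq ?M (\<lambda>p. flat len (F n) p - flat len h p) < inverse (real (Suc n))"
      "\<And>n. l2_sq ?M (\<lambda>p. flat len (K n) p - flat len k p) < inverse (real (Suc n))"
      unfolding near_def by blast+
    have null: "(\<lambda>n. x n) \<longlonglongrightarrow> 0" if "\<And>n. 0 \<le> x n" "\<And>n. x n < inverse (real (Suc n))" for x :: "nat \<Rightarrow> real"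
      by (rule Lim_null_comparison[OF always_eventually LIMSEQ_inverse_real_of_nat])
         (use that less_imp_le in auto)
    show ?thesis
      unfolding H0_iff[OF G] using L FK(1) null[OF l2_sq_nonneg FK(2)] null[OF l2_sq_nonneg FK(3)] by blast
  qed
  moreover have "(h, k) \<in> graph_adjoint E len (H0 V E len)" if hk: "(h, k) \<in> H0 V E len" for h k
    unfolding graph_adjoint_def using hk H0_symmetric[OF G _ hk] by (auto simp: H0_iff[OF G])
  ultimately have "graph_adjoint E len (H0 V E len) = H0 V E len" by auto
  then show ?thesis using H0_densely_defined[OF G] by (simp add: self_adjoint_op_def)
qed

end
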